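(* Let $d\ge 1$, $H\in(\tfrac12,1)$, $0<t_0<T$, and assume $\beta\in\big(2H-1,\ d\wedge(2H+1)\big)$. Let $u$ be the mild solution of the linear stochastic wave equation with zero initial conditions driven by the fractional-colored noise $W$ with Hurst index $H$ and Riesz spatial covariance of parameter $\beta$ (as defined in the context). Then for any $t\in[t_0,T]$ the map $x\mapsto u(t,x)$ is almost surely H\"older continuous of order $\delta\in\big(0,\big(\frac{2H+1-\beta}{2}\big)\wedge1\big)$.
   Context: Fourier transform convention: $\mathcal F\varphi(\xi)=\int_{\mathbb R^d}e^{-i\xi\cdot x}\varphi(x)\,dx$. Let $\mu(d\xi)=|\xi|^{-d+\beta}d\xi$ on $\mathbb R^d$, $0<\beta<d$, and let $f$ be the Fourier transform of $\mu$ in $\mathcal S'(\mathbb R^d)$, i.e. $\int f\varphi\,dx=\int\mathcal F\varphi\,d\mu$ for $\varphi\in\mathcal S(\mathbb R^d)$ (the Riesz kernel, a constant multiple of $|x|^{-\beta}$). Let $R_H(t,s)=\frac12(t^{2H}+s^{2H}-|t-s|^{2H})$ and $\alpha_H=H(2H-1)$. The noise $W=\{W_t(A):t\ge0,\ A\subset\mathbb R^d \text{ bounded Borel}\}$ is a centered Gaussian family with covariance $\mathbf E(W_t(A)W_s(B))=R_H(t,s)\int_A\int_B f(x-y)\,dx\,dy$. The Hilbert space $\mathcal{HP}$ is the completion of the linear span of the functions $1_{[0,t]\times A}$ for the inner product $\langle\varphi,\psi\rangle_{\mathcal{HP}}=\alpha_H\int_{\mathbb R^d}\int_0^\infty\int_0^\infty\mathcal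 F\varphi(r,\cdot)(\xi)\overline{\mathcal F\psi(v,\cdot)(\xi)}|r-v|^{2H-2}\,dr\,dv\,\mu(d\xi)$, and $1_{[0,t]\times A}\mapsto W_t(A)$ extends to an isometry $\varphi\mapsto W(\varphi)=\int_0^\infty\int_{\mathbb R^d}\varphi\,dW$ from $\mathcal{HP}$ into $L^2(\Omega)$. The stochastic wave equation is $\partial_t^2u=\Delta u+\dot W$ on $(0,\infty)\times\mathbb R^d$, $u(0,\cdot)=0$, $\partial_tu(0,\cdot)=0$. Let $G_1$ be the fundamental solution of $u_{tt}-\Delta u=0$, with $\mathcal FG_1(t,\cdot)(\xi)=\sin(t|\xi|)/|\xi|$. The (mild) solution is the centered Gaussian process $u(t,x)=\int_0^t\int_{\mathbb R^d}G_1(t-s,x-y)\,W(ds,dy)$, i.e. $u(t,x)=W(g_{t,x})$ with $g_{t,x}=G_1(t-\cdot,x-\cdot)1_{[0,t]}$; it is well defined for $\beta\in(0,d\wedge(2H+1))$. Equivalently, $u$ is centered Gaussian with $$\mathbf E[u(t,x)u(s,y)]=\alpha_H\int_{\mathbb R^d}\mu(d\xi)\,e^{-i\xi\cdot(x-y)}\int_0^t\int_0^s\frac{\sin((t-r)|\xi|)\,\sin((s-v)|\xi|)}{|\xi|^2}\,|r-v|^{2H-2}\,dv\,dr .$$ *)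

theory Defs
  imports "HOL-Probability.Probability"
begin

definition fourier :: "('a::euclidean_space \<Rightarrow> complex) \<Rightarrow> 'a \<Rightarrow> complex" where
  "fourier \<phi> \<xi> = (LINT x|lborel. cis (- (\<xi> \<bullet> x)) * \<phi> x)"

fun iter_deriv :: "'a::euclidean_space list \<Rightarrow> ('a \<Rightarrow> complex) \<Rightarrow> 'a \<Rightarrow> complex" where
  "iter_deriv [] \<phi> = \<phi>"
| "iter_deriv (b # bs) \<phi> = (\<lambda>x. frechet_derivative (iter_deriv bs \<phi>) (at x) b)"

definition schwartz :: "('a::euclidean_space \<Rightarrow> complex) \<Rightarrow> bool" where
  "schwartz \<phi> \<longleftrightarrow>
    (\<forall>bs. set bs \<subseteq> Basis \<longrightarrow>
      (\<forall>x. iter_deriv bs \<phi> differentiable at x) \<and>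
      (\<forall>k::nat. bounded (range (\<lambda>x. norm x ^ k *\<^sub>R iter_deriv bs \<phi> x))))"

definition riesz_measure :: "real \<Rightarrow> 'a::euclidean_space measure" where
  "riesz_measure \<beta> = density lborel (\<lambda>\<xi>. ennreal (norm \<xi> powr (\<beta> - real DIM('a))))"

text \<open>The Riesz kernel: the Fourier transform of \<open>riesz_measure \<beta>\<close> in the sense of tempered
  distributions. The first conjunct selects the pointwise representative (and makes the left-hand
  integrals converge absolutely when \<open>\<beta> < DIM('a)\<close>); the second determines the constant.\<close>

definition riesz_kernel :: "real \<Rightarrow> ('a::euclidean_space \<Rightarrow> real) \<Rightarrow> bool" where
  "riesz_kernel \<beta> f \<longleftrightarrow>
    (\<exists>c. \<forall>x. f x = c * norm x powr (- \<beta>)) \<and>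
    (\<forall>\<phi>. schwartz \<phi> \<longrightarrow>
      (LINT x|lborel. complex_of_real (f x) * \<phi> x) = (LINT \<xi>|riesz_measure \<beta>. fourier \<phi> \<xi>))"

definition R_H :: "real \<Rightarrow> real \<Rightarrow> real \<Rightarrow> real" where
  "R_H H t s = (t powr (2 * H) + s powr (2 * H) - \<bar>t - s\<bar> powr (2 * H)) / 2"

definition alpha_H :: "real \<Rightarrow> real" where
  "alpha_H H = H * (2 * H - 1)"

text \<open>Degenerate (almost surely vanishing) variables count as Gaussian.\<close>

definition centered_gaussian :: "'w measure \<Rightarrow> ('w \<Rightarrow> real) \<Rightarrow> bool" where
  "centered_gaussian M X \<longleftrightarrow> X \<in> borel_measurable M \<and>
    ((AE \<omega> in M. X \<omega> = 0) \<or> (\<exists>\<sigma>>0. distributed M lborel X (normal_density 0 \<sigma>)))"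

definition centered_gaussian_family ::
    "'w measure \<Rightarrow> 'i set \<Rightarrow> ('i \<Rightarrow> 'w \<Rightarrow> real) \<Rightarrow> bool" where
  "centered_gaussian_family M I X \<longleftrightarrow>
    (\<forall>J c. finite J \<and> J \<subseteq> I \<longrightarrow> centered_gaussian M (\<lambda>\<omega>. \<Sum>j\<in>J. c j * X j \<omega>))"

definition noise_index :: "(real \<times> 'a::euclidean_space set) set" where
  "noise_index = {0..} \<times> {A. A \<in> sets borel \<and> bounded A}"

definition fractional_colored_noise ::
    "'w measure \<Rightarrow> real \<Rightarrow> ('a::euclidean_space \<Rightarrow> real) \<Rightarrow> (real \<Rightarrow> 'a set \<Rightarrow> 'w \<Rightarrow> real) \<Rightarrow> bool" where
  "fractional_colored_noise M H f W \<longleftrightarrow>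
    centered_gaussian_family M noise_index (\<lambda>(t, A). W t A) \<and>
    (\<forall>(t, A)\<in>noise_index. \<forall>(s, B)\<in>noise_index.
      (LINT \<omega>|M. W t A \<omega> * W s B \<omega>)
        = R_H H t s * (LINT x:A|lborel. (LINT y:B|lborel. f (x - y))))"

text \<open>
  Since some elements of the Hilbert space \<open>HP\<close> are distributions in the space variable,
  its elements are represented by their spatial Fourier transforms \<open>\<Phi> r \<xi>\<close>, in terms of which
  the inner product is given.
\<close>

definition HP_inner ::
    "real \<Rightarrow> real \<Rightarrow> (real \<Rightarrow> 'a::euclidean_space \<Rightarrow> complex) \<Rightarrow> (real \<Rightarrow> 'a \<Rightarrow> complex) \<Rightarrow> complex" where
  "HP_inner H \<beta> \<Phi> \<Psi> = complex_of_real (alpha_H H) *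
    (LINT \<xi>|riesz_measure \<beta>. (LINT r:{0..}|lborel. (LINT v:{0..}|lborel.
      \<Phi> r \<xi> * cnj (\<Psi> v \<xi>) * complex_of_real (\<bar>r - v\<bar> powr (2 * H - 2)))))"

definition HP_norm :: "real \<Rightarrow> real \<Rightarrow> (real \<Rightarrow> 'a::euclidean_space \<Rightarrow> complex) \<Rightarrow> real" where
  "HP_norm H \<beta> \<Phi> = sqrt (Re (HP_inner H \<beta> \<Phi> \<Phi>))"

text \<open>The list of triples \<open>(c, t, A)\<close> stands for the linear combination of the functions
  \<open>c 1\<^bsub>[0,t] \<times> A\<^esub>\<close>.\<close>

definition elementary :: "(real \<times> real \<times> 'a::euclidean_space set) list \<Rightarrow> bool" where
  "elementary cs \<longleftrightarrow> (\<forall>(c, t, A)\<in>set cs. (t, A) \<in> noise_index)"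

definition elem_fun :: "(real \<times> real \<times> 'a::euclidean_space set) list \<Rightarrow> real \<Rightarrow> 'a \<Rightarrow> real" where
  "elem_fun cs r y = (\<Sum>(c, t, A)\<leftarrow>cs. c * indicator ({0..t} \<times> A) (r, y))"

definition elem_integral ::
    "(real \<Rightarrow> 'a set \<Rightarrow> 'w \<Rightarrow> real) \<Rightarrow> (real \<times> real \<times> 'a::euclidean_space set) list \<Rightarrow> 'w \<Rightarrow> real" where
  "elem_integral W cs \<omega> = (\<Sum>(c, t, A)\<leftarrow>cs. c * W t A \<omega>)"

definition elem_hat ::
    "(real \<times> real \<times> 'a::euclidean_space set) list \<Rightarrow> real \<Rightarrow> 'a \<Rightarrow> complex" where
  "elem_hat cs r = fourier (\<lambda>y. complex_of_real (elem_fun cs r y))"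

text \<open>\<open>X = W(\<phi>)\<close>, where \<open>\<Phi>\<close> is the spatial Fourier transform of \<open>\<phi>\<close>: the element \<open>\<phi>\<close> is an
  \<open>HP\<close>-limit of elementary functions whose integrals converge to \<open>X\<close> in \<open>L\<^sup>2\<close>, that is, \<open>X\<close> is the
  value at \<open>\<phi>\<close> of the continuous extension to \<open>HP\<close> of \<open>1\<^bsub>[0,t] \<times> A\<^esub> \<mapsto> W\<^sub>t(A)\<close>.\<close>

definition wiener_integral ::
    "'w measure \<Rightarrow> real \<Rightarrow> real \<Rightarrow> (real \<Rightarrow> 'a::euclidean_space set \<Rightarrow> 'w \<Rightarrow> real)
      \<Rightarrow> (real \<Rightarrow> 'a \<Rightarrow> complex) \<Rightarrow> ('w \<Rightarrow> real) \<Rightarrow> bool" where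
  "wiener_integral M H \<beta> W \<Phi> X \<longleftrightarrow>
    X \<in> borel_measurable M \<and> integrable M (\<lambda>\<omega>. (X \<omega>)\<^sup>2) \<and>
    (\<exists>\<phi>. (\<forall>n::nat. elementary (\<phi> n)) \<and>
      (\<lambda>n. HP_norm H \<beta> (\<lambda>r \<xi>. elem_hat (\<phi> n) r \<xi> - \<Phi> r \<xi>)) \<longlonglongrightarrow> 0 \<and>
      (\<lambda>n. LINT \<omega>|M. (elem_integral W (\<phi> n) \<omega> - X \<omega>)\<^sup>2) \<longlonglongrightarrow> 0)"

text \<open>The fundamental solution \<open>G\<^sub>1\<close> of the wave equation, given by its spatial Fourier transform
  (for \<open>d \<ge> 3\<close> it is not a function). The value at \<open>\<xi> = 0\<close> is immaterial.\<close>

definition G1_hat :: "real \<Rightarrow> 'a::euclidean_space \<Rightarrow> complex" where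
  "G1_hat t \<xi> = complex_of_real (sin (t * norm \<xi>) / norm \<xi>)"

text \<open>Spatial Fourier transform of \<open>(r, y) \<mapsto> G\<^sub>1(t - r, x - y) 1\<^bsub>[0,t]\<^esub>(r)\<close>; the reflection
  \<open>y \<mapsto> x - y\<close> turns \<open>G1_hat (t - r)\<close> into \<open>cis (- (\<xi> \<bullet> x)) * G1_hat (t - r) (- \<xi>)\<close>.\<close>

definition wave_kernel_hat :: "real \<Rightarrow> 'a::euclidean_space \<Rightarrow> real \<Rightarrow> 'a \<Rightarrow> complex" where
  "wave_kernel_hat t x r \<xi> = indicator {0..t} r * (cis (- (\<xi> \<bullet> x)) * G1_hat (t - r) (- \<xi>))"

definition wave_mild_solution ::
    "'w measure \<Rightarrow> real \<Rightarrow> real \<Rightarrow> (real \<Rightarrow> 'a::euclidean_space set \<Rightarrow> 'w \<Rightarrow> real)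
      \<Rightarrow> (real \<Rightarrow> 'a \<Rightarrow> 'w \<Rightarrow> real) \<Rightarrow> bool" where
  "wave_mild_solution M H \<beta> W u \<longleftrightarrow>
    (\<forall>t\<ge>0. \<forall>x. wiener_integral M H \<beta> W (wave_kernel_hat t x) (u t x))"

definition modification_of ::
    "'w measure \<Rightarrow> ('i \<Rightarrow> 'w \<Rightarrow> real) \<Rightarrow> ('i \<Rightarrow> 'w \<Rightarrow> real) \<Rightarrow> bool" where
  "modification_of M v u \<longleftrightarrow>
    (\<forall>x. v x \<in> borel_measurable M \<and> (AE \<omega> in M. v x \<omega> = u x \<omega>))"

text \<open>Hoelder continuity of order \<open>\<delta>\<close>, uniform on compact sets: the spatially stationary field
  considered here cannot be globally Hoelder on the whole space.\<close>

definition holder_continuous :: "real \<Rightarrow> ('a::euclidean_space \<Rightarrow> real) \<Rightarrow> bool" where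
  "holder_continuous \<delta> g \<longleftrightarrow>
    (\<forall>K. compact K \<longrightarrow> (\<exists>C. \<forall>x\<in>K. \<forall>y\<in>K. \<bar>g x - g y\<bar> \<le> C * dist x y powr \<delta>))"

end

theory Submission
  imports Defs
begin

text \<open>
  Hoelder continuity of \<open>x \<mapsto> u(t, x)\<close> follows from Kolmogorov's criterion
  (\<open>kolmogorov_continuity\<close>) once, for every \<open>\<delta>\<close> below the critical exponent and every \<open>p \<ge> 1\<close>,
  the \<open>2p\<close>-th moment of \<open>u(t, x) - u(t, y)\<close> is \<open>O(|x - y|\<^bsup>2p\<delta>\<^esup>)\<close>. The increment is a
  limit in \<open>L\<^sup>2\<close> of centered Gaussian variables, so all its even moments are bounded by powers of
  a bound on the variance (\<open>gaussian_limit_moments\<close>), and only \<open>p = 1\<close> requires an estimate.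

  The variance is bounded by a constant multiple of the squared \<open>HP\<close>-norm of the difference of two
  wave kernels (\<open>wiener_integral_diff_moments\<close>). On the Fourier side these kernels differ only by
  a phase, so that this squared norm is \<open>\<alpha>\<^sub>H\<close> times
  \<open>\<integral> |e\<^bsup>-i\<xi>x\<^esup> - e\<^bsup>-i\<xi>y\<^esup>|\<^sup>2 N(\<xi>) \<mu>(d\<xi>)\<close>, where \<open>N(\<xi>)\<close> is the energy of
  \<open>r \<mapsto> sin((t - r)|\<xi>|) / |\<xi>|\<close> on \<open>[0, t]\<close> with respect to the kernel \<open>|r - v|\<^bsup>2H-2\<^esup>\<close>. Oscillation
  of the sine gives \<open>N(\<xi>) \<le> C min(1, |\<xi>|\<^bsup>-2H-1\<^esup>)\<close> (\<open>wave_energy_bound\<close>). Since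
  \<open>|e\<^bsup>-i\<xi>x\<^esup> - e\<^bsup>-i\<xi>y\<^esup>| \<le> 2 (|\<xi>| |x - y|)\<^bsup>\<delta>\<^esup>\<close> for \<open>0 \<le> \<delta> \<le> 1\<close>, the integral is at most
  \<open>C' |x - y|\<^bsup>2\<delta>\<^esup>\<close> whenever \<open>|\<xi>|\<^bsup>2\<delta> - 2H - 1 + \<beta> - d\<^esup>\<close> is integrable at infinity, that is, for
  \<open>2\<delta> < 2H + 1 - \<beta>\<close> (\<open>wave_increment_energy\<close>).

  Two facts connect the covariance of the noise with the \<open>HP\<close>-norm. The fractional covariance is
  \<open>\<alpha>\<^sub>H\<close> times the mutual energy of two time intervals for the kernel \<open>|r - v|\<^bsup>2H-2\<^esup>\<close>
  (\<open>R_H_eq_riesz_form\<close>), and the mutual energy of two bounded sets for \<open>|x - y|\<^bsup>-\<beta>\<^esup>\<close> is a constant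
  multiple of the integral against \<open>\<mu>\<close> of the product of the Fourier transforms of their
  indicators, one of them conjugated (\<open>riesz_form_fourier\<close>). Both kernels are mixtures of
  Gaussians, for which the Fourier transform is explicit; this representation yields the identity
  in space, the positivity of the energy in time, and the integrability of the powers of the norm
  that occur.
\<close>

section \<open>Gaussian integrals on a Euclidean space\<close>

lemma norm_sq_eq_sum_Basis: "(norm (x::'a::euclidean_space))\<^sup>2 = (\<Sum>b\<in>Basis. (x \<bullet> b)\<^sup>2)"
  unfolding power2_norm_eq_inner by (subst euclidean_inner) (simp add: power2_eq_square)

lemma borel_measurable_cis [measurable]: "cis \<in> borel_measurable borel"
  by (intro borel_measurable_continuous_onI continuous_intros)

text \<open>
  The characteristic function of the standard normal law after the substitution \<open>x = sqrt(2a) y\<close>.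
\<close>

lemma gaussian_fourier_real:
  fixes a t :: real
  assumes a: "a > 0"
  shows "has_bochner_integral lborel (\<lambda>y. cis (t * y) * complex_of_real (exp (- a * y\<^sup>2)))
           (complex_of_real (sqrt (pi / a) * exp (- t\<^sup>2 / (4 * a))))"
proof -
  let ?u = "t / sqrt (2 * a)"
  have int1: "integrable lborel (\<lambda>x. std_normal_density x *\<^sub>R cis (?u * x))"
  proof (rule Bochner_Integration.integrable_bound)
    show "integrable lborel std_normal_density" using integrable_std_normal_moment[of 0] by simp
  qed auto
  have "(LINT x|lborel. std_normal_density x *\<^sub>R cis (?u * x)) = complex_of_real (exp (- ?u\<^sup>2 / 2))"
    using fun_cong[OF char_std_normal_distribution, of ?u]
    unfolding char_def cis_conv_exp by (subst (asm) integral_density) auto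
  with int1 have "has_bochner_integral lborel (\<lambda>x. std_normal_density x *\<^sub>R cis (?u * x)) (complex_of_real (exp (- ?u\<^sup>2 / 2)))"
    using has_bochner_integral_iff by blast
  then have "has_bochner_integral lborel (\<lambda>x. std_normal_density (0 + sqrt (2 * a) * x) *\<^sub>R cis (?u * (0 + sqrt (2 * a) * x)))
      (complex_of_real (exp (- ?u\<^sup>2 / 2)) /\<^sub>R \<bar>sqrt (2 * a)\<bar>)"
    using a by (subst (asm) lborel_has_bochner_integral_real_affine_iff[where c="sqrt (2 * a)" and t=0]) auto
  then have "has_bochner_integral lborel (\<lambda>x. (sqrt (2 * pi)) *\<^sub>R (std_normal_density (0 + sqrt (2 * a) * x) *\<^sub>R cis (?u * (0 + sqrt (2 * a) * x))))
      (sqrt (2 * pi) *\<^sub>R (complex_of_real (exp (- ?u\<^sup>2 / 2)) /\<^sub>R \<bar>sqrt (2 * a)\<bar>))"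
    by (rule has_bochner_integral_scaleR_right) 
  moreover have "(\<lambda>x. (sqrt (2 * pi)) *\<^sub>R (std_normal_density (0 + sqrt (2 * a) * x) *\<^sub>R cis (?u * (0 + sqrt (2 * a) * x))))
    = (\<lambda>y. cis (t * y) * complex_of_real (exp (- a * y\<^sup>2)))"
    using a by (auto simp: fun_eq_iff normal_density_def power_mult_distrib scaleR_conv_of_real)
  moreover have "sqrt (2 * pi) *\<^sub>R (complex_of_real (exp (- ?u\<^sup>2 / 2)) /\<^sub>R \<bar>sqrt (2 * a)\<bar>)
    = complex_of_real (sqrt (pi / a) * exp (- t\<^sup>2 / (4 * a)))"
    using a by (simp add: scaleR_conv_of_real power_divide real_sqrt_divide real_sqrt_mult field_simps)
  ultimately show ?thesis by simp
qed

text \<open>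
  The integrand is a product over the coordinates, and Lebesgue measure is the image of the product
  measure indexed by the basis.
\<close>

lemma gaussian_fourier:
  fixes x :: "'a::euclidean_space"
  assumes a: "a > 0"
  shows "has_bochner_integral lborel (\<lambda>\<xi>::'a. cis (x \<bullet> \<xi>) * complex_of_real (exp (- a * (norm \<xi>)\<^sup>2)))
           (complex_of_real (sqrt (pi / a) ^ DIM('a) * exp (- (norm x)\<^sup>2 / (4 * a))))"
proof -
  interpret product_sigma_finite "\<lambda>_::'a. lborel :: real measure" by standard
  define h where "h b y = cis ((x \<bullet> b) * y) * complex_of_real (exp (- a * y\<^sup>2))" for b :: 'a and y :: real
  have h: "has_bochner_integral lborel (h b) (complex_of_real (sqrt (pi / a) * exp (- (x \<bullet> b)\<^sup>2 / (4 * a))))" for b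
    unfolding h_def by (rule gaussian_fourier_real[OF a])
  have P: "has_bochner_integral (Pi\<^sub>M Basis (\<lambda>_. lborel)) (\<lambda>z. \<Prod>b\<in>Basis. h b (z b))
      (\<Prod>b\<in>(Basis::'a set). (complex_of_real (sqrt (pi / a) * exp (- (x \<bullet> b)\<^sup>2 / (4 * a)))))"
    unfolding has_bochner_integral_iff using h
    by (subst product_integral_prod) (auto simp: has_bochner_integral_iff intro!: product_integrable_prod)
  have prod_eq: "(\<Prod>b\<in>Basis. h b (\<xi> \<bullet> b)) = cis (x \<bullet> \<xi>) * complex_of_real (exp (- a * (norm \<xi>)\<^sup>2))" for \<xi>
  proof -
    have "(\<Prod>b\<in>Basis. h b (\<xi> \<bullet> b)) = (\<Prod>b\<in>Basis. exp (\<i> * complex_of_real ((x \<bullet> b) * (\<xi> \<bullet> b)) + complex_of_real (- a * (\<xi> \<bullet> b)\<^sup>2)))"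
      by (simp only: h_def cis_conv_exp exp_add exp_of_real[symmetric])
    also have "\<dots> = exp (\<i> * complex_of_real (x \<bullet> \<xi>) + complex_of_real (- a * (norm \<xi>)\<^sup>2))"
      by (simp add: exp_sum[symmetric] euclidean_inner[of x \<xi>] norm_sq_eq_sum_Basis[of \<xi>] sum.distrib sum_subtractf sum_distrib_left sum_negf)
    finally show ?thesis by (simp only: cis_conv_exp exp_add exp_of_real)
  qed
  have val: "(\<Prod>b\<in>(Basis::'a set). (complex_of_real (sqrt (pi / a) * exp (- (x \<bullet> b)\<^sup>2 / (4 * a)))))
     = complex_of_real (sqrt (pi / a) ^ DIM('a) * exp (- (norm x)\<^sup>2 / (4 * a)))"
    by (simp only: of_real_prod[symmetric] prod.distrib exp_sum[symmetric, OF finite_Basis] prod_constant norm_sq_eq_sum_Basis[of x] sum_negf sum_divide_distrib[symmetric])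
  have "has_bochner_integral (Pi\<^sub>M Basis (\<lambda>_. lborel)) (\<lambda>z. cis (x \<bullet> (\<Sum>b\<in>Basis. z b *\<^sub>R b)) * complex_of_real (exp (- a * (norm (\<Sum>b\<in>Basis. z b *\<^sub>R b))\<^sup>2)))
     (complex_of_real (sqrt (pi / a) ^ DIM('a) * exp (- (norm x)\<^sup>2 / (4 * a))))"
    using P unfolding prod_eq[symmetric] val by (simp add: inner_sum_left inner_Basis if_distrib if_distribR cong: if_cong)
  then show ?thesis
    by (subst lborel_eq) (rule has_bochner_integral_distr, auto)
qed

lemma nn_integral_gaussian:
  assumes a: "a > 0"
  shows "(\<integral>\<^sup>+ \<xi>. ennreal (exp (- a * (norm (\<xi>::'a::euclidean_space))\<^sup>2)) \<partial>lborel) = ennreal (sqrt (pi / a) ^ DIM('a))"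
proof -
  have "has_bochner_integral lborel (\<lambda>\<xi>::'a. complex_of_real (exp (- a * (norm \<xi>)\<^sup>2))) (complex_of_real (sqrt (pi / a) ^ DIM('a)))"
    using gaussian_fourier[OF a, of "0::'a"] by simp
  then have "has_bochner_integral lborel (\<lambda>\<xi>::'a. exp (- a * (norm \<xi>)\<^sup>2)) (sqrt (pi / a) ^ DIM('a))"
    unfolding has_bochner_integral_iff complex_of_real_integrable_eq integral_complex_of_real of_real_eq_iff .
  then show ?thesis
    by (subst nn_integral_eq_integral) (auto simp: has_bochner_integral_iff)
qed

lemma integrable_gaussian:
  assumes a: "a > 0"
  shows "integrable lborel (\<lambda>\<xi>::'a::euclidean_space. exp (- a * (norm \<xi>)\<^sup>2))"
  using nn_integral_gaussian[OF a, where 'a='a] by (intro integrableI_nonneg) auto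

section \<open>Powers of the norm as mixtures of Gaussians\<close>

text \<open>
  Euler's integral for the Gamma function, rescaled. With \<open>q = a/2\<close> and \<open>A = |x|\<^sup>2\<close> it presents
  \<open>|x|\<^bsup>-a\<^esup>\<close> as a mixture of the Gaussians \<open>e\<^bsup>-s|x|^2\<^esup>\<close>. Everything about Riesz kernels below is
  reduced to Gaussians in this way.
\<close>

lemma nn_integral_powr_exp:
  fixes q A :: real
  assumes "q > 0" "A > 0"
  shows "(\<integral>\<^sup>+ s. ennreal (indicator {0..} s * (s powr (q - 1) * exp (- s * A))) \<partial>lborel) = ennreal (Gamma q * A powr (- q))"
proof -
  let ?I = "\<integral>\<^sup>+ s. ennreal (indicator {0..} s * (s powr (q - 1) * exp (- s * A))) \<partial>lborel"
  have "ennreal (Gamma q) = (\<integral>\<^sup>+ t. ennreal (indicator {0..} t * t powr (q - 1) / exp t) \<partial>lborel)"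
    by (rule Gamma_conv_nn_integral_real[OF assms(1)])
  also have "\<dots> = ennreal A * (\<integral>\<^sup>+ s. ennreal (indicator {0..} (A * s) * (A * s) powr (q - 1) / exp (A * s)) \<partial>lborel)"
    using assms by (subst nn_integral_real_affine[where c=A and t=0]) auto
  also have "(\<integral>\<^sup>+ s. ennreal (indicator {0..} (A * s) * (A * s) powr (q - 1) / exp (A * s)) \<partial>lborel)
     = (\<integral>\<^sup>+ s. ennreal (A powr (q - 1)) * ennreal (indicator {0..} s * (s powr (q - 1) * exp (- s * A))) \<partial>lborel)"
    using assms by (intro nn_integral_cong)
      (auto simp: indicator_def powr_mult exp_minus field_simps zero_le_mult_iff ennreal_mult[symmetric])
  also have "\<dots> = ennreal (A powr (q - 1)) * ?I"
    by (rule nn_integral_cmult) simp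
  also have "ennreal A * \<dots> = ennreal (A powr q) * ?I"
    using assms by (simp add: mult.assoc[symmetric] ennreal_mult[symmetric] powr_diff)
  finally have "ennreal (A powr (-q)) * ennreal (Gamma q) = ennreal (A powr (-q)) * (ennreal (A powr q) * ?I)"
    by simp
  also have "\<dots> = ?I"
    using assms by (simp add: mult.assoc[symmetric] ennreal_mult[symmetric] powr_add[symmetric])
  finally show ?thesis
    using assms by (simp add: ennreal_mult[symmetric] Gamma_real_nonneg mult.commute)
qed

lemma nn_integral_finite_if_powr_bounds:
  fixes F :: "real \<Rightarrow> real"
  assumes "- 1 < u" "v < - 1" "0 \<le> C"
    and near: "\<And>s. 0 < s \<Longrightarrow> s \<le> 1 \<Longrightarrow> F s \<le> C * s powr u"
    and far: "\<And>s. 1 \<le> s \<Longrightarrow> F s \<le> C * s powr v"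
  shows "(\<integral>\<^sup>+ s. ennreal (indicator {0<..} s * F s) \<partial>lborel) < \<infinity>"
proof -
  have 1: "(\<integral>\<^sup>+ s. ennreal (indicator {0..1} s * s powr u) \<partial>lborel) < \<infinity>"
  proof -
    have "((\<lambda>s. s powr u) has_integral (1 powr (u + 1) / (u + 1))) {0..1}"
      using has_integral_powr_from_0[of u 1] assms by auto
    from nn_integral_has_integral_lebesgue[OF _ this] show ?thesis by simp
  qed
  have 2: "(\<integral>\<^sup>+ s. ennreal (indicator {1..} s * s powr v) \<partial>lborel) < \<infinity>"
  proof -
    have "((\<lambda>s. s powr v) has_integral - (1 powr (v + 1)) / (v + 1)) {1..}"
      using has_integral_powr_to_inf[of v 1] assms by auto
    from nn_integral_has_integral_lebesgue[OF _ this] show ?thesis by simp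
  qed
  have "(\<integral>\<^sup>+ s. ennreal (indicator {0<..} s * F s) \<partial>lborel) \<le>
     (\<integral>\<^sup>+ s. ennreal C * (ennreal (indicator {0..1} s * s powr u) + ennreal (indicator {1..} s * s powr v)) \<partial>lborel)"
  proof (rule nn_integral_mono)
    fix s :: real
    have "indicator {0<..} s * F s \<le> C * (indicator {0..1} s * s powr u + indicator {1..} s * s powr v)"
    proof (cases "s \<le> 1")
      case True then show ?thesis using near[of s] assms(3) by (cases "s = 1") (auto simp: indicator_def)
    next
      case False then show ?thesis using far[of s] assms by (auto simp: indicator_def)
    qed
    then show "ennreal (indicator {0<..} s * F s) \<le> ennreal C * (ennreal (indicator {0..1} s * s powr u) + ennreal (indicator {1..} s * s powr v))"
      using assms by (simp add: ennreal_mult[symmetric] ennreal_plus[symmetric] ennreal_leI del: ennreal_plus)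
  qed
  also have "\<dots> = ennreal C * ((\<integral>\<^sup>+ s. ennreal (indicator {0..1} s * s powr u) \<partial>lborel) + (\<integral>\<^sup>+ s. ennreal (indicator {1..} s * s powr v) \<partial>lborel))"
    by (simp add: nn_integral_cmult nn_integral_add)
  also have "\<dots> < \<infinity>" using 1 2 by (simp add: ennreal_mult_less_top)
  finally show ?thesis .
qed

text \<open>
  The mixture of the Fourier transforms of Gaussians, \<open>e\<^bsup>-r^2/(4s)\<^esup>\<close>, is again a power of \<open>r\<close>,
  because the substitution \<open>s \<rightarrow> r\<^sup>2 s\<close> shows that it is homogeneous. It remains to see that the value
  at \<open>r = 1\<close> is finite: near \<open>0\<close> the exponential beats every power of \<open>s\<close>. Strict positivity of \<open>K\<close>
  serves later to read off integrability of \<open>|fourier g|\<^sup>2\<close> from finiteness of an energy.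
\<close>

lemma nn_integral_powr_exp_inverse:
  fixes p :: real
  assumes p: "p < 0"
  obtains K where "K > 0" "\<And>r. r > 0 \<Longrightarrow>
    (\<integral>\<^sup>+ s. ennreal (indicator {0<..} s * (s powr (p - 1) * exp (- r\<^sup>2 / (4 * s)))) \<partial>lborel) = ennreal (K * r powr (2 * p))"
proof -
  let ?I = "\<lambda>r. \<integral>\<^sup>+ s. ennreal (indicator {0<..} s * (s powr (p - 1) * exp (- r\<^sup>2 / (4 * s)))) \<partial>lborel"
  obtain m :: nat where m: "1 - p \<le> m" using real_arch_simple by blast
  have m0: "m > 0" using m p by (cases m) auto
  have fin: "?I 1 < \<infinity>"
  proof (rule nn_integral_finite_if_powr_bounds[where u=0 and v="p-1" and C="max 1 ((4 * real m) ^ m)"])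
    fix s :: real assume s: "0 < s" "s \<le> 1"
    have "exp (- 1 / (4 * s)) \<le> (4 * real m * s) ^ m"
    proof -
      have "(1 / (4 * s) / m) ^ m \<le> (1 + 1 / (4 * s) / m) ^ m"
        using s by (intro power_mono) auto
      also have "\<dots> \<le> exp (1 / (4 * s))"
        using s m0 by (intro exp_ge_one_plus_x_over_n_power_n) (auto intro: order_trans[of _ 0])
      finally have "1 / (4 * real m * s) ^ m \<le> exp (1 / (4 * s))" by (simp add: power_divide power_mult_distrib field_simps)
      then have "inverse (exp (1 / (4 * s))) \<le> inverse (1 / (4 * real m * s) ^ m)"
        using s m0 by (intro le_imp_inverse_le) auto
      then show ?thesis by (simp add: exp_minus)
    qed
    then have "s powr (p - 1) * exp (- 1 / (4 * s)) \<le> s powr (p - 1) * (4 * real m * s) ^ m"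
      by (intro mult_left_mono) auto
    also have "\<dots> = (4 * real m) ^ m * s powr (p - 1 + m)"
      using s by (simp add: power_mult_distrib powr_add powr_realpow)
    also have "\<dots> \<le> (4 * real m) ^ m * 1"
      using s m by (intro mult_left_mono powr_le1) auto
    also have "\<dots> \<le> max 1 ((4 * real m) ^ m) * s powr 0" using s by simp
    finally show "s powr (p - 1) * exp (- 1\<^sup>2 / (4 * s)) \<le> max 1 ((4 * real m) ^ m) * s powr 0" by simp
  next
    fix s :: real assume s: "1 \<le> s"
    then have "s powr (p - 1) * exp (- 1\<^sup>2 / (4 * s)) \<le> s powr (p - 1) * 1"
      by (intro mult_left_mono) auto
    also have "\<dots> \<le> max 1 ((4 * real m) ^ m) * s powr (p - 1)" by (simp add: mult_le_cancel_right1)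
    finally show "s powr (p - 1) * exp (- 1\<^sup>2 / (4 * s)) \<le> max 1 ((4 * real m) ^ m) * s powr (p - 1)" by simp
  qed (use p in auto)
  have scale: "?I r = ennreal (r powr (2 * p)) * ?I 1" if r: "r > 0" for r
  proof -
    have "?I r = ennreal (r\<^sup>2) * (\<integral>\<^sup>+ s. ennreal (indicator {0<..} (r\<^sup>2 * s) * ((r\<^sup>2 * s) powr (p - 1) * exp (- r\<^sup>2 / (4 * (r\<^sup>2 * s))))) \<partial>lborel)"
      using r by (subst nn_integral_real_affine[where c="r\<^sup>2" and t=0]) auto
    also have "(\<integral>\<^sup>+ s. ennreal (indicator {0<..} (r\<^sup>2 * s) * ((r\<^sup>2 * s) powr (p - 1) * exp (- r\<^sup>2 / (4 * (r\<^sup>2 * s))))) \<partial>lborel)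
      = (\<integral>\<^sup>+ s. ennreal ((r\<^sup>2) powr (p - 1)) * ennreal (indicator {0<..} s * (s powr (p - 1) * exp (- 1\<^sup>2 / (4 * s)))) \<partial>lborel)"
      using r by (intro nn_integral_cong)
        (auto simp: indicator_def powr_mult field_simps zero_less_mult_iff ennreal_mult[symmetric])
    also have "\<dots> = ennreal ((r\<^sup>2) powr (p - 1)) * ?I 1" by (rule nn_integral_cmult) simp
    also have "ennreal (r\<^sup>2) * \<dots> = ennreal (r\<^sup>2 * (r\<^sup>2) powr (p - 1)) * ?I 1"
      by (simp add: mult.assoc[symmetric] ennreal_mult[symmetric])
    also have "r\<^sup>2 * (r\<^sup>2) powr (p - 1) = (r\<^sup>2) powr p" using r by (simp add: powr_diff)
    also have "\<dots> = r powr (2 * p)" using r by (simp add: powr_powr[symmetric])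
    finally show ?thesis .
  qed
  show ?thesis
  proof (rule that[of "enn2real (?I 1)"])
    show "?I r = ennreal (enn2real (?I 1) * r powr (2 * p))" if "r > 0" for r
      using scale[OF that] fin by (simp add: ennreal_mult mult.commute)
    have "ennreal (2 powr (p - 1) * exp (- 1 / 4)) = (\<integral>\<^sup>+ s. ennreal (2 powr (p - 1) * exp (- 1 / 4)) * indicator {1..2} s \<partial>(lborel :: real measure))"
      by (subst nn_integral_cmult_indicator) auto
    also have "\<dots> \<le> ?I 1"
    proof (rule nn_integral_mono)
      fix s :: real
      show "ennreal (2 powr (p - 1) * exp (- 1 / 4)) * indicator {1..2} s \<le> ennreal (indicator {0<..} s * (s powr (p - 1) * exp (- 1\<^sup>2 / (4 * s))))"
      proof (cases "s \<in> {1..2}")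
        case True
        have "2 powr (p - 1) \<le> s powr (p - 1)" using True p by (intro powr_mono2') auto
        moreover have "exp (- 1 / 4) \<le> exp (- 1 / (4 * s))" using True by (simp add: field_simps)
        ultimately have "2 powr (p - 1) * exp (- 1 / 4) \<le> s powr (p - 1) * exp (- 1 / (4 * s))"
          by (intro mult_mono) auto
        then show ?thesis using True by (simp add: ennreal_leI)
      qed simp
    qed
    finally have "0 < ?I 1" by (rule less_le_trans[rotated]) simp
    then show "0 < enn2real (?I 1)" using fin by (simp add: enn2real_positive_iff)
  qed
qed

lemma square_powr_half: "0 \<le> x \<Longrightarrow> (x\<^sup>2) powr (- (a / 2)) = x powr (- a :: real)"
proof (cases "x = 0")
  case False
  assume "0 \<le> x"
  with False have "x\<^sup>2 = x powr 2" by simp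
  then show ?thesis by (simp only: powr_powr) simp
qed simp

lemma sqrt_pi_divide_power:
  assumes s: "0 < s"
  shows "sqrt (pi / s) ^ n = sqrt pi ^ n * s powr (- real n / 2)"
proof -
  have "sqrt s ^ n = (s powr (1 / 2)) powr real n"
    using s by (simp add: powr_half_sqrt powr_realpow)
  also have "\<dots> = s powr (real n / 2)"
    by (simp add: powr_powr)
  finally have "sqrt s ^ n = s powr (real n / 2)" .
  moreover have "s powr (- real n / 2) = inverse (s powr (real n / 2))"
    by (simp add: powr_minus[symmetric])
  moreover have "sqrt (pi / s) ^ n = sqrt pi ^ n * inverse (sqrt s ^ n)"
    by (simp only: real_sqrt_divide power_divide) (simp only: divide_inverse)
  ultimately show ?thesis
    by (simp only:)
qed

text \<open>
  Replacing the power by its Gaussian mixture and integrating first over space leaves a constant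
  multiple of \<open>\<integral> s\<^bsup>a/2-1\<^esup> (s + 1)\<^bsup>-d/2\<^esup> ds\<close>, which converges at \<open>0\<close> because \<open>a > 0\<close> and at
  infinity because \<open>a < d\<close>.
\<close>

lemma nn_integral_norm_powr_gaussian_finite:
  fixes a :: real
  assumes "0 < a" "a < DIM('a::euclidean_space)"
  shows "(\<integral>\<^sup>+ z. ennreal (norm (z::'a) powr (- a) * exp (- (norm z)\<^sup>2)) \<partial>lborel) < \<infinity>"
proof -
  let ?d = "real DIM('a)"
  have mix: "ennreal (Gamma (a / 2)) * ennreal (norm z powr (- a) * exp (- (norm z)\<^sup>2))
     \<le> (\<integral>\<^sup>+ s. ennreal (indicator {0..} s * (s powr (a / 2 - 1))) * ennreal (exp (- (s + 1) * (norm z)\<^sup>2)) \<partial>lborel)" for z :: 'a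
  proof (cases "z = 0")
    case False
    then have "ennreal (Gamma (a / 2)) * ennreal (norm z powr (- a) * exp (- (norm z)\<^sup>2))
      = ennreal (exp (- (norm z)\<^sup>2)) * ennreal (Gamma (a / 2) * ((norm z)\<^sup>2) powr (- (a / 2)))"
      using assms by (simp only: square_powr_half norm_ge_zero) (simp add: ennreal_mult[symmetric] Gamma_real_nonneg mult_ac)
    also have "\<dots> = ennreal (exp (- (norm z)\<^sup>2)) * (\<integral>\<^sup>+ s. ennreal (indicator {0..} s * (s powr (a / 2 - 1) * exp (- s * (norm z)\<^sup>2))) \<partial>lborel)"
      using assms False by (subst nn_integral_powr_exp) auto
    also have "\<dots> = (\<integral>\<^sup>+ s. ennreal (exp (- (norm z)\<^sup>2)) * ennreal (indicator {0..} s * (s powr (a / 2 - 1) * exp (- s * (norm z)\<^sup>2))) \<partial>lborel)"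
      by (simp add: nn_integral_cmult)
    also have "\<dots> = (\<integral>\<^sup>+ s. ennreal (indicator {0..} s * (s powr (a / 2 - 1))) * ennreal (exp (- (s + 1) * (norm z)\<^sup>2)) \<partial>lborel)"
      by (intro nn_integral_cong) (auto simp: ennreal_mult[symmetric] indicator_def exp_add[symmetric] algebra_simps)
    finally show ?thesis by simp
  qed simp
  have "ennreal (Gamma (a / 2)) * (\<integral>\<^sup>+ z. ennreal (norm (z::'a) powr (- a) * exp (- (norm z)\<^sup>2)) \<partial>lborel)
    \<le> (\<integral>\<^sup>+ z. (\<integral>\<^sup>+ s. ennreal (indicator {0..} s * (s powr (a / 2 - 1))) * ennreal (exp (- (s + 1) * (norm (z::'a))\<^sup>2)) \<partial>lborel) \<partial>lborel)"
    by (subst nn_integral_cmult[symmetric], simp, rule nn_integral_mono, rule mix)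
  also have "\<dots> = (\<integral>\<^sup>+ s. (\<integral>\<^sup>+ z. ennreal (indicator {0..} s * (s powr (a / 2 - 1))) * ennreal (exp (- (s + 1) * (norm (z::'a))\<^sup>2)) \<partial>lborel) \<partial>lborel)"
    by (rule lborel_pair.Fubini') simp
  also have "\<dots> = (\<integral>\<^sup>+ s. ennreal (indicator {0<..} s * (s powr (a / 2 - 1) * sqrt (pi / (s + 1)) ^ DIM('a))) \<partial>lborel)"
  proof (rule nn_integral_cong)
    fix s :: real
    show "(\<integral>\<^sup>+ z. ennreal (indicator {0..} s * (s powr (a / 2 - 1))) * ennreal (exp (- (s + 1) * (norm (z::'a))\<^sup>2)) \<partial>lborel)
      = ennreal (indicator {0<..} s * (s powr (a / 2 - 1) * sqrt (pi / (s + 1)) ^ DIM('a)))"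
    proof (cases "s > 0")
      case True
      then have "(\<integral>\<^sup>+ z. ennreal (exp (- (s + 1) * (norm (z::'a))\<^sup>2)) \<partial>lborel) = ennreal (sqrt (pi / (s + 1)) ^ DIM('a))"
        by (intro nn_integral_gaussian) simp
      then show ?thesis
        using True by (subst nn_integral_cmult) (simp_all add: ennreal_mult)
    qed (auto simp: indicator_def)
  qed
  also have "\<dots> < \<infinity>"
  proof (rule nn_integral_finite_if_powr_bounds[where u="a/2-1" and v="a/2-1-?d/2" and C="sqrt pi ^ DIM('a)"])
    fix s :: real assume s: "0 < s"
    have "sqrt (pi / (s + 1)) ^ DIM('a) \<le> sqrt pi ^ DIM('a)"
      using s by (intro power_mono real_sqrt_le_mono) (auto simp: field_simps)
    then show "s powr (a / 2 - 1) * sqrt (pi / (s + 1)) ^ DIM('a) \<le> sqrt pi ^ DIM('a) * s powr (a / 2 - 1)"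
      by (simp add: mult.commute mult_right_mono)
  next
    fix s :: real assume s: "1 \<le> s"
    have "sqrt (pi / (s + 1)) ^ DIM('a) \<le> sqrt (pi / s) ^ DIM('a)"
      using s by (intro power_mono real_sqrt_le_mono) (auto simp: field_simps)
    also have "\<dots> = sqrt pi ^ DIM('a) * s powr (- ?d / 2)"
      using s by (intro sqrt_pi_divide_power) simp
    finally have "s powr (a / 2 - 1) * sqrt (pi / (s + 1)) ^ DIM('a) \<le> s powr (a / 2 - 1) * (sqrt pi ^ DIM('a) * s powr (- ?d / 2))"
      by (intro mult_left_mono) auto
    also have "\<dots> = sqrt pi ^ DIM('a) * s powr (a / 2 - 1 - ?d / 2)"
      using powr_add[of s "a / 2 - 1" "- ?d / 2"] by simp
    finally show "s powr (a / 2 - 1) * sqrt (pi / (s + 1)) ^ DIM('a) \<le> sqrt pi ^ DIM('a) * s powr (a / 2 - 1 - ?d / 2)" .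
  qed (use assms in auto)
  finally show ?thesis
    using Gamma_real_pos[of "a / 2"] assms(1) by (auto simp: ennreal_mult_less_top ennreal_eq_0_iff simp del: Gamma_real_pos)
qed

lemma nn_integral_norm_powr_cball_finite:
  fixes a :: real
  assumes "0 < a" "a < DIM('a::euclidean_space)"
  shows "(\<integral>\<^sup>+ z. ennreal (indicator (cball 0 R) z * norm (z::'a) powr (- a)) \<partial>lborel) < \<infinity>"
proof -
  have "(\<integral>\<^sup>+ z. ennreal (indicator (cball 0 R) z * norm (z::'a) powr (- a)) \<partial>lborel)
     \<le> (\<integral>\<^sup>+ z. ennreal (exp (R\<^sup>2)) * ennreal (norm (z::'a) powr (- a) * exp (- (norm z)\<^sup>2)) \<partial>lborel)"
  proof (intro nn_integral_mono)
    fix z :: 'a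
    have "indicator (cball 0 R) z * norm z powr (- a) \<le> exp (R\<^sup>2) * (norm z powr (- a) * exp (- (norm z)\<^sup>2))"
    proof (cases "norm z \<le> R")
      case True
      then have "(norm z)\<^sup>2 \<le> R\<^sup>2" by (intro power_mono) auto
      then have "1 \<le> exp (R\<^sup>2) * exp (- (norm z)\<^sup>2)" by (simp add: exp_add[symmetric])
      then have "norm z powr (- a) * 1 \<le> norm z powr (- a) * (exp (R\<^sup>2) * exp (- (norm z)\<^sup>2))"
        by (intro mult_left_mono) auto
      then show ?thesis using True by (simp add: mult_ac)
    qed simp
    then show "ennreal (indicator (cball 0 R) z * norm z powr (- a)) \<le> ennreal (exp (R\<^sup>2)) * ennreal (norm z powr (- a) * exp (- (norm z)\<^sup>2))"
      by (simp add: ennreal_mult[symmetric] ennreal_leI)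
  qed
  also have "\<dots> = ennreal (exp (R\<^sup>2)) * (\<integral>\<^sup>+ z. ennreal (norm (z::'a) powr (- a) * exp (- (norm z)\<^sup>2)) \<partial>lborel)"
    by (rule nn_integral_cmult) simp
  also have "\<dots> < \<infinity>" using nn_integral_norm_powr_gaussian_finite[OF assms] by (simp add: ennreal_mult_less_top)
  finally show ?thesis .
qed

text \<open>
  The same exchange of integrals, now for the mixture representing a power of \<open>1 + |z|\<^sup>2\<close>, ends in
  Euler's integral for \<open>Gamma((b - d)/2)\<close>.
\<close>

lemma nn_integral_one_plus_norm_powr_finite:
  fixes b :: real
  assumes "b > DIM('a::euclidean_space)"
  shows "(\<integral>\<^sup>+ z. ennreal ((1 + (norm (z::'a))\<^sup>2) powr (- (b / 2))) \<partial>lborel) < \<infinity>"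
proof -
  let ?d = "real DIM('a)"
  have b: "b / 2 > 0" "(b - ?d) / 2 > 0" using assms by (auto intro: le_less_trans[of 0 "?d"])
  have "ennreal (Gamma (b / 2)) * (\<integral>\<^sup>+ z. ennreal ((1 + (norm (z::'a))\<^sup>2) powr (- (b / 2))) \<partial>lborel)
    = (\<integral>\<^sup>+ z. (\<integral>\<^sup>+ s. ennreal (indicator {0..} s * (s powr (b / 2 - 1) * exp (- s * (1 + (norm (z::'a))\<^sup>2)))) \<partial>lborel) \<partial>lborel)"
    using b(1) by (subst nn_integral_powr_exp, simp_all add: add_pos_nonneg)
      (subst nn_integral_cmult[symmetric], simp_all add: ennreal_mult[symmetric] Gamma_real_nonneg)
  also have "\<dots> = (\<integral>\<^sup>+ s. (\<integral>\<^sup>+ z. ennreal (indicator {0..} s * (s powr (b / 2 - 1) * exp (- s * (1 + (norm (z::'a))\<^sup>2)))) \<partial>lborel) \<partial>lborel)"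
    by (rule lborel_pair.Fubini') simp
  also have "\<dots> = (\<integral>\<^sup>+ s. ennreal (sqrt pi ^ DIM('a)) * ennreal (indicator {0..} s * (s powr ((b - ?d) / 2 - 1) * exp (- s * 1))) \<partial>lborel)"
  proof (rule nn_integral_cong)
    fix s :: real
    show "(\<integral>\<^sup>+ z. ennreal (indicator {0..} s * (s powr (b / 2 - 1) * exp (- s * (1 + (norm (z::'a))\<^sup>2)))) \<partial>lborel)
      = ennreal (sqrt pi ^ DIM('a)) * ennreal (indicator {0..} s * (s powr ((b - ?d) / 2 - 1) * exp (- s * 1)))"
    proof (cases "s > 0")
      case True
      have "(\<integral>\<^sup>+ z. ennreal (indicator {0..} s * (s powr (b / 2 - 1) * exp (- s * (1 + (norm (z::'a))\<^sup>2)))) \<partial>lborel)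
        = (\<integral>\<^sup>+ z. ennreal (s powr (b / 2 - 1) * exp (- s)) * ennreal (exp (- s * (norm (z::'a))\<^sup>2)) \<partial>lborel)"
        using True by (intro nn_integral_cong) (auto simp: ennreal_mult[symmetric] exp_add[symmetric] algebra_simps)
      also have "\<dots> = ennreal (s powr (b / 2 - 1) * exp (- s)) * ennreal (sqrt (pi / s) ^ DIM('a))"
        using nn_integral_gaussian[OF True, where 'a='a] by (subst nn_integral_cmult) auto
      also have "sqrt (pi / s) ^ DIM('a) = sqrt pi ^ DIM('a) * s powr (- ?d / 2)"
        using True by (rule sqrt_pi_divide_power)
      also have "ennreal (s powr (b / 2 - 1) * exp (- s)) * ennreal (sqrt pi ^ DIM('a) * s powr (- ?d / 2))
        = ennreal (sqrt pi ^ DIM('a)) * ennreal (indicator {0..} s * (s powr ((b - ?d) / 2 - 1) * exp (- s * 1)))"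
        using True by (simp add: ennreal_mult[symmetric] mult_ac)
          (simp add: powr_add[symmetric] diff_divide_distrib algebra_simps)
      finally show ?thesis .
    qed (auto simp: indicator_def)
  qed
  also have "\<dots> = ennreal (sqrt pi ^ DIM('a)) * ennreal (Gamma ((b - ?d) / 2) * 1 powr (- ((b - ?d) / 2)))"
    by (subst nn_integral_cmult, simp, subst nn_integral_powr_exp) (use b in auto)
  also have "\<dots> < \<infinity>" by (simp add: ennreal_mult_less_top)
  finally show ?thesis
    using Gamma_real_pos[OF b(1)] by (auto simp: ennreal_mult_less_top ennreal_eq_0_iff simp del: Gamma_real_pos)
qed

section \<open>Positivity of Riesz energies\<close>

lemma borel_measurable_cnj [measurable]: "cnj \<in> borel_measurable borel"
  by (intro borel_measurable_continuous_onI continuous_intros)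

lemma lborel_product_integral:
  fixes f :: "'a::euclidean_space \<Rightarrow> complex" and h :: "'b::euclidean_space \<Rightarrow> complex"
  assumes f: "integrable lborel f" and h: "integrable lborel h"
  shows "integrable lborel (\<lambda>z. f (fst z) * h (snd z))"
    and "(LINT z|lborel. f (fst z) * h (snd z)) = (LINT x|lborel. f x) * (LINT y|lborel. h y)"
proof -
  have [measurable]: "f \<in> borel_measurable borel" "h \<in> borel_measurable borel"
    using f h by (auto dest: borel_measurable_integrable)
  have int: "integrable (lborel \<Otimes>\<^sub>M lborel) (\<lambda>(x, y). f x * h y)"
    using f h by (intro lborel_pair.Fubini_integrable) (auto simp: norm_mult)
  then show "integrable lborel (\<lambda>z. f (fst z) * h (snd z))"
    by (simp add: lborel_prod case_prod_beta')
  show "(LINT z|lborel. f (fst z) * h (snd z)) = (LINT x|lborel. f x) * (LINT y|lborel. h y)"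
    using lborel_pair.integral_fst'[OF int] by (simp add: lborel_prod case_prod_beta')
qed

text \<open>
  The Gaussian kernel is the Fourier transform of a Gaussian density. Inserting that integral and
  exchanging it with the integral over \<open>(x, y)\<close> factorises the latter into \<open>fourier g\<close> times its
  conjugate; in particular the form is positive.
\<close>

lemma gaussian_energy:
  fixes g :: "'a::euclidean_space \<Rightarrow> complex"
  assumes g: "integrable lborel g" and s: "s > 0"
  shows "integrable lborel (\<lambda>\<xi>. (norm (fourier g \<xi>))\<^sup>2 * exp (- (norm \<xi>)\<^sup>2 / (4 * s)))"
    and "(LINT z|lborel. g (fst z) * cnj (g (snd z)) * complex_of_real (exp (- s * (norm (fst z - snd z))\<^sup>2)))
      = complex_of_real (inverse (sqrt (4 * pi * s) ^ DIM('a)) *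
          (LINT \<xi>|lborel. (norm (fourier g \<xi>))\<^sup>2 * exp (- (norm \<xi>)\<^sup>2 / (4 * s))))"
proof -
  define c where "c = sqrt (4 * pi * s) ^ DIM('a)"
  have c: "c > 0" using s by (simp add: c_def)
  have a: "1 / (4 * s) > 0" using s by simp
  have [measurable]: "g \<in> borel_measurable borel" using g by (auto dest: borel_measurable_integrable)
  define F where "F z \<xi> = (g (fst z) * cnj (g (snd z))) *
      (cis ((snd z - fst z) \<bullet> \<xi>) * complex_of_real (exp (- (1 / (4 * s)) * (norm \<xi>)\<^sup>2)))" for z :: "'a \<times> 'a" and \<xi> :: 'a
  have gg: "integrable lborel (\<lambda>z. g (fst z) * cnj (g (snd z)))"
    using g by (intro lborel_product_integral(1)) auto
  have "integrable lborel (\<lambda>z. (g (fst (fst z)) * cnj (g (snd (fst z)))) * complex_of_real (exp (- (1 / (4 * s)) * (norm (snd z :: 'a))\<^sup>2)))"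
    by (rule lborel_product_integral(1)[where f="\<lambda>z. g (fst z) * cnj (g (snd z))", OF gg])
       (intro integrable_of_real integrable_gaussian a)
  then have int: "integrable (lborel \<Otimes>\<^sub>M lborel) (\<lambda>(z, \<xi>). F z \<xi>)"
    unfolding lborel_prod by (rule Bochner_Integration.integrable_bound) (auto simp: F_def norm_mult case_prod_beta' borel_prod[symmetric])
  have inner1: "(LINT \<xi>|lborel. F z \<xi>) = g (fst z) * cnj (g (snd z)) * complex_of_real (c * exp (- s * (norm (fst z - snd z))\<^sup>2))" for z
  proof -
    have "(LINT \<xi>|lborel. F z \<xi>) = g (fst z) * cnj (g (snd z)) *
        (LINT \<xi>|lborel. cis ((snd z - fst z) \<bullet> \<xi>) * complex_of_real (exp (- (1 / (4 * s)) * (norm \<xi>)\<^sup>2)))"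
      unfolding F_def by (rule integral_mult_right_zero)
    also have "\<dots> = g (fst z) * cnj (g (snd z)) * complex_of_real (sqrt (pi / (1 / (4 * s))) ^ DIM('a) * exp (- (norm (snd z - fst z))\<^sup>2 / (4 * (1 / (4 * s)))))"
      by (simp only: has_bochner_integral_integral_eq[OF gaussian_fourier[OF a, of "snd z - fst z"]])
    also have "sqrt (pi / (1 / (4 * s))) ^ DIM('a) = c" by (simp add: c_def mult_ac)
    also have "- (norm (snd z - fst z))\<^sup>2 / (4 * (1 / (4 * s))) = - s * (norm (fst z - snd z))\<^sup>2"
      using s by (subst norm_minus_commute) simp
    finally show ?thesis .
  qed
  have inner2: "(LINT z|lborel. F z \<xi>) = complex_of_real ((norm (fourier g \<xi>))\<^sup>2 * exp (- (norm \<xi>)\<^sup>2 / (4 * s)))" for \<xi>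
  proof -
    have 1: "integrable lborel (\<lambda>x. cis (- (\<xi> \<bullet> x)) * g x)"
      using g by (rule Bochner_Integration.integrable_bound) (auto simp: norm_mult)
    then have 2: "integrable lborel (\<lambda>x. cnj (cis (- (\<xi> \<bullet> x)) * g x))"
      by (rule integrable_cnj)
    have "F z \<xi> = (cis (- (\<xi> \<bullet> fst z)) * g (fst z)) * cnj (cis (- (\<xi> \<bullet> snd z)) * g (snd z)) * complex_of_real (exp (- (norm \<xi>)\<^sup>2 / (4 * s)))" for z
      by (simp add: F_def inner_diff_left inner_diff_right inner_commute cis_cnj cis_mult mult_ac)
    then have "(LINT z|lborel. F z \<xi>) = (LINT z|lborel. (cis (- (\<xi> \<bullet> fst z)) * g (fst z)) * cnj (cis (- (\<xi> \<bullet> snd z)) * g (snd z))) * complex_of_real (exp (- (norm \<xi>)\<^sup>2 / (4 * s)))"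
      by simp
    also have "\<dots> = fourier g \<xi> * cnj (fourier g \<xi>) * complex_of_real (exp (- (norm \<xi>)\<^sup>2 / (4 * s)))"
      using lborel_product_integral(2)[OF 1 2] by (simp only: fourier_def Bochner_Integration.integral_cnj)
    finally show ?thesis by (simp only: complex_norm_square of_real_mult)
  qed
  have "integrable lborel (\<lambda>\<xi>. LINT z|lborel. F z \<xi>)"
    using lborel_pair.integrable_snd[OF int] by simp
  then show int2: "integrable lborel (\<lambda>\<xi>. (norm (fourier g \<xi>))\<^sup>2 * exp (- (norm \<xi>)\<^sup>2 / (4 * s)))"
    unfolding inner2 complex_of_real_integrable_eq .
  have "(LINT z|lborel. g (fst z) * cnj (g (snd z)) * complex_of_real (exp (- s * (norm (fst z - snd z))\<^sup>2))) * complex_of_real c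
     = (LINT z|lborel. LINT \<xi>|lborel. F z \<xi>)"
    unfolding inner1 of_real_mult by (subst integral_mult_left_zero[symmetric]) (simp only: mult_ac)
  also have "\<dots> = (LINT \<xi>|lborel. LINT z|lborel. F z \<xi>)"
    using lborel_pair.Fubini_integral[OF int] by simp
  also have "\<dots> = complex_of_real (LINT \<xi>|lborel. (norm (fourier g \<xi>))\<^sup>2 * exp (- (norm \<xi>)\<^sup>2 / (4 * s)))"
    unfolding inner2 by (rule integral_complex_of_real)
  finally show "(LINT z|lborel. g (fst z) * cnj (g (snd z)) * complex_of_real (exp (- s * (norm (fst z - snd z))\<^sup>2)))
      = complex_of_real (inverse (sqrt (4 * pi * s) ^ DIM('a)) *
          (LINT \<xi>|lborel. (norm (fourier g \<xi>))\<^sup>2 * exp (- (norm \<xi>)\<^sup>2 / (4 * s))))"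
    using c unfolding c_def[symmetric] by (simp add: field_simps)
qed

text \<open>
  On the diagonal \<open>0 powr - a = 0\<close>, whereas the Gaussian mixture is infinite there; the two agree
  only off this null set.
\<close>

lemma AE_lborel_off_diagonal: "AE z in lborel. fst z \<noteq> (snd z :: 'a::euclidean_space)"
proof -
  have "AE z in lborel \<Otimes>\<^sub>M lborel. fst z \<noteq> (snd z :: 'a)"
  proof (rule lborel_pair.AE_pair_measure)
    show "AE x in lborel. AE y in lborel. fst (x, y) \<noteq> (snd (x, y) :: 'a)"
    proof (rule AE_I2)
      fix x :: 'a
      show "AE y in lborel. fst (x, y) \<noteq> (snd (x, y) :: 'a)"
        using AE_lborel_singleton[of x] by eventually_elim auto
    qed
    have "{z \<in> space (borel \<Otimes>\<^sub>M borel). norm (fst z - (snd z :: 'a)) \<noteq> 0} \<in> sets (borel \<Otimes>\<^sub>M borel)"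
      by measurable
    then show "{z \<in> space (lborel \<Otimes>\<^sub>M lborel). fst z \<noteq> (snd z :: 'a)} \<in> sets (lborel \<Otimes>\<^sub>M lborel)"
      by (simp add: space_pair_measure)
  qed
  then show ?thesis unfolding lborel_prod .
qed

text \<open>
  \<open>gaussian_energy\<close> integrated over the mixing parameter. This shows that the Riesz energy of \<open>g\<close> is
  a nonnegative real, and expresses it through the Fourier transform of \<open>g\<close>.
\<close>

lemma riesz_energy_mixture:
  fixes g :: "'a::euclidean_space \<Rightarrow> complex"
  assumes g: "integrable lborel g" and a: "a > 0"
    and fin: "integrable lborel (\<lambda>z. g (fst z) * cnj (g (snd z)) * complex_of_real (norm (fst z - snd z) powr - a))"
  obtains r where "r \<ge> 0"
    and "(LINT z|lborel. g (fst z) * cnj (g (snd z)) * complex_of_real (norm (fst z - snd z) powr - a)) = complex_of_real r"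
    and "ennreal (Gamma (a / 2) * r) = (\<integral>\<^sup>+ s. ennreal (indicator {0<..} s * (s powr (a / 2 - 1) * inverse (sqrt (4 * pi * s) ^ DIM('a))))
            * (\<integral>\<^sup>+ \<xi>. ennreal ((norm (fourier g \<xi>))\<^sup>2 * exp (- (norm \<xi>)\<^sup>2 / (4 * s))) \<partial>lborel) \<partial>lborel)"
proof -
  have G: "Gamma (a / 2) > 0" using a by simp
  have [measurable]: "g \<in> borel_measurable borel" using g by (auto dest: borel_measurable_integrable)
  define k where "k z s = indicator {0<..} s * (s powr (a / 2 - 1) * exp (- s * (norm (fst z - snd z))\<^sup>2))" for z :: "'a \<times> 'a" and s :: real
  have k0: "k z s \<ge> 0" for z s by (simp add: k_def)
  have [measurable]: "(\<lambda>x. k (fst x) (snd x)) \<in> borel_measurable (borel \<Otimes>\<^sub>M borel)"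
    unfolding k_def borel_prod[symmetric] by measurable
  have [measurable]: "(\<lambda>s. k z s) \<in> borel_measurable borel" for z
    unfolding k_def borel_prod[symmetric] by measurable
  have knn: "(\<integral>\<^sup>+ s. ennreal (k z s) \<partial>lborel) = ennreal (Gamma (a / 2) * norm (fst z - snd z) powr - a)" if "fst z \<noteq> snd z" for z :: "'a \<times> 'a"
  proof -
    have "(\<integral>\<^sup>+ s. ennreal (k z s) \<partial>lborel) = (\<integral>\<^sup>+ s. ennreal (indicator {0..} s * (s powr (a / 2 - 1) * exp (- s * (norm (fst z - snd z))\<^sup>2))) \<partial>lborel)"
      by (intro nn_integral_cong) (auto simp: k_def indicator_def)
    also have "\<dots> = ennreal (Gamma (a / 2) * ((norm (fst z - snd z))\<^sup>2) powr - (a / 2))"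
      using that a by (intro nn_integral_powr_exp) auto
    finally show ?thesis by (simp only: square_powr_half norm_ge_zero)
  qed
  have kint: "(LINT s|lborel. k z s) = Gamma (a / 2) * norm (fst z - snd z) powr - a" if "fst z \<noteq> snd z" for z :: "'a \<times> 'a"
    using knn[OF that] G by (subst integral_eq_nn_integral) (auto simp: k0)
  define F where "F z s = (g (fst z) * cnj (g (snd z))) * complex_of_real (k z s)" for z :: "'a \<times> 'a" and s :: real
  have [measurable]: "(\<lambda>x. F (fst x) (snd x)) \<in> borel_measurable (borel \<Otimes>\<^sub>M borel)"
    unfolding F_def k_def borel_prod[symmetric] by measurable
  have int: "integrable (lborel \<Otimes>\<^sub>M lborel) (\<lambda>(z, s). F z s)"
  proof (rule integrableI_bounded)
    have "(\<integral>\<^sup>+ x. ennreal (norm (case x of (z, s) \<Rightarrow> F z s)) \<partial>(lborel \<Otimes>\<^sub>M lborel)) = (\<integral>\<^sup>+ z. \<integral>\<^sup>+ s. ennreal (norm (F z s)) \<partial>lborel \<partial>lborel)"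
      by (subst lborel.nn_integral_fst[symmetric]) (auto simp: case_prod_beta')
    also have "\<dots> = (\<integral>\<^sup>+ z. ennreal (Gamma (a / 2)) * ennreal (norm (g (fst z) * cnj (g (snd z)) * complex_of_real (norm (fst z - snd z) powr - a))) \<partial>lborel)"
    proof (rule nn_integral_cong_AE, use AE_lborel_off_diagonal in eventually_elim)
      fix z :: "'a \<times> 'a" assume z: "fst z \<noteq> snd z"
      have "(\<integral>\<^sup>+ s. ennreal (norm (F z s)) \<partial>lborel) = (\<integral>\<^sup>+ s. ennreal (norm (g (fst z) * cnj (g (snd z)))) * ennreal (k z s) \<partial>lborel)"
        by (intro nn_integral_cong) (simp add: F_def norm_mult k0 ennreal_mult[symmetric])
      also have "\<dots> = ennreal (norm (g (fst z) * cnj (g (snd z)))) * ennreal (Gamma (a / 2) * norm (fst z - snd z) powr - a)"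
        by (subst nn_integral_cmult) (auto simp: knn[OF z])
      finally show "(\<integral>\<^sup>+ s. ennreal (norm (F z s)) \<partial>lborel) = ennreal (Gamma (a / 2)) * ennreal (norm (g (fst z) * cnj (g (snd z)) * complex_of_real (norm (fst z - snd z) powr - a)))"
        using G by (simp add: ennreal_mult[symmetric] norm_mult mult_ac)
    qed
    also have "\<dots> = ennreal (Gamma (a / 2)) * (\<integral>\<^sup>+ z. ennreal (norm (g (fst z) * cnj (g (snd z)) * complex_of_real (norm (fst z - snd z) powr - a))) \<partial>lborel)"
      by (rule nn_integral_cmult) (simp add: borel_prod[symmetric])
    also have "\<dots> < \<infinity>" using fin by (simp add: integrable_iff_bounded ennreal_mult_less_top)
    finally show "(\<integral>\<^sup>+ x. ennreal (norm (case x of (z, s) \<Rightarrow> F z s)) \<partial>(lborel \<Otimes>\<^sub>M lborel)) < \<infinity>" .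
  qed (simp add: case_prod_beta')
  define Q where "Q s = (LINT \<xi>|lborel. (norm (fourier g \<xi>))\<^sup>2 * exp (- (norm \<xi>)\<^sup>2 / (4 * s)))" for s :: real
  have Q0: "Q s \<ge> 0" for s unfolding Q_def by (intro integral_nonneg_AE) auto
  define q where "q s = indicator {0<..} s * (s powr (a / 2 - 1) * inverse (sqrt (4 * pi * s) ^ DIM('a))) * Q s" for s :: real
  have q0: "q s \<ge> 0" for s unfolding q_def using Q0 by (auto simp: indicator_def)
  have inner: "(LINT z|lborel. F z s) = complex_of_real (q s)" for s
  proof (cases "s > 0")
    case True
    have "(LINT z|lborel. F z s) = (LINT z|lborel. (g (fst z) * cnj (g (snd z)) * complex_of_real (exp (- s * (norm (fst z - snd z))\<^sup>2))) * complex_of_real (s powr (a / 2 - 1)))"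
      using True by (intro Bochner_Integration.integral_cong) (auto simp: F_def k_def)
    also have "\<dots> = (LINT z|lborel. g (fst z) * cnj (g (snd z)) * complex_of_real (exp (- s * (norm (fst z - snd z))\<^sup>2))) * complex_of_real (s powr (a / 2 - 1))"
      by (rule integral_mult_left_zero)
    also have "\<dots> = complex_of_real (q s)"
      unfolding gaussian_energy(2)[OF g True] Q_def[symmetric] using True by (simp add: q_def)
    finally show ?thesis .
  qed (simp add: F_def k_def q_def)
  have qint: "integrable lborel q"
    using lborel_pair.integrable_snd[OF int] unfolding inner by (simp add: complex_of_real_integrable_eq)
  define r where "r = (LINT s|lborel. q s) / Gamma (a / 2)"
  have "(LINT z|lborel. g (fst z) * cnj (g (snd z)) * complex_of_real (norm (fst z - snd z) powr - a)) * complex_of_real (Gamma (a / 2))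
      = (LINT z|lborel. g (fst z) * cnj (g (snd z)) * complex_of_real (norm (fst z - snd z) powr - a) * complex_of_real (Gamma (a / 2)))"
    by (rule integral_mult_left_zero[symmetric])
  also have "\<dots> = (LINT z|lborel. LINT s|lborel. F z s)"
  proof (rule integral_cong_AE)
    show "AE z in lborel. g (fst z) * cnj (g (snd z)) * complex_of_real (norm (fst z - snd z) powr - a) * complex_of_real (Gamma (a / 2)) = (LINT s|lborel. F z s)"
      using AE_lborel_off_diagonal
      by eventually_elim (simp add: F_def kint)
  qed (use borel_measurable_integrable[OF fin] lborel_pair.integrable_fst[OF int] in \<open>auto dest: borel_measurable_integrable\<close>)
  also have "\<dots> = (LINT s|lborel. LINT z|lborel. F z s)"
    using lborel_pair.Fubini_integral[OF int] by simp
  also have "\<dots> = complex_of_real (LINT s|lborel. q s)"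
    unfolding inner by (rule integral_complex_of_real)
  finally have E: "(LINT z|lborel. g (fst z) * cnj (g (snd z)) * complex_of_real (norm (fst z - snd z) powr - a)) = complex_of_real r"
    using G by (simp add: r_def field_simps)
  show ?thesis
  proof (rule that[OF _ E])
    show "r \<ge> 0" using G q0 by (auto simp: r_def intro!: divide_nonneg_pos integral_nonneg_AE)
    have "ennreal (Gamma (a / 2) * r) = (\<integral>\<^sup>+ s. ennreal (q s) \<partial>lborel)"
      using G qint q0 by (subst nn_integral_eq_integral) (auto simp: r_def)
    also have "\<dots> = (\<integral>\<^sup>+ s. ennreal (indicator {0<..} s * (s powr (a / 2 - 1) * inverse (sqrt (4 * pi * s) ^ DIM('a))))
            * (\<integral>\<^sup>+ \<xi>. ennreal ((norm (fourier g \<xi>))\<^sup>2 * exp (- (norm \<xi>)\<^sup>2 / (4 * s))) \<partial>lborel) \<partial>lborel)"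
    proof (rule nn_integral_cong)
      fix s :: real
      show "ennreal (q s) = ennreal (indicator {0<..} s * (s powr (a / 2 - 1) * inverse (sqrt (4 * pi * s) ^ DIM('a))))
            * (\<integral>\<^sup>+ \<xi>. ennreal ((norm (fourier g \<xi>))\<^sup>2 * exp (- (norm \<xi>)\<^sup>2 / (4 * s))) \<partial>lborel)"
      proof (cases "s > 0")
        case True
        have "(\<integral>\<^sup>+ \<xi>. ennreal ((norm (fourier g \<xi>))\<^sup>2 * exp (- (norm \<xi>)\<^sup>2 / (4 * s))) \<partial>lborel) = ennreal (Q s)"
          unfolding Q_def by (rule nn_integral_eq_integral[OF gaussian_energy(1)[OF g True]]) auto
        then show ?thesis
          using True by (simp only: q_def) (simp add: ennreal_mult Q0)
      qed (simp add: q_def)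
    qed
    finally show "ennreal (Gamma (a / 2) * r) = \<dots>" .
  qed
qed

text \<open>
  A vector space of functions for which all Riesz energies of order \<open>a < d\<close> converge absolutely. It
  contains the indicators of bounded Borel sets and, as functions of time, the wave kernels at a
  fixed frequency.
\<close>

definition bounded_support :: "('a::euclidean_space \<Rightarrow> complex) \<Rightarrow> bool" where
  "bounded_support g \<longleftrightarrow> g \<in> borel_measurable borel \<and>
     (\<exists>B R. \<forall>x. norm (g x) \<le> B * indicator (cball 0 R) x)"

lemma bounded_support_measurable [measurable_dest]: "bounded_support g \<Longrightarrow> g \<in> borel_measurable borel"
  by (simp add: bounded_support_def)

lemma bounded_support_integrable:
  assumes "bounded_support (g :: 'a::euclidean_space \<Rightarrow> complex)"
  shows "integrable lborel g"
proof -
  from assms obtain B R where B: "\<And>x. norm (g x) \<le> B * indicator (cball 0 R) x"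
    unfolding bounded_support_def by auto
  have [measurable]: "g \<in> borel_measurable borel" using assms by (rule bounded_support_measurable)
  have "integrable lborel (\<lambda>x::'a. B * indicator (cball 0 R) x)"
    by (intro integrable_mult_right integrable_real_indicator) (use emeasure_lborel_cball_finite[of "0::'a" R] in auto)
  then show ?thesis
    by (rule Bochner_Integration.integrable_bound) (use B in \<open>auto intro: order_trans[OF _ abs_ge_self]\<close>)
qed

lemma bounded_support_cmult:
  assumes "bounded_support g" shows "bounded_support (\<lambda>x. c * g x)"
proof -
  from assms obtain B R where B: "\<And>x. norm (g x) \<le> B * indicator (cball 0 R) x"
    unfolding bounded_support_def by auto
  have [measurable]: "g \<in> borel_measurable borel" using assms by (rule bounded_support_measurable)
  have "norm (c * g x) \<le> (norm c * B) * indicator (cball 0 R) x" for x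
    using mult_left_mono[OF B[of x], of "norm c"] by (simp add: norm_mult mult_ac)
  then show ?thesis unfolding bounded_support_def by auto
qed

lemma bounded_support_add:
  assumes "bounded_support g" "bounded_support h" shows "bounded_support (\<lambda>x. g x + h x)"
proof -
  from assms(1) obtain B R where B: "\<And>x. norm (g x) \<le> B * indicator (cball 0 R) x"
    unfolding bounded_support_def by auto
  from assms(2) obtain B' R' where B': "\<And>x. norm (h x) \<le> B' * indicator (cball 0 R') x"
    unfolding bounded_support_def by auto
  have [measurable]: "g \<in> borel_measurable borel" "h \<in> borel_measurable borel"
    using assms by (auto dest: bounded_support_measurable)
  have "norm (g x + h x) \<le> (\<bar>B\<bar> + \<bar>B'\<bar>) * indicator (cball 0 (max R R')) x" for x
  proof -
    have "norm (g x) \<le> \<bar>B\<bar> * indicator (cball 0 (max R R')) x"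
      using B[of x] by (cases "x \<in> cball 0 R") auto
    moreover have "norm (h x) \<le> \<bar>B'\<bar> * indicator (cball 0 (max R R')) x"
      using B'[of x] by (cases "x \<in> cball 0 R'") auto
    ultimately show ?thesis
      using norm_triangle_ineq[of "g x" "h x"] by (simp add: distrib_right)
  qed
  then show ?thesis unfolding bounded_support_def by auto
qed

lemma bounded_support_diff:
  assumes "bounded_support g" "bounded_support h" shows "bounded_support (\<lambda>x. g x - h x)"
  using bounded_support_add[OF assms(1) bounded_support_cmult[OF assms(2), of "-1"]] by simp

lemma bounded_support_indicator:
  assumes "A \<in> sets borel" "bounded A"
  shows "bounded_support (\<lambda>x. complex_of_real (indicator A x))"
proof -
  from assms(2) obtain R where R: "A \<subseteq> cball 0 R"
    by (auto simp: subset_eq bounded_iff)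
  have "norm (complex_of_real (indicator A x)) \<le> 1 * indicator (cball 0 R) x" for x
    using R by (auto simp: indicator_def)
  moreover have "(\<lambda>x. complex_of_real (indicator A x)) \<in> borel_measurable borel"
    using assms by measurable
  ultimately show ?thesis unfolding bounded_support_def by blast
qed

text \<open>
  After the translation \<open>y = x + w\<close> the inner integral runs over a ball of \<open>w\<close> that does not depend
  on \<open>x\<close>, and the kernel is integrable there.
\<close>

lemma riesz_kernel_integrable:
  fixes g h :: "'a::euclidean_space \<Rightarrow> complex" and a :: real
  assumes a: "0 < a" "a < DIM('a)" and gh: "bounded_support g" "bounded_support h"
  shows "integrable lborel (\<lambda>z. g (fst z) * cnj (h (snd z)) * complex_of_real (norm (fst z - snd z) powr - a))"
proof (rule integrableI_bounded)
  from gh(1) obtain B R where B: "\<And>x. norm (g x) \<le> B * indicator (cball 0 R) x"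
    unfolding bounded_support_def by auto
  from gh(2) obtain B' R' where B': "\<And>x. norm (h x) \<le> B' * indicator (cball 0 R') x"
    unfolding bounded_support_def by auto
  have [measurable]: "g \<in> borel_measurable borel" "h \<in> borel_measurable borel"
    using gh by (auto dest: bounded_support_measurable)
  show "(\<lambda>z. g (fst z) * cnj (h (snd z)) * complex_of_real (norm (fst z - snd z) powr - a)) \<in> borel_measurable lborel"
    by (simp add: borel_prod[symmetric])
  have [measurable]: "cball (0::'a) (R + R') \<in> sets borel" by simp
  define I where "I = (\<integral>\<^sup>+ z. ennreal (indicator (cball 0 (R + R')) z * norm (z::'a) powr (- a)) \<partial>lborel)"
  have I: "I < \<infinity>" unfolding I_def by (rule nn_integral_norm_powr_cball_finite[OF a])
  have "(\<integral>\<^sup>+ z. ennreal (norm (g (fst z) * cnj (h (snd z)) * complex_of_real (norm (fst z - snd z) powr - a))) \<partial>lborel)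
    = (\<integral>\<^sup>+ x. \<integral>\<^sup>+ y. ennreal (norm (g x) * norm (h y) * norm (x - y) powr - a) \<partial>lborel \<partial>lborel)"
    unfolding lborel_prod[symmetric] by (subst lborel.nn_integral_fst[symmetric]) (auto simp: norm_mult)
  also have "\<dots> \<le> (\<integral>\<^sup>+ x. ennreal (\<bar>B\<bar> * \<bar>B'\<bar>) * I * indicator (cball 0 R) (x::'a) \<partial>lborel)"
  proof (rule nn_integral_mono)
    fix x :: 'a
    show "(\<integral>\<^sup>+ y. ennreal (norm (g x) * norm (h y) * norm (x - y) powr - a) \<partial>lborel) \<le> ennreal (\<bar>B\<bar> * \<bar>B'\<bar>) * I * indicator (cball 0 R) x"
    proof (cases "x \<in> cball 0 R")
      case True
      have "(\<integral>\<^sup>+ y. ennreal (norm (g x) * norm (h y) * norm (x - y) powr - a) \<partial>lborel)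
        = (\<integral>\<^sup>+ w. ennreal (norm (g x) * norm (h (x + w)) * norm w powr - a) \<partial>lborel)"
        by (subst lborel_distr_plus[of x, symmetric], subst nn_integral_distr) auto
      also have "\<dots> \<le> (\<integral>\<^sup>+ w. ennreal (\<bar>B\<bar> * \<bar>B'\<bar>) * ennreal (indicator (cball 0 (R + R')) w * norm (w::'a) powr - a) \<partial>lborel)"
      proof (rule nn_integral_mono)
        fix w :: 'a
        have "norm (h (x + w)) \<le> \<bar>B'\<bar> * indicator (cball 0 (R + R')) w"
        proof (cases "x + w \<in> cball 0 R'")
          case True
          have "norm w \<le> norm (x + w) + norm x" by norm
          with True \<open>x \<in> cball 0 R\<close> have "w \<in> cball 0 (R + R')" by simp
          then show ?thesis using B'[of "x + w"] True by simp
        qed (use B'[of "x + w"] in simp)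
        moreover have "norm (g x) \<le> \<bar>B\<bar>" using B[of x] True by simp
        ultimately have "norm (g x) * norm (h (x + w)) \<le> \<bar>B\<bar> * (\<bar>B'\<bar> * indicator (cball 0 (R + R')) w)"
          by (intro mult_mono) auto
        from mult_right_mono[OF this, of "norm w powr - a"]
        show "ennreal (norm (g x) * norm (h (x + w)) * norm w powr - a) \<le> ennreal (\<bar>B\<bar> * \<bar>B'\<bar>) * ennreal (indicator (cball 0 (R + R')) w * norm w powr - a)"
          by (simp add: ennreal_mult[symmetric] mult_ac ennreal_leI)
      qed
      also have "\<dots> = ennreal (\<bar>B\<bar> * \<bar>B'\<bar>) * I" unfolding I_def by (rule nn_integral_cmult) simp
      finally show ?thesis using True by simp
    next
      case False
      then have "g x = 0" using B[of x] by simp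
      then show ?thesis by simp
    qed
  qed
  also have "\<dots> = ennreal (\<bar>B\<bar> * \<bar>B'\<bar>) * I * emeasure lborel (cball (0::'a) R)"
    by (rule nn_integral_cmult_indicator) simp
  also have "\<dots> < \<infinity>"
    using I emeasure_lborel_cball_finite[of "0::'a" R] by (simp add: ennreal_mult_less_top)
  finally show "(\<integral>\<^sup>+ z. ennreal (norm (g (fst z) * cnj (h (snd z)) * complex_of_real (norm (fst z - snd z) powr - a))) \<partial>lborel) < \<infinity>" .
qed

text \<open>
  The mutual energy of \<open>g\<close> and \<open>h\<close> for the Riesz kernel \<open>|x - y|\<^bsup>-a\<^esup>\<close>. It is used in space with
  \<open>a = \<beta>\<close> and in time with \<open>a = 2 - 2H\<close>.
\<close>

definition riesz_form :: "real \<Rightarrow> ('a::euclidean_space \<Rightarrow> complex) \<Rightarrow> ('a \<Rightarrow> complex) \<Rightarrow> complex" where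
  "riesz_form a g h = (LINT z|lborel. g (fst z) * cnj (h (snd z)) * complex_of_real (norm (fst z - snd z) powr - a))"

abbreviation riesz_energy :: "real \<Rightarrow> ('a::euclidean_space \<Rightarrow> complex) \<Rightarrow> real" where
  "riesz_energy a g \<equiv> Re (riesz_form a g g)"

lemma riesz_form_cmult: "riesz_form a (\<lambda>x. c * g x) (\<lambda>x. d * h x) = c * cnj d * riesz_form a g h"
  unfolding riesz_form_def by (subst integral_mult_right_zero[symmetric]) (simp add: mult_ac)

context
  fixes a :: real
  assumes a: "0 < a" "a < DIM('a::euclidean_space)"
begin

lemma riesz_form_iterated:
  assumes "bounded_support (g::'a \<Rightarrow> complex)" "bounded_support h"
  shows "riesz_form a g h = (LINT x|lborel. LINT y|lborel. g x * cnj (h y) * complex_of_real (norm (x - y) powr - a))"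
  using lborel_pair.integral_fst'[OF riesz_kernel_integrable[OF a assms, folded lborel_prod]]
  unfolding riesz_form_def by (simp add: lborel_prod)

lemma riesz_form_add:
  assumes "bounded_support (g::'a \<Rightarrow> complex)" "bounded_support g'" "bounded_support h" "bounded_support h'"
  shows "riesz_form a (\<lambda>x. g x + g' x) (\<lambda>x. h x + h' x)
    = riesz_form a g h + riesz_form a g h' + riesz_form a g' h + riesz_form a g' h'"
  using riesz_kernel_integrable[OF a assms(1,3)] riesz_kernel_integrable[OF a assms(1,4)]
    riesz_kernel_integrable[OF a assms(2,3)] riesz_kernel_integrable[OF a assms(2,4)]
  unfolding riesz_form_def by (simp add: algebra_simps flip: Bochner_Integration.integral_add)

lemma riesz_form_polar:
  assumes "bounded_support (g::'a \<Rightarrow> complex)" "bounded_support h"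
  shows "riesz_energy a (\<lambda>x. g x + h x) = riesz_energy a g + riesz_energy a h + (Re (riesz_form a g h) + Re (riesz_form a h g))"
    and "riesz_energy a (\<lambda>x. g x - h x) = riesz_energy a g + riesz_energy a h - (Re (riesz_form a g h) + Re (riesz_form a h g))"
proof -
  have m: "bounded_support (\<lambda>x. (-1) * h x)" by (rule bounded_support_cmult[OF assms(2)])
  show "riesz_energy a (\<lambda>x. g x + h x) = riesz_energy a g + riesz_energy a h + (Re (riesz_form a g h) + Re (riesz_form a h g))"
    using riesz_form_add[OF assms assms] by simp
  show "riesz_energy a (\<lambda>x. g x - h x) = riesz_energy a g + riesz_energy a h - (Re (riesz_form a g h) + Re (riesz_form a h g))"
    using riesz_form_add[OF assms(1) m assms(1) m] riesz_form_cmult[of a 1 g "-1" h] riesz_form_cmult[of a "-1" h 1 g] riesz_form_cmult[of a "-1" h "-1" h]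
    by simp
qed

lemma riesz_energy_nonneg:
  assumes "bounded_support (g::'a \<Rightarrow> complex)"
  shows "riesz_form a g g = complex_of_real (riesz_energy a g)" "riesz_energy a g \<ge> 0"
  using riesz_energy_mixture[OF bounded_support_integrable[OF assms] a(1) riesz_kernel_integrable[OF a assms assms]]
  unfolding riesz_form_def[symmetric] by (metis Re_complex_of_real)+

text \<open>
  The parallelogram identity and positivity. This inequality plays the part of the triangle
  inequality for the seminorm given by the square root of the energy.
\<close>

lemma riesz_energy_diff_le:
  assumes "bounded_support (g::'a \<Rightarrow> complex)" "bounded_support h"
  shows "riesz_energy a (\<lambda>x. g x - h x) \<le> 2 * riesz_energy a g + 2 * riesz_energy a h"
  using riesz_form_polar[OF assms] riesz_energy_nonneg(2)[OF bounded_support_add[OF assms]] by linarith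

end

section \<open>Riesz energies on the Fourier side\<close>

lemma borel_measurable_fourier [measurable]:
  assumes [measurable]: "g \<in> borel_measurable borel"
  shows "fourier g \<in> borel_measurable borel"
  unfolding fourier_def by measurable

lemma fourier_add:
  assumes "integrable lborel g" "integrable lborel h"
  shows "fourier (\<lambda>x. g x + h x) \<xi> = fourier g \<xi> + fourier h \<xi>"
proof -
  have "integrable lborel (\<lambda>x. cis (- (\<xi> \<bullet> x)) * g x)" if "integrable lborel g" for g
    using that by (rule Bochner_Integration.integrable_bound) (use that in \<open>auto simp: norm_mult\<close>)
  from this[OF assms(1)] this[OF assms(2)] show ?thesis
    by (simp add: fourier_def distrib_left)
qed

lemma fourier_cmult: "fourier (\<lambda>x. c * g x) \<xi> = c * fourier g \<xi>"
  unfolding fourier_def by (subst integral_mult_right_zero[symmetric]) (simp add: mult_ac)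

text \<open>
  By Tonelli's theorem the mixing integral in \<open>riesz_energy_mixture\<close> may be done first; it turns
  \<open>e\<^bsup>-|\<xi>|^2/(4s)\<^esup>\<close> into a multiple of \<open>|\<xi>|\<^bsup>a-d\<^esup>\<close>, the density of the spectral measure. The energy
  being finite, \<open>|fourier g|\<^sup>2\<close> is integrable for that measure.
\<close>

lemma riesz_energy_fourier:
  fixes a :: real
  assumes a: "0 < a" "a < DIM('a::euclidean_space)"
  obtains K where "K > 0"
    "\<And>g :: 'a \<Rightarrow> complex. bounded_support g \<Longrightarrow>
       integrable (riesz_measure a) (\<lambda>\<xi>. (norm (fourier g \<xi>))\<^sup>2) \<and>
       riesz_energy a g = K * (LINT \<xi>|riesz_measure a. (norm (fourier g \<xi>))\<^sup>2)"
proof -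
  let ?d = "real DIM('a)"
  have "(a - ?d) / 2 < 0" using a by simp
  from nn_integral_powr_exp_inverse[OF this] obtain K0 where K0: "K0 > 0" "\<And>r. r > 0 \<Longrightarrow>
    (\<integral>\<^sup>+ s. ennreal (indicator {0<..} s * (s powr ((a - ?d) / 2 - 1) * exp (- r\<^sup>2 / (4 * s)))) \<partial>lborel) = ennreal (K0 * r powr (2 * ((a - ?d) / 2)))"
    by blast
  have "2 * ((a - ?d) / 2) = a - ?d" by simp
  note K0 = K0(1) K0(2)[unfolded this]
  define C where "C = inverse (sqrt (4 * pi) ^ DIM('a))"
  have C: "C > 0" by (simp add: C_def)
  have G: "Gamma (a / 2) > 0" using a by simp
  \<comment> \<open>\<open>C s\<^bsup>-d/2\<^esup>\<close> comes from the Gaussian energies, \<open>K0\<close> from the mixing integral, and the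
    Gamma factor normalises the mixture that represents the kernel.\<close>
  define K where "K = C * K0 / Gamma (a / 2)"
  have K: "K > 0" using C K0 G by (simp add: K_def)
  show ?thesis
  proof (rule that[OF K])
    fix g :: "'a \<Rightarrow> complex" assume g: "bounded_support g"
    have [measurable]: "g \<in> borel_measurable borel" using g by (rule bounded_support_measurable)
    have [measurable]: "fourier g \<in> borel_measurable borel" by measurable
    let ?E = "riesz_energy a g"
    have E: "?E \<ge> 0" by (rule riesz_energy_nonneg(2)[OF a g])
    obtain r where r: "r \<ge> 0" "riesz_form a g g = complex_of_real r"
      "ennreal (Gamma (a / 2) * r) = (\<integral>\<^sup>+ s. ennreal (indicator {0<..} s * (s powr (a / 2 - 1) * inverse (sqrt (4 * pi * s) ^ DIM('a))))
            * (\<integral>\<^sup>+ \<xi>. ennreal ((norm (fourier g \<xi>))\<^sup>2 * exp (- (norm \<xi>)\<^sup>2 / (4 * s))) \<partial>lborel) \<partial>lborel)"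
      using riesz_energy_mixture[OF bounded_support_integrable[OF g] a(1) riesz_kernel_integrable[OF a g g]]
      unfolding riesz_form_def by blast
    have "r = ?E" using r(2) by simp
    have w: "indicator {0<..} s * (s powr (a / 2 - 1) * inverse (sqrt (4 * pi * s) ^ DIM('a))) = C * (indicator {0<..} s * s powr ((a - ?d) / 2 - 1))" for s :: real
    proof (cases "s > 0")
      case True
      have "sqrt s ^ DIM('a) = s powr (?d / 2)"
        using True by (simp add: powr_half_sqrt[symmetric] powr_powr flip: powr_realpow)
      then have "inverse (sqrt (4 * pi * s) ^ DIM('a)) = C * s powr (- ?d / 2)"
        by (simp only: C_def real_sqrt_mult power_mult_distrib inverse_mult_distrib minus_divide_left[symmetric] powr_minus)
      moreover have "s powr (a / 2 - 1) * s powr (- ?d / 2) = s powr ((a - ?d) / 2 - 1)"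
        unfolding powr_add[symmetric] by (rule arg_cong[where f="\<lambda>e. s powr e"]) (simp add: field_simps)
      ultimately show ?thesis using True by simp
    qed simp
    have "ennreal (Gamma (a / 2) * ?E) = (\<integral>\<^sup>+ s. \<integral>\<^sup>+ \<xi>. ennreal (C * (norm (fourier g \<xi>))\<^sup>2) * ennreal (indicator {0<..} s * (s powr ((a - ?d) / 2 - 1) * exp (- (norm \<xi>)\<^sup>2 / (4 * s)))) \<partial>lborel \<partial>lborel)"
      unfolding r(3)[unfolded \<open>r = ?E\<close>] w using C
      by (intro nn_integral_cong, subst nn_integral_cmult[symmetric]) (auto simp: ennreal_mult[symmetric] mult_ac intro!: nn_integral_cong)
    also have "\<dots> = (\<integral>\<^sup>+ \<xi>. \<integral>\<^sup>+ s. ennreal (C * (norm (fourier g \<xi>))\<^sup>2) * ennreal (indicator {0<..} s * (s powr ((a - ?d) / 2 - 1) * exp (- (norm \<xi>)\<^sup>2 / (4 * s)))) \<partial>lborel \<partial>lborel)"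
      by (rule lborel_pair.Fubini') simp
    also have "\<dots> = (\<integral>\<^sup>+ \<xi>. ennreal (C * K0) * (ennreal (norm \<xi> powr (a - ?d)) * ennreal ((norm (fourier g \<xi>))\<^sup>2)) \<partial>lborel)"
    proof (rule nn_integral_cong_AE, use AE_lborel_singleton[of "0::'a"] in eventually_elim)
      fix \<xi> :: 'a assume "\<xi> \<noteq> 0"
      then have pos: "norm \<xi> > 0" by simp
      show "(\<integral>\<^sup>+ s. ennreal (C * (norm (fourier g \<xi>))\<^sup>2) * ennreal (indicator {0<..} s * (s powr ((a - ?d) / 2 - 1) * exp (- (norm \<xi>)\<^sup>2 / (4 * s)))) \<partial>lborel)
        = ennreal (C * K0) * (ennreal (norm \<xi> powr (a - ?d)) * ennreal ((norm (fourier g \<xi>))\<^sup>2))"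
        using C K0(1) by (subst nn_integral_cmult, simp, subst K0(2)[OF pos]) (simp add: ennreal_mult[symmetric] mult_ac)
    qed
    also have "\<dots> = ennreal (C * K0) * (\<integral>\<^sup>+ \<xi>. ennreal ((norm (fourier g \<xi>))\<^sup>2) \<partial>riesz_measure a)"
      unfolding riesz_measure_def by (subst nn_integral_density) (auto simp: nn_integral_cmult)
    finally have eq: "ennreal (Gamma (a / 2) * ?E) = ennreal (C * K0) * (\<integral>\<^sup>+ \<xi>. ennreal ((norm (fourier g \<xi>))\<^sup>2) \<partial>riesz_measure a)" .
    have [measurable]: "fourier g \<in> borel_measurable (riesz_measure a)"
      by (simp add: riesz_measure_def)
    have "ennreal (C * K0) * (\<integral>\<^sup>+ \<xi>. ennreal ((norm (fourier g \<xi>))\<^sup>2) \<partial>riesz_measure a) < \<infinity>"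
      unfolding eq[symmetric] by simp
    then have fin: "(\<integral>\<^sup>+ \<xi>. ennreal ((norm (fourier g \<xi>))\<^sup>2) \<partial>riesz_measure a) < \<infinity>"
      using C K0(1) by (auto simp: ennreal_mult_less_top ennreal_eq_0_iff mult_le_0_iff)
    then have int: "integrable (riesz_measure a) (\<lambda>\<xi>. (norm (fourier g \<xi>))\<^sup>2)"
      by (intro integrableI_nonneg) auto
    have "ennreal (Gamma (a / 2) * ?E) = ennreal (C * K0 * (LINT \<xi>|riesz_measure a. (norm (fourier g \<xi>))\<^sup>2))"
      unfolding eq using int C K0(1) by (subst nn_integral_eq_integral) (auto simp: ennreal_mult)
    then have "Gamma (a / 2) * ?E = C * K0 * (LINT \<xi>|riesz_measure a. (norm (fourier g \<xi>))\<^sup>2)"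
      using E G C K0(1) by (subst (asm) ennreal_inj) (auto intro!: mult_nonneg_nonneg integral_nonneg_AE)
    then have "?E = K * (LINT \<xi>|riesz_measure a. (norm (fourier g \<xi>))\<^sup>2)"
      using G by (simp add: K_def field_simps)
    with int show "integrable (riesz_measure a) (\<lambda>\<xi>. (norm (fourier g \<xi>))\<^sup>2) \<and>
       ?E = K * (LINT \<xi>|riesz_measure a. (norm (fourier g \<xi>))\<^sup>2)" by blast
  qed
qed

text \<open>
  Polarisation of \<open>riesz_energy_fourier\<close>. The left-hand side is symmetrised in \<open>g\<close> and \<open>h\<close>, which
  is what polarisation of a quadratic form yields directly.
\<close>

lemma riesz_form_fourier:
  fixes a :: real
  assumes a: "0 < a" "a < DIM('a::euclidean_space)"
  obtains K where "K > 0"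
    "\<And>g h :: 'a \<Rightarrow> complex. bounded_support g \<Longrightarrow> bounded_support h \<Longrightarrow>
       integrable (riesz_measure a) (\<lambda>\<xi>. Re (fourier g \<xi> * cnj (fourier h \<xi>)))"
    "\<And>g h :: 'a \<Rightarrow> complex. bounded_support g \<Longrightarrow> bounded_support h \<Longrightarrow>
       Re (riesz_form a g h) + Re (riesz_form a h g) = 2 * K * (LINT \<xi>|riesz_measure a. Re (fourier g \<xi> * cnj (fourier h \<xi>)))"
proof -
  obtain K where K: "K > 0" 
    and int: "\<And>g :: 'a \<Rightarrow> complex. bounded_support g \<Longrightarrow> integrable (riesz_measure a) (\<lambda>\<xi>. (norm (fourier g \<xi>))\<^sup>2)"
    and E: "\<And>g :: 'a \<Rightarrow> complex. bounded_support g \<Longrightarrow> riesz_energy a g = K * (LINT \<xi>|riesz_measure a. (norm (fourier g \<xi>))\<^sup>2)"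
    using riesz_energy_fourier[OF a] by metis
  have polar: "Re (u * cnj v) = ((norm (u + v))\<^sup>2 - (norm (u - v))\<^sup>2) / 4" for u v
    by (simp only: cmod_power2) (simp add: power2_eq_square algebra_simps)
  have eq: "Re (fourier g \<xi> * cnj (fourier h \<xi>)) = ((norm (fourier (\<lambda>x. g x + h x) \<xi>))\<^sup>2 - (norm (fourier (\<lambda>x. g x - h x) \<xi>))\<^sup>2) / 4"
    if "bounded_support g" "bounded_support h" for g h :: "'a \<Rightarrow> complex" and \<xi>
  proof -
    note i = bounded_support_integrable[OF that(1)] bounded_support_integrable[OF that(2)]
    have "fourier (\<lambda>x. g x - h x) \<xi> = fourier g \<xi> - fourier h \<xi>"
      using fourier_add[OF i(1), of "\<lambda>x. (-1) * h x" \<xi>] i(2) fourier_cmult[of "-1" h \<xi>] by simp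
    then show ?thesis by (simp only: fourier_add[OF i] polar)
  qed
  show ?thesis
  proof (rule that[OF K])
    fix g h :: "'a \<Rightarrow> complex" assume gh: "bounded_support g" "bounded_support h"
    note p = bounded_support_add[OF gh] and m = bounded_support_diff[OF gh]
    show "integrable (riesz_measure a) (\<lambda>\<xi>. Re (fourier g \<xi> * cnj (fourier h \<xi>)))"
      unfolding eq[OF gh] using int[OF p] int[OF m] by simp
    show "Re (riesz_form a g h) + Re (riesz_form a h g) = 2 * K * (LINT \<xi>|riesz_measure a. Re (fourier g \<xi> * cnj (fourier h \<xi>)))"
      unfolding eq[OF gh] using int[OF p] int[OF m] E[OF p] E[OF m] riesz_form_polar[OF a gh] K
      by (simp add: field_simps)
  qed
qed

section \<open>The covariance of fractional Brownian motion\<close>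

text \<open>
  \<open>sgn(v - r) |v - r|\<^bsup>h\<^esup>\<close>, written with positive parts, is an antiderivative of the singular kernel
  that is continuous across the singularity at \<open>v = r\<close>.
\<close>

lemma signed_powr_derivative:
  fixes h r v :: real
  assumes "v \<noteq> r"
  shows "((\<lambda>v. max (v - r) 0 powr h - max (r - v) 0 powr h) has_vector_derivative (h * \<bar>r - v\<bar> powr (h - 1))) (at v)"
proof (cases "v > r")
  case True
  have "((\<lambda>v. (v - r) powr h) has_real_derivative (h * \<bar>r - v\<bar> powr (h - 1))) (at v)"
    using True by (auto intro!: derivative_eq_intros simp: abs_minus_commute)
  then have "((\<lambda>v. (v - r) powr h) has_vector_derivative (h * \<bar>r - v\<bar> powr (h - 1))) (at v)"
    by (rule has_real_derivative_iff_has_vector_derivative[THEN iffD1])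
  then show ?thesis
    by (rule has_vector_derivative_transform_within_open[of _ _ _ "{r<..}"]) (use True in auto)
next
  case False
  then have v: "v < r" using assms by simp
  have "((\<lambda>v. - ((r - v) powr h)) has_real_derivative (h * \<bar>r - v\<bar> powr (h - 1))) (at v)"
    using v by (auto intro!: derivative_eq_intros)
  then have "((\<lambda>v. - ((r - v) powr h)) has_vector_derivative (h * \<bar>r - v\<bar> powr (h - 1))) (at v)"
    by (rule has_real_derivative_iff_has_vector_derivative[THEN iffD1])
  then show ?thesis
    by (rule has_vector_derivative_transform_within_open[of _ _ _ "{..<r}"]) (use v in auto)
qed

lemma continuous_on_max_powr: "h > 0 \<Longrightarrow> continuous_on A f \<Longrightarrow> continuous_on A (\<lambda>x. max (f x) 0 powr (h :: real))"
  by (intro continuous_on_powr' continuous_intros) auto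

lemma has_integral_abs_powr:
  fixes h r p q :: real
  assumes h: "h > 0" and pq: "p \<le> q"
  shows "((\<lambda>v. \<bar>r - v\<bar> powr (h - 1)) has_integral
     ((max (q - r) 0 powr h - max (r - q) 0 powr h) / h - (max (p - r) 0 powr h - max (r - p) 0 powr h) / h)) {p..q}"
proof (rule fundamental_theorem_of_calculus_interior_strong[where S="{r}"])
  fix v assume "v \<in> {p<..<q} - {r}"
  then have "v \<noteq> r" by simp
  from has_vector_derivative_mult_right[OF signed_powr_derivative[OF this, of h], of "1 / h"]
  show "((\<lambda>v. (max (v - r) 0 powr h - max (r - v) 0 powr h) / h) has_vector_derivative \<bar>r - v\<bar> powr (h - 1)) (at v)"
    using h by simp
next
  show "continuous_on {p..q} (\<lambda>v. (max (v - r) 0 powr h - max (r - v) 0 powr h) / h)"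
    using h by (intro continuous_intros continuous_on_max_powr) auto
qed (use pq in auto)

lemma lborel_integral_abs_powr:
  fixes h r p q :: real
  assumes h: "h > 0" and pq: "p \<le> q"
  shows "integrable lborel (\<lambda>v. indicator {p..q} v * \<bar>r - v\<bar> powr (h - 1))"
    and "(LINT v|lborel. indicator {p..q} v * \<bar>r - v\<bar> powr (h - 1))
      = (max (q - r) 0 powr h - max (r - q) 0 powr h) / h - (max (p - r) 0 powr h - max (r - p) 0 powr h) / h" (is "_ = ?I")
proof -
  note hi = has_integral_abs_powr[OF assms, of r]
  have nn: "(\<integral>\<^sup>+ v. ennreal (indicator {p..q} v * \<bar>r - v\<bar> powr (h - 1)) \<partial>lborel) = ennreal ?I"
    by (rule nn_integral_has_integral_lebesgue[OF _ hi]) simp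
  have I: "?I \<ge> 0" by (rule has_integral_nonneg[OF hi]) simp
  show "integrable lborel (\<lambda>v. indicator {p..q} v * \<bar>r - v\<bar> powr (h - 1))"
    by (rule integrableI_nonneg) (auto simp: nn)
  show "(LINT v|lborel. indicator {p..q} v * \<bar>r - v\<bar> powr (h - 1)) = ?I"
    using I nn by (subst integral_eq_nn_integral) auto
qed

text \<open>
  The fractional covariance is the double integral of \<open>\<alpha>\<^sub>H |r - v|\<^bsup>2H-2\<^esup>\<close> over \<open>[0,t] \<times> [0,s]\<close>:
  both integrations are instances of the fundamental theorem of calculus, each with one exceptional
  point.
\<close>

lemma R_H_eq_riesz_form:
  assumes H: "1 / 2 < H" "H < 1" and ts: "0 \<le> t" "0 \<le> s"
  shows "complex_of_real (alpha_H H) * riesz_form (2 - 2 * H) (\<lambda>r. complex_of_real (indicator {0..t} r)) (\<lambda>r. complex_of_real (indicator {0..s} r))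
    = complex_of_real (R_H H t s)"
proof -
  define h where "h = 2 * H - 1"
  have h: "h > 0" "2 * H > 0" "- (2 - 2 * H) = h - 1" "2 * H = h + 1" using H by (auto simp: h_def)
  define \<phi> where "\<phi> r = (max (s - r) 0 powr h - max (r - s) 0 powr h) / h - (max (0 - r) 0 powr h - max (r - 0) 0 powr h) / h" for r
  define F where "F r = (r powr (2 * H) - (max (r - s) 0 powr (2 * H) + max (s - r) 0 powr (2 * H))) / (h * (2 * H))" for r
  have inner: "(LINT v|lborel. indicator {0..s} v * \<bar>r - v\<bar> powr (h - 1)) = \<phi> r" for r
    unfolding \<phi>_def by (rule lborel_integral_abs_powr(2)[OF h(1) ts(2)])
  have cont: "continuous_on {0..t} \<phi>"
    unfolding \<phi>_def using h by (intro continuous_intros continuous_on_max_powr) auto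
  have "(\<phi> has_integral (F t - F 0)) {0..t}"
  proof (rule fundamental_theorem_of_calculus_interior_strong[where S="{s}"])
    show "continuous_on {0..t} F"
    proof -
      have "continuous_on {0..t} (\<lambda>r. (max r 0 powr (2 * H) - (max (r - s) 0 powr (2 * H) + max (s - r) 0 powr (2 * H))) / (h * (2 * H)))"
        using h by (intro continuous_intros continuous_on_max_powr) auto
      then show ?thesis
        by (rule continuous_on_eq) (auto simp: F_def)
    qed
  next
    fix r assume r: "r \<in> {0<..<t} - {s}"
    have d1: "((\<lambda>r. r powr (2 * H)) has_vector_derivative (2 * H * r powr h)) (at r)"
      unfolding has_real_derivative_iff_has_vector_derivative[symmetric]
      using r by (auto intro!: derivative_eq_intros simp: h_def)
    have d2: "((\<lambda>r. max (r - s) 0 powr (2 * H) + max (s - r) 0 powr (2 * H)) has_vector_derivative (2 * H * (max (r - s) 0 powr h - max (s - r) 0 powr h))) (at r)"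
    proof (cases "r > s")
      case True
      have "((\<lambda>r. (r - s) powr (2 * H)) has_vector_derivative (2 * H * (max (r - s) 0 powr h - max (s - r) 0 powr h))) (at r)"
        unfolding has_real_derivative_iff_has_vector_derivative[symmetric]
        using True by (auto intro!: derivative_eq_intros simp: h_def)
      then show ?thesis
        by (rule has_vector_derivative_transform_within_open[of _ _ _ "{s<..}"]) (use True in auto)
    next
      case False
      then have "r < s" using r by simp
      have "((\<lambda>r. (s - r) powr (2 * H)) has_vector_derivative (2 * H * (max (r - s) 0 powr h - max (s - r) 0 powr h))) (at r)"
        unfolding has_real_derivative_iff_has_vector_derivative[symmetric]
        using \<open>r < s\<close> by (auto intro!: derivative_eq_intros simp: h_def)
      then show ?thesis
        by (rule has_vector_derivative_transform_within_open[of _ _ _ "{..<s}"]) (use \<open>r < s\<close> in auto)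
    qed
    from has_vector_derivative_mult_right[OF has_vector_derivative_diff[OF d1 d2], of "1 / (h * (2 * H))"]
    have "(F has_vector_derivative (1 / (h * (2 * H)) * (2 * H * r powr h - 2 * H * (max (r - s) 0 powr h - max (s - r) 0 powr h)))) (at r)"
      by (simp add: F_def[abs_def])
    moreover have "1 / (h * (2 * H)) * (2 * H * r powr h - 2 * H * (max (r - s) 0 powr h - max (s - r) 0 powr h)) = \<phi> r"
    proof -
      have "1 / (h * (2 * H)) * (2 * H * A - 2 * H * (B - C)) = (C - B) / h - (0 - A) / h" for A B C
        using h(1,2) by (simp add: field_simps)
      then show ?thesis using r h by (simp add: \<phi>_def)
    qed
    ultimately show "(F has_vector_derivative \<phi> r) (at r)" by simp
  qed (use ts in auto)
  then have outer: "(LINT r|lborel. indicator {0..t} r * \<phi> r) = F t - F 0"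
    using set_borel_integral_eq_integral(2)[OF borel_integrable_atLeastAtMost'[OF cont]]
    by (simp add: set_lebesgue_integral_def integral_unique)
  have mx: "max (r - s) 0 powr (2 * H) + max (s - r) 0 powr (2 * H) = \<bar>r - s\<bar> powr (2 * H)" for r
    using h(2) by (cases "r \<ge> s") (auto simp: max_def)
  have val: "alpha_H H * (F t - F 0) = R_H H t s"
  proof -
    have "F t - F 0 = (t powr (2 * H) + s powr (2 * H) - \<bar>t - s\<bar> powr (2 * H)) / (h * (2 * H))"
      unfolding F_def mx diff_divide_distrib[symmetric] using ts by simp
    moreover have "alpha_H H = H * h" by (simp add: alpha_H_def h_def)
    ultimately show ?thesis using h(1) H by (simp add: R_H_def)
  qed
  have bs: "bounded_support (\<lambda>r::real. complex_of_real (indicator {0..t} r))" for t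
    by (intro bounded_support_indicator) auto
  have "riesz_form (2 - 2 * H) (\<lambda>r. complex_of_real (indicator {0..t} r)) (\<lambda>r. complex_of_real (indicator {0..s} r))
    = (LINT r|lborel. LINT v|lborel. complex_of_real (indicator {0..t} r) * cnj (complex_of_real (indicator {0..s} v)) * complex_of_real (norm (r - v) powr - (2 - 2 * H)))"
    using H by (intro riesz_form_iterated bs) auto
  also have "\<dots> = (LINT r|lborel. LINT v|lborel. complex_of_real (indicator {0..t} r * (indicator {0..s} v * \<bar>r - v\<bar> powr (h - 1))))"
    unfolding h(3) by (simp add: mult.assoc)
  also have "\<dots> = complex_of_real (F t - F 0)"
    by (simp only: integral_complex_of_real integral_mult_right_zero inner outer)
  finally show ?thesis
    using val by (simp only: of_real_mult[symmetric])
qed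

section \<open>The time energy of the wave kernel\<close>

lemma sine_integral_bound:
  fixes p q t l :: real
  assumes "l > 0" "p \<le> q"
  shows "\<bar>integral {p..q} (\<lambda>v. sin ((t - v) * l))\<bar> \<le> 2 / l"
proof -
  have "((\<lambda>v. sin ((t - v) * l)) has_integral (cos ((t - q) * l) / l - cos ((t - p) * l) / l)) {p..q}"
    using assms by (intro fundamental_theorem_of_calculus)
      (auto intro!: derivative_eq_intros simp: has_real_derivative_iff_has_vector_derivative[symmetric])
  then have "\<bar>integral {p..q} (\<lambda>v. sin ((t - v) * l))\<bar> = \<bar>cos ((t - q) * l) - cos ((t - p) * l)\<bar> / l"
    using assms by (simp add: integral_unique diff_divide_distrib[symmetric])
  also have "\<dots> \<le> 2 / l"
    using assms abs_cos_le_one[of "(t - q) * l"] abs_cos_le_one[of "(t - p) * l"]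
    by (intro divide_right_mono) linarith+
  finally show ?thesis .
qed

text \<open>
  The second mean value theorem takes the monotone weight out of the integral at the two end points,
  leaving integrals of the sine alone.
\<close>

lemma oscillatory_integral_bound:
  fixes w :: "real \<Rightarrow> real"
  assumes l: "l > 0" and pq: "p \<le> q" and w: "\<And>v. v \<in> {p..q} \<Longrightarrow> \<bar>w v\<bar> \<le> B" and cont: "continuous_on {p..q} w"
    and mono: "(\<forall>x y. p \<le> x \<longrightarrow> x \<le> y \<longrightarrow> y \<le> q \<longrightarrow> w x \<le> w y) \<or> (\<forall>x y. p \<le> x \<longrightarrow> x \<le> y \<longrightarrow> y \<le> q \<longrightarrow> w y \<le> w x)"
  shows "\<bar>LINT v|lborel. indicator {p..q} v * (sin ((t - v) * l) * w v)\<bar> \<le> 4 * B / l"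
proof -
  have main: "\<bar>integral {p..q} (\<lambda>v. w v * sin ((t - v) * l))\<bar> \<le> 4 * B / l"
    if w: "\<And>v. v \<in> {p..q} \<Longrightarrow> \<bar>w v\<bar> \<le> B" and mono: "\<And>x y. p \<le> x \<Longrightarrow> x \<le> y \<Longrightarrow> y \<le> q \<Longrightarrow> w x \<le> w y" for w
  proof -
    have "(\<lambda>v. sin ((t - v) * l)) integrable_on {p..q}"
      by (intro integrable_continuous_interval continuous_intros)
    from second_mean_value_theorem[where g=w, OF this pq mono] obtain c where c: "c \<in> {p..q}"
      "integral {p..q} (\<lambda>x. w x * sin ((t - x) * l)) = w p * integral {p..c} (\<lambda>v. sin ((t - v) * l)) + w q * integral {c..q} (\<lambda>v. sin ((t - v) * l))"
      by blast
    have "\<bar>w p * integral {p..c} (\<lambda>v. sin ((t - v) * l))\<bar> \<le> B * (2 / l)"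
      unfolding abs_mult using c l pq w[of p] by (intro mult_mono sine_integral_bound) auto
    moreover have "\<bar>w q * integral {c..q} (\<lambda>v. sin ((t - v) * l))\<bar> \<le> B * (2 / l)"
      unfolding abs_mult using c l pq w[of q] by (intro mult_mono sine_integral_bound) auto
    moreover have "4 * B / l = B * (2 / l) + B * (2 / l)" by simp
    ultimately show ?thesis unfolding c(2) by linarith
  qed
  have "\<bar>integral {p..q} (\<lambda>v. w v * sin ((t - v) * l))\<bar> \<le> 4 * B / l"
    using mono
  proof
    assume "\<forall>x y. p \<le> x \<longrightarrow> x \<le> y \<longrightarrow> y \<le> q \<longrightarrow> w x \<le> w y"
    then show ?thesis using w by (intro main) auto
  next
    assume "\<forall>x y. p \<le> x \<longrightarrow> x \<le> y \<longrightarrow> y \<le> q \<longrightarrow> w y \<le> w x"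
    then have "\<bar>integral {p..q} (\<lambda>v. (- w v) * sin ((t - v) * l))\<bar> \<le> 4 * B / l"
      using w by (intro main) auto
    then show ?thesis by simp
  qed
  moreover have "set_integrable lborel {p..q} (\<lambda>v. sin ((t - v) * l) * w v)"
    by (intro borel_integrable_atLeastAtMost' continuous_intros cont)
  from set_borel_integral_eq_integral(2)[OF this]
  have "(LINT v|lborel. indicator {p..q} v * (sin ((t - v) * l) * w v)) = integral {p..q} (\<lambda>v. w v * sin ((t - v) * l))"
    by (simp add: set_lebesgue_integral_def mult.commute)
  ultimately show ?thesis by simp
qed

text \<open>
  The interval is cut at distance \<open>1/l\<close> from the singularity \<open>r\<close>. Within that distance the kernel
  itself integrates to a multiple of \<open>l\<^bsup>-h\<^esup>\<close>. On either side beyond it the kernel is monotone and at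
  most \<open>l\<^bsup>1-h\<^esup>\<close>, so that the oscillation of the sine gains a further factor \<open>1/l\<close>.
\<close>

lemma oscillatory_riesz_potential_bound:
  fixes h l r t :: real
  assumes h: "0 < h" "h < 1" and l: "l > 0"
  shows "\<bar>LINT v|lborel. indicator {0..t} v * (sin ((t - v) * l) * \<bar>r - v\<bar> powr (h - 1))\<bar> \<le> (2 / h + 8) * l powr (- h)"
proof -
  define e where "e = 1 / l"
  have e: "e > 0" using l by (simp add: e_def)
  define G where "G A v = indicator A v * (sin ((t - v) * l) * \<bar>r - v\<bar> powr (h - 1))" for A v
  have eh: "4 * e powr (h - 1) / l = 4 * e powr h" "e powr h = l powr (- h)"
    using e l by (simp_all add: powr_diff e_def powr_minus_divide powr_divide)
  have cont: "continuous_on A (\<lambda>v. \<bar>r - v\<bar> powr (h - 1))" if "r \<notin> A" for A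
    using that by (intro continuous_on_powr' continuous_intros) auto
  have far_int: "integrable lborel (G {p..q})" if "r \<notin> {p..q}" for p q
  proof -
    have "set_integrable lborel {p..q} (\<lambda>v. sin ((t - v) * l) * \<bar>r - v\<bar> powr (h - 1))"
      by (intro borel_integrable_atLeastAtMost' continuous_on_mult cont[OF that] continuous_intros)
    then show ?thesis by (simp add: G_def[abs_def] set_integrable_def)
  qed
  have far: "\<bar>LINT v|lborel. G {p..q} v\<bar> \<le> 4 * e powr h"
    if "q \<le> r - e \<or> r + e \<le> p" for p q
  proof (cases "p \<le> q")
    case True
    have bd: "\<bar>\<bar>r - v\<bar> powr (h - 1)\<bar> \<le> e powr (h - 1)" if "v \<in> {p..q}" for v
      using that \<open>q \<le> r - e \<or> r + e \<le> p\<close> e h by (auto intro!: powr_mono2')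
    have "r \<notin> {p..q}" using that e by auto
    moreover have "(\<forall>x y. p \<le> x \<longrightarrow> x \<le> y \<longrightarrow> y \<le> q \<longrightarrow> \<bar>r - x\<bar> powr (h - 1) \<le> \<bar>r - y\<bar> powr (h - 1)) \<or> (\<forall>x y. p \<le> x \<longrightarrow> x \<le> y \<longrightarrow> y \<le> q \<longrightarrow> \<bar>r - y\<bar> powr (h - 1) \<le> \<bar>r - x\<bar> powr (h - 1))"
      using that e h by (auto intro!: powr_mono2')
    ultimately show ?thesis
      unfolding G_def eh(1)[symmetric] using True l by (intro oscillatory_integral_bound cont bd) auto
  qed (use e in \<open>simp add: G_def\<close>)
  define A where "A = {0..t} \<inter> {r - e<..<r + e}"
  have [measurable]: "A \<in> sets borel" by (simp add: A_def)
  have dom: "norm (G A v) \<le> indicator {r - e..r + e} v * \<bar>r - v\<bar> powr (h - 1)" for v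
  proof (cases "v \<in> A")
    case True
    have "\<bar>sin ((t - v) * l)\<bar> * \<bar>r - v\<bar> powr (h - 1) \<le> 1 * \<bar>r - v\<bar> powr (h - 1)"
      by (intro mult_right_mono) auto
    then show ?thesis using True by (auto simp: G_def A_def abs_mult)
  qed (auto simp: G_def)
  have dom_int: "integrable lborel (\<lambda>v. indicator {r - e..r + e} v * \<bar>r - v\<bar> powr (h - 1))"
    using e h by (intro lborel_integral_abs_powr(1)) auto
  have GA_meas: "G A \<in> borel_measurable lborel" unfolding G_def[abs_def] by measurable
  have near_int: "integrable lborel (G A)"
    by (rule Bochner_Integration.integrable_bound[OF dom_int GA_meas]) (use dom in \<open>auto intro: order_trans[OF _ abs_ge_self]\<close>)
  have "\<bar>LINT v|lborel. G A v\<bar> \<le> (LINT v|lborel. indicator {r - e..r + e} v * \<bar>r - v\<bar> powr (h - 1))"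
    using order_trans[OF integral_norm_bound[of lborel "G A"] integral_mono[OF integrable_norm[OF near_int] dom_int dom]] by simp
  also have "\<dots> = 2 / h * e powr h"
    using e h by (subst lborel_integral_abs_powr(2)) auto
  finally have near: "\<bar>LINT v|lborel. G A v\<bar> \<le> 2 / h * e powr h" .
  \<comment> \<open>If the singularity is close to an end point of \<open>[0, t]\<close> or outside, an outer interval may
    be empty.\<close>
  define t1 where "t1 = min t (r - e)"
  define t2 where "t2 = max 0 (r + e)"
  have split: "G {0..t} v = G {0..t1} v + G A v + G {t2..t} v" for v
    using e by (auto simp: G_def A_def t1_def t2_def indicator_def)
  have i1: "integrable lborel (G {0..t1})" and i2: "integrable lborel (G {t2..t})"
    using e by (auto intro!: far_int simp: t1_def t2_def)
  have "(LINT v|lborel. G {0..t} v) = (LINT v|lborel. G {0..t1} v) + (LINT v|lborel. G A v) + (LINT v|lborel. G {t2..t} v)"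
    unfolding split using i1 i2 near_int by simp
  moreover have "\<bar>LINT v|lborel. G {0..t1} v\<bar> \<le> 4 * e powr h" by (rule far) (simp add: t1_def)
  moreover have "\<bar>LINT v|lborel. G {t2..t} v\<bar> \<le> 4 * e powr h" by (rule far) (simp add: t2_def)
  moreover have "(2 / h + 8) * e powr h = 2 / h * e powr h + 4 * e powr h + 4 * e powr h" by (simp add: algebra_simps)
  ultimately have "\<bar>LINT v|lborel. G {0..t} v\<bar> \<le> (2 / h + 8) * e powr h" using near by linarith
  then show ?thesis by (simp add: G_def eh(2))
qed

text \<open>
  The spatial Fourier transform of \<open>G\<^sub>1(t - r)\<close> for \<open>0 \<le> r \<le> t\<close>, at a frequency of norm \<open>l\<close>. The
  transform of the wave kernel at \<open>x\<close> is this function times a phase independent of \<open>r\<close>.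
\<close>

definition wave_factor :: "real \<Rightarrow> real \<Rightarrow> real \<Rightarrow> complex" where
  "wave_factor t l r = complex_of_real (indicator {0..t} r * (sin ((t - r) * l) / l))"

lemma wave_factor_bound: "l \<ge> 0 \<Longrightarrow> norm (wave_factor t l r) \<le> t * indicator {0..t} r"
proof (cases "r \<in> {0..t} \<and> l \<noteq> 0")
  case True
  assume "l \<ge> 0"
  have "\<bar>sin ((t - r) * l)\<bar> \<le> (t - r) * l"
    using abs_sin_x_le_abs_x[of "(t - r) * l"] True \<open>l \<ge> 0\<close> by (simp add: abs_mult)
  also have "\<dots> \<le> t * l" using True \<open>l \<ge> 0\<close> by (intro mult_right_mono) auto
  finally show ?thesis using True \<open>l \<ge> 0\<close> by (simp add: wave_factor_def norm_mult norm_divide divide_simps)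
qed (auto simp: wave_factor_def indicator_def)

lemma bounded_support_wave_factor: assumes "l \<ge> 0" shows "bounded_support (wave_factor t l)"
proof -
  have "norm (wave_factor t l r) \<le> \<bar>t\<bar> * indicator (cball 0 \<bar>t\<bar>) r" for r
    using wave_factor_bound[OF assms, of t r] by (cases "r \<in> {0..t}") (auto simp: wave_factor_def)
  moreover have "wave_factor t l \<in> borel_measurable borel" unfolding wave_factor_def[abs_def] by measurable
  ultimately show ?thesis unfolding bounded_support_def by blast
qed

text \<open>
  The decay \<open>l\<^bsup>-2H-1\<^esup>\<close> splits into \<open>l\<^bsup>-2\<^esup>\<close> from the two denominators and \<open>l\<^bsup>-(2H-1)\<^esup>\<close> from the
  oscillation in one of the two time variables; in the other variable the sine is bounded by \<open>1\<close>.
\<close>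

lemma wave_energy_bound_high:
  assumes H: "1 / 2 < H" "H < 1" and l: "l > 0" and t: "t \<ge> 0"
  shows "riesz_energy (2 - 2 * H) (wave_factor t l) \<le> t * (2 / (2 * H - 1) + 8) * l powr (- (2 * H + 1))"
proof -
  define h where "h = 2 * H - 1"
  have h: "0 < h" "h < 1" "- (2 - 2 * H) = h - 1" using H by (auto simp: h_def)
  let ?K = "2 / h + 8"
  define P where "P r = (LINT v|lborel. indicator {0..t} v * (sin ((t - v) * l) * \<bar>r - v\<bar> powr (h - 1)))" for r
  have P: "\<bar>P r\<bar> \<le> ?K * l powr (- h)" for r
    unfolding P_def by (rule oscillatory_riesz_potential_bound[OF h(1,2) l])
  have [measurable]: "P \<in> borel_measurable borel" unfolding P_def[abs_def] by measurable
  have bs: "bounded_support (wave_factor t l)" using l by (intro bounded_support_wave_factor) simp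
  have "riesz_form (2 - 2 * H) (wave_factor t l) (wave_factor t l)
     = (LINT r|lborel. LINT v|lborel. wave_factor t l r * cnj (wave_factor t l v) * complex_of_real (norm (r - v) powr - (2 - 2 * H)))"
    using H by (intro riesz_form_iterated bs) auto
  also have "\<dots> = (LINT r|lborel. LINT v|lborel. complex_of_real (indicator {0..t} r * (sin ((t - r) * l) / l) / l * (indicator {0..t} v * (sin ((t - v) * l) * \<bar>r - v\<bar> powr (h - 1)))))"
    unfolding wave_factor_def h(3) by (simp add: mult_ac)
  also have "\<dots> = complex_of_real (LINT r|lborel. indicator {0..t} r * (sin ((t - r) * l) / l) / l * P r)"
    by (simp only: integral_complex_of_real integral_mult_right_zero P_def)
  finally have "riesz_energy (2 - 2 * H) (wave_factor t l) = (LINT r|lborel. indicator {0..t} r * (sin ((t - r) * l) / l) / l * P r)"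
    by simp
  also have "\<dots> \<le> (LINT r|lborel. indicator {0..t} r * (1 / l / l * (?K * l powr (- h))))"
  proof (rule integral_mono_AE')
    show "integrable lborel (\<lambda>r::real. indicator {0..t} r * (1 / l / l * (?K * l powr (- h))))"
      using t by (intro integrable_mult_left integrable_real_indicator) auto
    show "AE r in lborel. indicator {0..t} r * (sin ((t - r) * l) / l) / l * P r \<le> indicator {0..t} r * (1 / l / l * (?K * l powr (- h)))"
    proof (rule AE_I2)
      fix r
      have "\<bar>sin ((t - r) * l) / l / l\<bar> * \<bar>P r\<bar> \<le> 1 / l / l * (?K * l powr (- h))"
        using l P[of r] by (intro mult_mono) (auto simp: abs_mult divide_simps)
      then have "sin ((t - r) * l) / l / l * P r \<le> 1 / l / l * (?K * l powr (- h))"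
        unfolding abs_mult[symmetric] by linarith
      then show "indicator {0..t} r * (sin ((t - r) * l) / l) / l * P r \<le> indicator {0..t} r * (1 / l / l * (?K * l powr (- h)))"
        by (auto simp: indicator_def)
    qed
    show "AE r in lborel. 0 \<le> indicator {0..t} r * (1 / l / l * (?K * l powr (- h)))"
      using l h by auto
  qed
  also have "\<dots> = t * (1 / l / l * (?K * l powr (- h)))" using t by simp
  also have "1 / l / l * (?K * l powr (- h)) = ?K * l powr (- (2 * H + 1))"
  proof -
    have "l powr (- (2 * H + 1)) = l powr (- h) * l powr (- 2)"
      unfolding powr_add[symmetric] by (rule arg_cong[where f="\<lambda>e. l powr e"]) (simp add: h_def)
    also have "l powr (- 2) = 1 / l / l" using l by (simp add: powr_minus power2_eq_square divide_simps)
    finally show ?thesis by simp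
  qed
  finally show ?thesis by (simp add: h_def mult.assoc)
qed

text \<open>
  Since \<open>|sin(sl)| \<le> sl\<close>, the wave factor is bounded by \<open>t\<close> at every frequency.
\<close>

lemma wave_energy_bound_low:
  assumes H: "1 / 2 < H" "H < 1" and l: "l \<ge> 0" and t: "t \<ge> 0"
  shows "riesz_energy (2 - 2 * H) (wave_factor t l) \<le> t\<^sup>2 * riesz_energy (2 - 2 * H) (\<lambda>r. complex_of_real (indicator {0..t} r))"
proof -
  let ?k = "\<lambda>z::real \<times> real. complex_of_real (norm (fst z - snd z) powr - (2 - 2 * H))"
  let ?F = "\<lambda>z. wave_factor t l (fst z) * cnj (wave_factor t l (snd z)) * ?k z"
  let ?G = "\<lambda>z. complex_of_real (indicator {0..t} (fst z)) * cnj (complex_of_real (indicator {0..t} (snd z))) * ?k z"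
  have a: "0 < 2 - 2 * H" "2 - 2 * H < real DIM(real)" using H by auto
  note bs = bounded_support_wave_factor[OF l, of t]
  have bs': "bounded_support (\<lambda>r::real. complex_of_real (indicator {0..t} r))"
    by (intro bounded_support_indicator) auto
  note i1 = riesz_kernel_integrable[OF a bs bs] and i2 = riesz_kernel_integrable[OF a bs' bs']
  have "riesz_energy (2 - 2 * H) (wave_factor t l) \<le> norm (LINT z|lborel. ?F z)"
    unfolding riesz_form_def by (rule complex_Re_le_cmod)
  also have "\<dots> \<le> (LINT z|lborel. norm (?F z))" by (rule integral_norm_bound)
  also have "\<dots> \<le> (LINT z|lborel. t\<^sup>2 * Re (?G z))"
  proof (rule integral_mono)
    show "integrable lborel (\<lambda>z. norm (?F z))" by (rule integrable_norm[OF i1])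
    show "integrable lborel (\<lambda>z. t\<^sup>2 * Re (?G z))" by (intro integrable_mult_right integrable_Re i2)
    fix z :: "real \<times> real"
    have "norm (wave_factor t l (fst z)) * norm (wave_factor t l (snd z)) \<le> (t * indicator {0..t} (fst z)) * (t * indicator {0..t} (snd z))"
      using t l by (intro mult_mono wave_factor_bound) auto
    from mult_right_mono[OF this, of "norm (fst z - snd z) powr - (2 - 2 * H)"]
    show "norm (?F z) \<le> t\<^sup>2 * Re (?G z)"
      by (simp add: norm_mult power2_eq_square mult_ac)
  qed
  also have "\<dots> = t\<^sup>2 * (LINT z|lborel. Re (?G z))" by simp
  also have "(LINT z|lborel. Re (?G z)) = riesz_energy (2 - 2 * H) (\<lambda>r. complex_of_real (indicator {0..t} r))"
    unfolding riesz_form_def by (rule integral_Re[OF i2])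
  finally show ?thesis .
qed

lemma wave_energy_bound:
  assumes H: "1 / 2 < H" "H < 1" and t: "t \<ge> 0"
  obtains C where "C \<ge> 0" "\<And>l. l > 0 \<Longrightarrow> riesz_energy (2 - 2 * H) (wave_factor t l) \<le> C * min 1 (l powr (- (2 * H + 1)))"
proof -
  define C1 where "C1 = t * (2 / (2 * H - 1) + 8)"
  define C2 where "C2 = t\<^sup>2 * riesz_energy (2 - 2 * H) (\<lambda>r. complex_of_real (indicator {0..t} r))"
  have C1: "C1 \<ge> 0" using H t by (simp add: C1_def)
  show ?thesis
  proof (rule that[of "max C1 C2"])
    show "0 \<le> max C1 C2" using C1 by simp
    fix l :: real assume l: "l > 0"
    have "riesz_energy (2 - 2 * H) (wave_factor t l) \<le> C1 * l powr (- (2 * H + 1))"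
      unfolding C1_def by (rule wave_energy_bound_high[OF H l t])
    also have "\<dots> \<le> max C1 C2 * l powr (- (2 * H + 1))" by (intro mult_right_mono) auto
    finally have 1: "riesz_energy (2 - 2 * H) (wave_factor t l) \<le> max C1 C2 * l powr (- (2 * H + 1))" .
    have "riesz_energy (2 - 2 * H) (wave_factor t l) \<le> C2"
      unfolding C2_def using l by (intro wave_energy_bound_low[OF H _ t]) simp
    then have 2: "riesz_energy (2 - 2 * H) (wave_factor t l) \<le> max C1 C2 * 1" by simp
    show "riesz_energy (2 - 2 * H) (wave_factor t l) \<le> max C1 C2 * min 1 (l powr (- (2 * H + 1)))"
      using 1 2 by (simp add: min_def)
  qed
qed

section \<open>The Hilbert space norm\<close>

text \<open>
  \<open>HP_norm\<close> is built from Bochner integrals, which return \<open>0\<close> on integrands that are not integrable.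
  For admissible \<open>\<Phi>\<close> all these integrals converge, so that convergence to \<open>0\<close> of \<open>HP_norm\<close> carries
  its intended meaning. The last condition is imposed on the energy at fixed frequency and not on
  the absolute value of the triple integrand: for the wave kernel the latter need not be
  integrable when \<open>\<beta> \<ge> 2\<close>.
\<close>

definition HP_admissible :: "real \<Rightarrow> real \<Rightarrow> (real \<Rightarrow> 'a::euclidean_space \<Rightarrow> complex) \<Rightarrow> bool" where
  "HP_admissible H \<beta> \<Phi> \<longleftrightarrow> (\<lambda>(r, \<xi>). \<Phi> r \<xi>) \<in> borel_measurable (borel \<Otimes>\<^sub>M borel) \<and>
     (\<forall>\<xi>. bounded_support (\<lambda>r. \<Phi> r \<xi>)) \<and> (\<forall>r<0. \<forall>\<xi>. \<Phi> r \<xi> = 0) \<and>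
     integrable (riesz_measure \<beta>) (\<lambda>\<xi>. riesz_energy (2 - 2 * H) (\<lambda>r. \<Phi> r \<xi>))"

lemma HP_admissibleD:
  assumes "HP_admissible H \<beta> \<Phi>"
  shows "(\<lambda>(r, \<xi>). \<Phi> r \<xi>) \<in> borel_measurable (borel \<Otimes>\<^sub>M borel)"
    and "bounded_support (\<lambda>r. \<Phi> r \<xi>)" and "r < 0 \<Longrightarrow> \<Phi> r \<xi> = 0"
    and "integrable (riesz_measure \<beta>) (\<lambda>\<xi>. riesz_energy (2 - 2 * H) (\<lambda>r. \<Phi> r \<xi>))"
  using assms by (auto simp: HP_admissible_def)

definition HP_energy :: "real \<Rightarrow> real \<Rightarrow> (real \<Rightarrow> 'a::euclidean_space \<Rightarrow> complex) \<Rightarrow> real" where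
  "HP_energy H \<beta> \<Phi> = alpha_H H * (LINT \<xi>|riesz_measure \<beta>. riesz_energy (2 - 2 * H) (\<lambda>r. \<Phi> r \<xi>))"

lemma sets_riesz_measure [measurable_cong, simp]: "sets (riesz_measure \<beta>) = sets borel"
  by (simp add: riesz_measure_def)

context
  fixes H :: real
  assumes H: "1 / 2 < H" "H < 1"
begin

private lemma a: "0 < 2 - 2 * H" "2 - 2 * H < real DIM(real)"
  using H by auto

lemma alpha_H_pos: "alpha_H H > 0"
  using H by (simp add: alpha_H_def)

lemma HP_norm_square:
  assumes "HP_admissible H \<beta> \<Phi>"
  shows "(HP_norm H \<beta> \<Phi>)\<^sup>2 = HP_energy H \<beta> \<Phi>"
proof -
  have inner: "(LINT r:{0..}|lborel. (LINT v:{0..}|lborel.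
      \<Phi> r \<xi> * cnj (\<Phi> v \<xi>) * complex_of_real (\<bar>r - v\<bar> powr (2 * H - 2)))) = complex_of_real (riesz_energy (2 - 2 * H) (\<lambda>r. \<Phi> r \<xi>))" for \<xi>
  proof -
    note bs = HP_admissibleD(2)[OF assms, of \<xi>]
    have z: "indicator {0..} r *\<^sub>R \<Phi> r \<xi> = \<Phi> r \<xi>" for r
      using HP_admissibleD(3)[OF assms, of r \<xi>] by (simp add: indicator_def)
    have "(LINT r:{0..}|lborel. (LINT v:{0..}|lborel. \<Phi> r \<xi> * cnj (\<Phi> v \<xi>) * complex_of_real (\<bar>r - v\<bar> powr (2 * H - 2))))
      = (LINT r|lborel. LINT v|lborel. (indicator {0..} r *\<^sub>R \<Phi> r \<xi>) * cnj (indicator {0..} v *\<^sub>R \<Phi> v \<xi>) * complex_of_real (\<bar>r - v\<bar> powr (2 * H - 2)))"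
      unfolding set_lebesgue_integral_def
      by (intro Bochner_Integration.integral_cong refl, subst integral_scaleR_right[symmetric])
         (simp add: scaleR_conv_of_real mult_ac)
    also have "\<dots> = riesz_form (2 - 2 * H) (\<lambda>r. \<Phi> r \<xi>) (\<lambda>r. \<Phi> r \<xi>)"
      unfolding z by (subst riesz_form_iterated[OF a bs bs]) simp
    also have "\<dots> = complex_of_real (riesz_energy (2 - 2 * H) (\<lambda>r. \<Phi> r \<xi>))"
      by (rule riesz_energy_nonneg(1)[OF a bs])
    finally show ?thesis .
  qed
  have "HP_inner H \<beta> \<Phi> \<Phi> = complex_of_real (HP_energy H \<beta> \<Phi>)"
    unfolding HP_inner_def inner HP_energy_def by (simp only: integral_complex_of_real of_real_mult)
  moreover have "HP_energy H \<beta> \<Phi> \<ge> 0"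
    unfolding HP_energy_def using alpha_H_pos riesz_energy_nonneg(2)[OF a HP_admissibleD(2)[OF assms]]
    by (intro mult_nonneg_nonneg integral_nonneg_AE) auto
  ultimately show ?thesis by (simp add: HP_norm_def)
qed

lemma measurable_riesz_energy:
  fixes \<Phi> :: "real \<Rightarrow> 'a::euclidean_space \<Rightarrow> complex"
  assumes [measurable]: "(\<lambda>(r, \<xi>). \<Phi> r \<xi>) \<in> borel_measurable (borel \<Otimes>\<^sub>M borel)"
    and bs: "\<And>\<xi>. bounded_support (\<lambda>r. \<Phi> r \<xi>)"
  shows "(\<lambda>\<xi>. riesz_energy (2 - 2 * H) (\<lambda>r. \<Phi> r \<xi>)) \<in> borel_measurable borel"
  unfolding riesz_form_iterated[OF a bs bs] by measurable

text \<open>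
  The inequality \<open>riesz_energy_diff_le\<close> at each frequency provides both the domination needed for
  admissibility of the difference and the inequality between the integrated energies.
\<close>

lemma HP_admissible_diff:
  assumes \<Phi>: "HP_admissible H \<beta> \<Phi>" and \<Psi>: "HP_admissible H \<beta> \<Psi>"
  shows "HP_admissible H \<beta> (\<lambda>r \<xi>. \<Phi> r \<xi> - \<Psi> r \<xi>)"
    and "HP_energy H \<beta> (\<lambda>r \<xi>. \<Phi> r \<xi> - \<Psi> r \<xi>) \<le> 2 * HP_energy H \<beta> \<Phi> + 2 * HP_energy H \<beta> \<Psi>"
proof -
  note [measurable] = HP_admissibleD(1)[OF \<Phi>] HP_admissibleD(1)[OF \<Psi>]
  have meas: "(\<lambda>(r, \<xi>). \<Phi> r \<xi> - \<Psi> r \<xi>) \<in> borel_measurable (borel \<Otimes>\<^sub>M borel)"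
    by measurable
  have bs: "bounded_support (\<lambda>r. \<Phi> r \<xi> - \<Psi> r \<xi>)" for \<xi>
    by (intro bounded_support_diff HP_admissibleD(2)[OF \<Phi>] HP_admissibleD(2)[OF \<Psi>])
  let ?E = "\<lambda>\<xi>. riesz_energy (2 - 2 * H) (\<lambda>r. \<Phi> r \<xi> - \<Psi> r \<xi>)"
  let ?B = "\<lambda>\<xi>. 2 * riesz_energy (2 - 2 * H) (\<lambda>r. \<Phi> r \<xi>) + 2 * riesz_energy (2 - 2 * H) (\<lambda>r. \<Psi> r \<xi>)"
  have le: "?E \<xi> \<le> ?B \<xi>" for \<xi>
    by (rule riesz_energy_diff_le[OF a HP_admissibleD(2)[OF \<Phi>] HP_admissibleD(2)[OF \<Psi>]])
  have nn: "0 \<le> ?E \<xi>" for \<xi> by (rule riesz_energy_nonneg(2)[OF a bs])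
  have intB: "integrable (riesz_measure \<beta>) ?B"
    by (intro Bochner_Integration.integrable_add integrable_mult_right HP_admissibleD(4) \<Phi> \<Psi>)
  have intE: "integrable (riesz_measure \<beta>) ?E"
  proof (rule Bochner_Integration.integrable_bound[OF intB])
    show "?E \<in> borel_measurable (riesz_measure \<beta>)"
      using measurable_riesz_energy[OF meas bs] by (simp cong: measurable_cong_sets)
    show "AE \<xi> in riesz_measure \<beta>. norm (?E \<xi>) \<le> norm (?B \<xi>)"
    proof (rule AE_I2)
      fix \<xi> show "norm (?E \<xi>) \<le> norm (?B \<xi>)" using nn[of \<xi>] le[of \<xi>] by simp
    qed
  qed
  show "HP_admissible H \<beta> (\<lambda>r \<xi>. \<Phi> r \<xi> - \<Psi> r \<xi>)"
    unfolding HP_admissible_def using meas bs intE HP_admissibleD(3)[OF \<Phi>] HP_admissibleD(3)[OF \<Psi>] by auto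
  have "(LINT \<xi>|riesz_measure \<beta>. ?E \<xi>) \<le> (LINT \<xi>|riesz_measure \<beta>. ?B \<xi>)"
    by (rule integral_mono[OF intE intB le])
  also have "\<dots> = 2 * (LINT \<xi>|riesz_measure \<beta>. riesz_energy (2 - 2 * H) (\<lambda>r. \<Phi> r \<xi>)) + 2 * (LINT \<xi>|riesz_measure \<beta>. riesz_energy (2 - 2 * H) (\<lambda>r. \<Psi> r \<xi>))"
    using HP_admissibleD(4)[OF \<Phi>] HP_admissibleD(4)[OF \<Psi>] by simp
  finally have "alpha_H H * (LINT \<xi>|riesz_measure \<beta>. ?E \<xi>) \<le> alpha_H H * \<dots>"
    using alpha_H_pos by (intro mult_left_mono) auto
  then show "HP_energy H \<beta> (\<lambda>r \<xi>. \<Phi> r \<xi> - \<Psi> r \<xi>) \<le> 2 * HP_energy H \<beta> \<Phi> + 2 * HP_energy H \<beta> \<Psi>"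
    by (simp add: HP_energy_def algebra_simps)
qed

section \<open>Wave kernels in the Hilbert space\<close>

text \<open>
  Near the origin the integrand is at most the density \<open>|\<xi>|\<^bsup>\<beta>-d\<^esup>\<close>, which is integrable as
  \<open>\<beta> > 0\<close>; at infinity the total exponent is \<open>-b\<close> with \<open>b = d + q - \<kappa> - \<beta> > d\<close>.
\<close>

lemma riesz_spectral_tail_finite:
  fixes \<beta> q \<kappa> :: real
  assumes \<beta>: "0 < \<beta>" "\<beta> < real DIM('a::euclidean_space)" and \<kappa>: "0 \<le> \<kappa>" "\<kappa> + \<beta> < q"
  shows "integrable (riesz_measure \<beta>) (\<lambda>\<xi>::'a. norm \<xi> powr \<kappa> * min 1 (norm \<xi> powr (- q)))"
proof (rule integrableI_nonneg)
  let ?d = "real DIM('a)"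
  define b where "b = ?d + q - \<kappa> - \<beta>"
  have b: "b > ?d" using \<kappa> by (simp add: b_def)
  have "(\<integral>\<^sup>+ \<xi>. ennreal (norm (\<xi>::'a) powr \<kappa> * min 1 (norm \<xi> powr (- q))) \<partial>riesz_measure \<beta>)
    = (\<integral>\<^sup>+ \<xi>. ennreal (norm (\<xi>::'a) powr (\<beta> - ?d)) * ennreal (norm \<xi> powr \<kappa> * min 1 (norm \<xi> powr (- q))) \<partial>lborel)"
    unfolding riesz_measure_def by (subst nn_integral_density) auto
  also have "\<dots> \<le> (\<integral>\<^sup>+ \<xi>. ennreal (indicator (cball 0 1) \<xi> * norm (\<xi>::'a) powr (- (?d - \<beta>))) + ennreal (2 powr (b / 2)) * ennreal ((1 + (norm \<xi>)\<^sup>2) powr (- (b / 2))) \<partial>lborel)"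
  proof (rule nn_integral_mono)
    fix \<xi> :: 'a
    have "norm \<xi> powr (\<beta> - ?d) * (norm \<xi> powr \<kappa> * min 1 (norm \<xi> powr (- q)))
      \<le> indicator (cball 0 1) \<xi> * norm \<xi> powr (- (?d - \<beta>)) + 2 powr (b / 2) * (1 + (norm \<xi>)\<^sup>2) powr (- (b / 2))"
    proof (cases "norm \<xi> \<le> 1")
      case True
      have "norm \<xi> powr \<kappa> * min 1 (norm \<xi> powr (- q)) \<le> 1 * 1"
        using True \<kappa> by (intro mult_mono powr_le1) auto
      then have "norm \<xi> powr (\<beta> - ?d) * (norm \<xi> powr \<kappa> * min 1 (norm \<xi> powr (- q))) \<le> norm \<xi> powr (\<beta> - ?d) * 1"
        by (intro mult_left_mono) auto
      moreover have "0 \<le> 2 powr (b / 2) * (1 + (norm \<xi>)\<^sup>2) powr (- (b / 2))" by simp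
      ultimately show ?thesis using True by (simp add: add_increasing2)
    next
      case False
      then have n: "norm \<xi> > 1" by simp
      have "norm \<xi> powr (\<beta> - ?d) * (norm \<xi> powr \<kappa> * min 1 (norm \<xi> powr (- q))) \<le> norm \<xi> powr (\<beta> - ?d) * (norm \<xi> powr \<kappa> * norm \<xi> powr (- q))"
        by (intro mult_left_mono) auto
      also have "\<dots> = norm \<xi> powr (- b)"
        unfolding powr_add[symmetric] by (rule arg_cong[where f="\<lambda>e. norm \<xi> powr e"]) (simp add: b_def)
      also have "\<dots> = ((norm \<xi>)\<^sup>2) powr (- (b / 2))" by (simp add: square_powr_half)
      also have "\<dots> \<le> ((1 + (norm \<xi>)\<^sup>2) / 2) powr (- (b / 2))"
      proof (rule powr_mono2')
        have "1 \<le> (norm \<xi>)\<^sup>2" using n by (simp add: power_increasing_iff one_le_power)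
        then show "(1 + (norm \<xi>)\<^sup>2) / 2 \<le> (norm \<xi>)\<^sup>2" by simp
        show "0 < (1 + (norm \<xi>)\<^sup>2) / 2" by (simp add: add_pos_nonneg)
        show "- (b / 2) \<le> 0" using b by simp
      qed
      also have "\<dots> = 2 powr (b / 2) * (1 + (norm \<xi>)\<^sup>2) powr (- (b / 2))"
        by (simp add: powr_divide powr_minus_divide)
      finally show ?thesis using n by simp
    qed
    then show "ennreal (norm \<xi> powr (\<beta> - ?d)) * ennreal (norm \<xi> powr \<kappa> * min 1 (norm \<xi> powr (- q)))
       \<le> ennreal (indicator (cball 0 1) \<xi> * norm \<xi> powr (- (?d - \<beta>))) + ennreal (2 powr (b / 2)) * ennreal ((1 + (norm \<xi>)\<^sup>2) powr (- (b / 2)))"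
      by (simp add: ennreal_mult[symmetric] ennreal_plus[symmetric] ennreal_leI del: ennreal_plus)
  qed
  also have "\<dots> = (\<integral>\<^sup>+ \<xi>. ennreal (indicator (cball 0 1) \<xi> * norm (\<xi>::'a) powr (- (?d - \<beta>))) \<partial>lborel) + ennreal (2 powr (b / 2)) * (\<integral>\<^sup>+ \<xi>. ennreal ((1 + (norm (\<xi>::'a))\<^sup>2) powr (- (b / 2))) \<partial>lborel)"
  proof -
    have [measurable]: "cball (0::'a) 1 \<in> sets borel" by simp
    show ?thesis by (subst nn_integral_add) (auto simp: nn_integral_cmult)
  qed
  also have "\<dots> < \<infinity>"
    using nn_integral_norm_powr_cball_finite[of "?d - \<beta>" 1, where 'a='a] nn_integral_one_plus_norm_powr_finite[OF b] \<beta>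
    by (simp add: ennreal_mult_less_top)
  finally show "(\<integral>\<^sup>+ \<xi>. ennreal (norm (\<xi>::'a) powr \<kappa> * min 1 (norm \<xi> powr (- q))) \<partial>riesz_measure \<beta>) < \<infinity>" .
qed (auto simp: riesz_measure_def)

lemma wave_kernel_hat_eq: "wave_kernel_hat t x r \<xi> = cis (- (\<xi> \<bullet> x)) * wave_factor t (norm \<xi>) r"
  by (simp add: wave_kernel_hat_def G1_hat_def wave_factor_def indicator_def)

text \<open>
  Interpolation between the bounds \<open>|x - y|\<close> and \<open>2\<close> for the chord.
\<close>

lemma norm_cis_diff_le:
  assumes "0 \<le> \<delta>" "\<delta> \<le> 1"
  shows "norm (cis x - cis y) \<le> 2 * \<bar>x - y\<bar> powr \<delta>"
proof (cases "x = y")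
  case False
  have "cis x - cis y = cis y * (cis (x - y) - 1)" by (simp add: right_diff_distrib cis_mult)
  then have "norm (cis x - cis y) = 2 * \<bar>sin ((x - y) / 2)\<bar>"
    using dist_exp_i_1[of "x - y"] by (simp add: norm_mult cis_conv_exp)
  also have "\<dots> \<le> 2 * \<bar>x - y\<bar> powr \<delta>"
  proof (cases "\<bar>x - y\<bar> \<le> 1")
    case True
    have "\<bar>sin ((x - y) / 2)\<bar> \<le> \<bar>x - y\<bar>" using abs_sin_x_le_abs_x[of "(x - y) / 2"] by simp
    also have "\<bar>x - y\<bar> = \<bar>x - y\<bar> powr 1" using False by simp
    also have "\<dots> \<le> \<bar>x - y\<bar> powr \<delta>" using True assms False by (intro powr_mono') auto
    finally show ?thesis by simp
  next
    case False
    then have "1 \<le> \<bar>x - y\<bar> powr \<delta>" using assms by (intro ge_one_powr_ge_zero) auto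
    moreover have "\<bar>sin ((x - y) / 2)\<bar> \<le> 1" by simp
    ultimately show ?thesis by linarith
  qed
  finally show ?thesis .
qed simp

text \<open>
  The phase drops out of the energy, and the remaining bound of order \<open>|\<xi>|\<^bsup>-2H-1\<^esup>\<close> is integrable
  for the spectral measure because \<open>\<beta> < 2H + 1\<close>.
\<close>

lemma wave_kernel_hat_admissible:
  fixes \<beta> t :: real and x :: "'a::euclidean_space"
  assumes \<beta>: "0 < \<beta>" "\<beta> < real DIM('a)" "\<beta> < 2 * H + 1" and t: "t \<ge> 0"
  shows "HP_admissible H \<beta> (wave_kernel_hat t x)"
proof -
  have meas: "(\<lambda>(r, \<xi>). wave_kernel_hat t x r \<xi>) \<in> borel_measurable (borel \<Otimes>\<^sub>M borel)"
    unfolding wave_kernel_hat_eq wave_factor_def by measurable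
  have bs: "bounded_support (\<lambda>r. wave_kernel_hat t x r \<xi>)" for \<xi>
    unfolding wave_kernel_hat_eq by (intro bounded_support_cmult bounded_support_wave_factor) simp
  have E: "riesz_energy (2 - 2 * H) (\<lambda>r. wave_kernel_hat t x r \<xi>) = riesz_energy (2 - 2 * H) (wave_factor t (norm \<xi>))" for \<xi>
    unfolding wave_kernel_hat_eq riesz_form_cmult by (simp add: cis_cnj cis_mult)
  obtain C where C: "C \<ge> 0" "\<And>l. l > 0 \<Longrightarrow> riesz_energy (2 - 2 * H) (wave_factor t l) \<le> C * min 1 (l powr (- (2 * H + 1)))"
    using wave_energy_bound[OF H t] by blast
  have "integrable (riesz_measure \<beta>) (\<lambda>\<xi>. riesz_energy (2 - 2 * H) (\<lambda>r. wave_kernel_hat t x r \<xi>))"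
  proof (rule Bochner_Integration.integrable_bound)
    show "integrable (riesz_measure \<beta>) (\<lambda>\<xi>::'a. C * (norm \<xi> powr 0 * min 1 (norm \<xi> powr (- (2 * H + 1)))))"
      using \<beta> by (intro integrable_mult_right riesz_spectral_tail_finite) auto
    show "(\<lambda>\<xi>. riesz_energy (2 - 2 * H) (\<lambda>r. wave_kernel_hat t x r \<xi>)) \<in> borel_measurable (riesz_measure \<beta>)"
      using measurable_riesz_energy[OF meas bs] by (simp cong: measurable_cong_sets)
    have "AE \<xi> in lborel. \<xi> \<noteq> (0::'a)" by (rule AE_lborel_singleton)
    then have "AE \<xi> in riesz_measure \<beta>. \<xi> \<noteq> (0::'a)"
      unfolding riesz_measure_def by (subst AE_density) (auto elim: eventually_mono)
    then show "AE \<xi> in riesz_measure \<beta>. norm (riesz_energy (2 - 2 * H) (\<lambda>r. wave_kernel_hat t x r \<xi>))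
        \<le> norm (C * (norm \<xi> powr 0 * min 1 (norm \<xi> powr (- (2 * H + 1)))))"
    proof eventually_elim
      fix \<xi> :: 'a assume "\<xi> \<noteq> 0"
      then have "riesz_energy (2 - 2 * H) (\<lambda>r. wave_kernel_hat t x r \<xi>) \<le> C * min 1 (norm \<xi> powr (- (2 * H + 1)))"
        unfolding E by (intro C) simp
      then show "norm (riesz_energy (2 - 2 * H) (\<lambda>r. wave_kernel_hat t x r \<xi>))
        \<le> norm (C * (norm \<xi> powr 0 * min 1 (norm \<xi> powr (- (2 * H + 1)))))"
        using \<open>\<xi> \<noteq> 0\<close> riesz_energy_nonneg(2)[OF a bs, of \<xi>] by simp
    qed
  qed
  moreover have "wave_kernel_hat t x r \<xi> = 0" if "r < 0" for r and \<xi> :: 'a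
    using that by (simp add: wave_kernel_hat_def)
  ultimately show ?thesis
    unfolding HP_admissible_def using meas bs by blast
qed

text \<open>
  The analytic heart of the regularity statement. The two kernels share the wave factor and differ
  in their phases, so the energy at frequency \<open>\<xi>\<close> acquires the factor
  \<open>|cis(-\<xi>x) - cis(-\<xi>y)|\<^sup>2 \<le> 4 (|\<xi>| |x - y|)\<^bsup>2\<delta>\<^esup>\<close>. The growth \<open>|\<xi>|\<^bsup>2\<delta>\<^esup>\<close> is compensated by
  the decay of the wave energy as long as \<open>2\<delta> + \<beta> < 2H + 1\<close>.
\<close>

lemma wave_increment_energy:
  fixes \<beta> t \<delta> :: real
  assumes \<beta>: "0 < \<beta>" "\<beta> < real DIM('a::euclidean_space)" "\<beta> < 2 * H + 1" and t: "t \<ge> 0"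
    and \<delta>: "0 \<le> \<delta>" "\<delta> \<le> 1" "2 * \<delta> + \<beta> < 2 * H + 1"
  obtains C where "C \<ge> 0" "\<And>x y::'a. HP_energy H \<beta> (\<lambda>r \<xi>. wave_kernel_hat t x r \<xi> - wave_kernel_hat t y r \<xi>) \<le> C * dist x y powr (2 * \<delta>)"
proof -
  obtain C where C: "C \<ge> 0" "\<And>l. l > 0 \<Longrightarrow> riesz_energy (2 - 2 * H) (wave_factor t l) \<le> C * min 1 (l powr (- (2 * H + 1)))"
    using wave_energy_bound[OF H t] by blast
  define I where "I = (LINT \<xi>::'a|riesz_measure \<beta>. norm \<xi> powr (2 * \<delta>) * min 1 (norm \<xi> powr (- (2 * H + 1))))"
  have I: "I \<ge> 0" unfolding I_def by (intro integral_nonneg_AE) auto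
  have int: "integrable (riesz_measure \<beta>) (\<lambda>\<xi>::'a. norm \<xi> powr (2 * \<delta>) * min 1 (norm \<xi> powr (- (2 * H + 1))))"
    using \<beta> \<delta> by (intro riesz_spectral_tail_finite) auto
  have AE0: "AE \<xi> in riesz_measure \<beta>. \<xi> \<noteq> (0::'a)"
    unfolding riesz_measure_def using AE_lborel_singleton[of "0::'a"]
    by (subst AE_density) (auto elim: eventually_mono)
  show ?thesis
  proof (rule that[of "alpha_H H * (4 * C * I)"])
    show "0 \<le> alpha_H H * (4 * C * I)" using alpha_H_pos C I by simp
    fix x y :: 'a
    let ?D = "\<lambda>r \<xi>. wave_kernel_hat t x r \<xi> - wave_kernel_hat t y r \<xi>"
    have adm: "HP_admissible H \<beta> ?D"
      by (intro HP_admissible_diff(1) wave_kernel_hat_admissible \<beta> t)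
    have E: "riesz_energy (2 - 2 * H) (\<lambda>r. ?D r \<xi>) = (norm (cis (- (\<xi> \<bullet> x)) - cis (- (\<xi> \<bullet> y))))\<^sup>2 * riesz_energy (2 - 2 * H) (wave_factor t (norm \<xi>))" for \<xi>
      unfolding wave_kernel_hat_eq left_diff_distrib[symmetric] riesz_form_cmult complex_norm_square[symmetric] by simp
    have "(LINT \<xi>|riesz_measure \<beta>. riesz_energy (2 - 2 * H) (\<lambda>r. ?D r \<xi>))
      \<le> (LINT \<xi>::'a|riesz_measure \<beta>. (4 * C * dist x y powr (2 * \<delta>)) * (norm \<xi> powr (2 * \<delta>) * min 1 (norm \<xi> powr (- (2 * H + 1)))))"
    proof (rule integral_mono_AE)
      show "AE \<xi> in riesz_measure \<beta>. riesz_energy (2 - 2 * H) (\<lambda>r. ?D r \<xi>) \<le> (4 * C * dist x y powr (2 * \<delta>)) * (norm \<xi> powr (2 * \<delta>) * min 1 (norm \<xi> powr (- (2 * H + 1))))"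
        using AE0
      proof eventually_elim
        fix \<xi> :: 'a assume "\<xi> \<noteq> 0"
        have "norm (cis (- (\<xi> \<bullet> x)) - cis (- (\<xi> \<bullet> y))) \<le> 2 * \<bar>- (\<xi> \<bullet> x) - (- (\<xi> \<bullet> y))\<bar> powr \<delta>"
          by (rule norm_cis_diff_le[OF \<delta>(1,2)])
        also have "\<bar>- (\<xi> \<bullet> x) - (- (\<xi> \<bullet> y))\<bar> powr \<delta> \<le> (norm \<xi> * dist x y) powr \<delta>"
        proof (intro powr_mono2)
          have "- (\<xi> \<bullet> x) - (- (\<xi> \<bullet> y)) = \<xi> \<bullet> (y - x)" by (simp add: inner_diff_right)
          then show "\<bar>- (\<xi> \<bullet> x) - (- (\<xi> \<bullet> y))\<bar> \<le> norm \<xi> * dist x y"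
            using Cauchy_Schwarz_ineq2[of \<xi> "y - x"] by (simp add: dist_norm norm_minus_commute[of y x])
        qed (use \<delta> in auto)
        finally have "(norm (cis (- (\<xi> \<bullet> x)) - cis (- (\<xi> \<bullet> y))))\<^sup>2 \<le> (2 * (norm \<xi> * dist x y) powr \<delta>)\<^sup>2"
          by (intro power_mono) auto
        also have "\<dots> = 4 * (dist x y powr (2 * \<delta>) * norm \<xi> powr (2 * \<delta>))"
        proof -
          have "(u powr \<delta>)\<^sup>2 = u powr (2 * \<delta>)" for u :: real
            by (simp add: power2_eq_square powr_add[symmetric])
          then show ?thesis by (simp add: power_mult_distrib powr_mult mult_ac)
        qed
        finally have "(norm (cis (- (\<xi> \<bullet> x)) - cis (- (\<xi> \<bullet> y))))\<^sup>2 * riesz_energy (2 - 2 * H) (wave_factor t (norm \<xi>))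
          \<le> 4 * (dist x y powr (2 * \<delta>) * norm \<xi> powr (2 * \<delta>)) * (C * min 1 (norm \<xi> powr (- (2 * H + 1))))"
          using \<open>\<xi> \<noteq> 0\<close> C by (intro mult_mono riesz_energy_nonneg(2)[OF a] bounded_support_wave_factor C(2)) auto
        then show "riesz_energy (2 - 2 * H) (\<lambda>r. ?D r \<xi>) \<le> (4 * C * dist x y powr (2 * \<delta>)) * (norm \<xi> powr (2 * \<delta>) * min 1 (norm \<xi> powr (- (2 * H + 1))))"
          unfolding E by (simp add: mult_ac)
      qed
      show "integrable (riesz_measure \<beta>) (\<lambda>\<xi>. riesz_energy (2 - 2 * H) (\<lambda>r. ?D r \<xi>))"
        by (rule HP_admissibleD(4)[OF adm])
      show "integrable (riesz_measure \<beta>) (\<lambda>\<xi>::'a. (4 * C * dist x y powr (2 * \<delta>)) * (norm \<xi> powr (2 * \<delta>) * min 1 (norm \<xi> powr (- (2 * H + 1)))))"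
        by (rule integrable_mult_right[OF int])
    qed
    also have "\<dots> = 4 * C * dist x y powr (2 * \<delta>) * I" by (simp add: I_def)
    finally show "HP_energy H \<beta> ?D \<le> alpha_H H * (4 * C * I) * dist x y powr (2 * \<delta>)"
      unfolding HP_energy_def using alpha_H_pos by (simp add: mult_ac)
  qed
qed

end

section \<open>Elementary functions and their stochastic integrals\<close>

lemma integral_double_sum:
  fixes f :: "'i \<Rightarrow> 'j \<Rightarrow> 'b \<Rightarrow> 'c::{banach, second_countable_topology}"
  assumes "\<And>i j. i \<in> S \<Longrightarrow> j \<in> S' \<Longrightarrow> integrable M (f i j)"
  shows "(LINT x|M. (\<Sum>i\<in>S. \<Sum>j\<in>S'. f i j x)) = (\<Sum>i\<in>S. \<Sum>j\<in>S'. (LINT x|M. f i j x))"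
  using assms by (simp add: Bochner_Integration.integral_sum Bochner_Integration.integrable_sum)

lemma riesz_form_sum:
  fixes g h :: "'i \<Rightarrow> 'a::euclidean_space \<Rightarrow> complex"
  assumes a: "0 < a" "a < real DIM('a)"
    and gh: "\<And>i. i \<in> S \<Longrightarrow> bounded_support (g i)" "\<And>j. j \<in> S' \<Longrightarrow> bounded_support (h j)"
  shows "riesz_form a (\<lambda>x. \<Sum>i\<in>S. g i x) (\<lambda>x. \<Sum>j\<in>S'. h j x) = (\<Sum>i\<in>S. \<Sum>j\<in>S'. riesz_form a (g i) (h j))"
proof -
  have "riesz_form a (\<lambda>x. \<Sum>i\<in>S. g i x) (\<lambda>x. \<Sum>j\<in>S'. h j x)
    = (LINT z|lborel. (\<Sum>i\<in>S. \<Sum>j\<in>S'. g i (fst z) * cnj (h j (snd z)) * complex_of_real (norm (fst z - snd z) powr - a)))"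
    unfolding riesz_form_def unfolding cnj_sum unfolding sum_product unfolding sum_distrib_right ..
  also have "\<dots> = (\<Sum>i\<in>S. \<Sum>j\<in>S'. riesz_form a (g i) (h j))"
    unfolding riesz_form_def using gh
    by (intro integral_double_sum riesz_kernel_integrable a)
  finally show ?thesis .
qed

abbreviation (input) cindicator :: "'a set \<Rightarrow> 'a \<Rightarrow> complex" where
  "cindicator A \<equiv> \<lambda>y. complex_of_real (indicator A y)"

lemma elem_fun_nth: "elem_fun cs r y = (\<Sum>i<length cs. fst (cs ! i) * indicator {0..fst (snd (cs ! i))} r * indicator (snd (snd (cs ! i))) y)"
  unfolding elem_fun_def
  by (simp add: sum_list_sum_nth atLeast0LessThan case_prod_beta' indicator_times mult.assoc)

lemma elem_integral_nth: "elem_integral W cs \<omega> = (\<Sum>i<length cs. fst (cs ! i) * W (fst (snd (cs ! i))) (snd (snd (cs ! i))) \<omega>)"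
  unfolding elem_integral_def
  by (simp add: sum_list_sum_nth atLeast0LessThan case_prod_beta')

lemma elementary_nth:
  assumes "elementary cs" "i < length cs"
  shows "0 \<le> fst (snd (cs ! i))" "snd (snd (cs ! i)) \<in> sets borel" "bounded (snd (snd (cs ! i)))"
    "(fst (snd (cs ! i)), snd (snd (cs ! i))) \<in> noise_index"
  using assms nth_mem[OF assms(2)] unfolding elementary_def noise_index_def by (auto simp: case_prod_beta' mem_Times_iff)

lemma fourier_sum:
  assumes "finite S" "\<And>i. i \<in> S \<Longrightarrow> integrable lborel (g i)"
  shows "fourier (\<lambda>x. \<Sum>i\<in>S. g i x) \<xi> = (\<Sum>i\<in>S. fourier (g i) \<xi>)"
  using assms
proof (induction S rule: finite_induct)
  case (insert i S)
  then have "fourier (\<lambda>x. g i x + (\<Sum>i\<in>S. g i x)) \<xi> = fourier (g i) \<xi> + fourier (\<lambda>x. \<Sum>i\<in>S. g i x) \<xi>"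
    by (intro fourier_add Bochner_Integration.integrable_sum) auto
  with insert show ?case by simp
qed (simp add: fourier_def)

lemma elem_hat_nth:
  assumes "elementary cs"
  shows "elem_hat cs r \<xi> = (\<Sum>i<length cs. (complex_of_real (fst (cs ! i)) * fourier (cindicator (snd (snd (cs ! i)))) \<xi>) * cindicator {0..fst (snd (cs ! i))} r)"
proof -
  have bs: "bounded_support (cindicator (snd (snd (cs ! i))))" if "i < length cs" for i
    using elementary_nth[OF assms that] by (intro bounded_support_indicator)
  have "elem_hat cs r \<xi> = fourier (\<lambda>y. \<Sum>i<length cs. (complex_of_real (fst (cs ! i)) * cindicator {0..fst (snd (cs ! i))} r) * cindicator (snd (snd (cs ! i))) y) \<xi>"
    by (simp only: elem_hat_def elem_fun_nth of_real_sum of_real_mult)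
  also have "\<dots> = (\<Sum>i<length cs. fourier (\<lambda>y. (complex_of_real (fst (cs ! i)) * cindicator {0..fst (snd (cs ! i))} r) * cindicator (snd (snd (cs ! i))) y) \<xi>)"
    by (intro fourier_sum bounded_support_integrable bounded_support_cmult bs) auto
  finally show ?thesis by (simp only: fourier_cmult) (simp add: mult_ac)
qed

text \<open>
  At each frequency, \<open>elem_hat\<close> is a finite combination of indicators of the intervals \<open>[0, t\<^sub>i]\<close>
  whose coefficients are Fourier transforms of the sets \<open>A\<^sub>i\<close>; the time energies of the intervals
  are the fractional covariances.
\<close>

lemma HP_energy_elementary:
  fixes cs :: "(real \<times> real \<times> 'a::euclidean_space set) list" and \<beta> H :: real
  assumes H: "1 / 2 < H" "H < 1" and \<beta>: "0 < \<beta>" "\<beta> < real DIM('a)" and cs: "elementary cs"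
  defines "c \<equiv> \<lambda>i. fst (cs ! i)" and "t \<equiv> \<lambda>i. fst (snd (cs ! i))" and "A \<equiv> \<lambda>i. snd (snd (cs ! i))"
  shows "HP_admissible H \<beta> (elem_hat cs)"
    and "HP_energy H \<beta> (elem_hat cs) = (\<Sum>i<length cs. \<Sum>j<length cs. c i * c j * R_H H (t i) (t j) *
       (LINT \<xi>|riesz_measure \<beta>. Re (fourier (cindicator (A i)) \<xi> * cnj (fourier (cindicator (A j)) \<xi>))))"
proof -
  let ?n = "length cs"
  let ?F = "\<lambda>i. fourier (cindicator (A i))"
  have a: "0 < 2 - 2 * H" "2 - 2 * H < real DIM(real)" using H by auto
  have en: "0 \<le> t i" "A i \<in> sets borel" "bounded (A i)" if "i < ?n" for i
    unfolding t_def A_def by (rule elementary_nth[OF cs that])+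
  have hat: "elem_hat cs r \<xi> = (\<Sum>i<?n. (complex_of_real (c i) * ?F i \<xi>) * cindicator {0..t i} r)" for r \<xi>
    unfolding c_def t_def A_def by (rule elem_hat_nth[OF cs])
  have bsA: "bounded_support (cindicator (A i))" if "i < ?n" for i
    using en[OF that] by (intro bounded_support_indicator)
  have bst: "bounded_support (\<lambda>r. z * cindicator {0..s} r)" for s :: real and z
    by (intro bounded_support_cmult bounded_support_indicator) auto
  have bs: "bounded_support (\<lambda>r. \<Sum>i\<in>S. f i * cindicator {0..t i} r)" if "finite S" for f and S :: "nat set"
    using that
  proof (induction S rule: finite_induct)
    case empty
    then show ?case using bst[of 0 0] by simp
  qed (simp add: bounded_support_add bst)
  have Fm: "?F i \<in> borel_measurable borel" if "i < ?n" for i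
    using bsA[OF that] by (intro borel_measurable_fourier bounded_support_measurable)
  have meas: "(\<lambda>(r, \<xi>). elem_hat cs r \<xi>) \<in> borel_measurable (borel \<Otimes>\<^sub>M borel)"
    unfolding hat case_prod_beta'
  proof (rule borel_measurable_sum)
    fix i assume "i \<in> {..<?n}"
    then have [measurable]: "?F i \<in> borel_measurable borel" by (intro Fm) simp
    show "(\<lambda>x. complex_of_real (c i) * ?F i (snd x) * cindicator {0..t i} (fst x)) \<in> borel_measurable (borel \<Otimes>\<^sub>M borel)"
      by measurable
  qed
  have form: "alpha_H H * riesz_energy (2 - 2 * H) (\<lambda>r. elem_hat cs r \<xi>)
    = (\<Sum>i<?n. \<Sum>j<?n. c i * c j * R_H H (t i) (t j) * Re (?F i \<xi> * cnj (?F j \<xi>)))" for \<xi>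
  proof -
    have "complex_of_real (alpha_H H) * riesz_form (2 - 2 * H) (\<lambda>r. elem_hat cs r \<xi>) (\<lambda>r. elem_hat cs r \<xi>)
      = (\<Sum>i<?n. \<Sum>j<?n. (complex_of_real (c i) * ?F i \<xi>) * cnj (complex_of_real (c j) * ?F j \<xi>) *
          (complex_of_real (alpha_H H) * riesz_form (2 - 2 * H) (cindicator {0..t i}) (cindicator {0..t j})))"
      unfolding hat riesz_form_sum[OF a bst bst] riesz_form_cmult sum_distrib_left by (simp only: mult_ac)
    also have "\<dots> = (\<Sum>i<?n. \<Sum>j<?n. complex_of_real (c i * c j * R_H H (t i) (t j)) * (?F i \<xi> * cnj (?F j \<xi>)))"
      using en by (intro sum.cong refl, subst R_H_eq_riesz_form[OF H]) (auto simp: mult_ac)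
    finally have "Re (complex_of_real (alpha_H H) * riesz_form (2 - 2 * H) (\<lambda>r. elem_hat cs r \<xi>) (\<lambda>r. elem_hat cs r \<xi>))
      = Re (\<Sum>i<?n. \<Sum>j<?n. complex_of_real (c i * c j * R_H H (t i) (t j)) * (?F i \<xi> * cnj (?F j \<xi>)))" by simp
    moreover have "Re (complex_of_real u * z) = u * Re z" for u z by simp
    ultimately show ?thesis by (simp only: Re_sum)
  qed
  obtain K where "\<And>g h :: 'a \<Rightarrow> complex. bounded_support g \<Longrightarrow> bounded_support h \<Longrightarrow>
       integrable (riesz_measure \<beta>) (\<lambda>\<xi>. Re (fourier g \<xi> * cnj (fourier h \<xi>)))"
    using riesz_form_fourier[OF \<beta>] by metis
  then have int: "integrable (riesz_measure \<beta>) (\<lambda>\<xi>. Re (?F i \<xi> * cnj (?F j \<xi>)))" if "i < ?n" "j < ?n" for i j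
    using that bsA by blast
  \<comment> \<open>Only the combination \<open>\<alpha>\<^sub>H\<close> times the energy is an explicit sum of integrable terms.\<close>
  have intE: "integrable (riesz_measure \<beta>) (\<lambda>\<xi>. alpha_H H * riesz_energy (2 - 2 * H) (\<lambda>r. elem_hat cs r \<xi>))"
    unfolding form by (intro Bochner_Integration.integrable_sum integrable_mult_right int) auto
  moreover have "alpha_H H \<noteq> 0" using alpha_H_pos[OF H] by simp
  ultimately have "integrable (riesz_measure \<beta>) (\<lambda>\<xi>. riesz_energy (2 - 2 * H) (\<lambda>r. elem_hat cs r \<xi>))"
    by simp
  moreover have "elem_hat cs r \<xi> = 0" if "r < 0" for r \<xi> unfolding hat using that by simp
  moreover have "bounded_support (\<lambda>r. elem_hat cs r \<xi>)" for \<xi> unfolding hat by (rule bs) simp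
  ultimately show "HP_admissible H \<beta> (elem_hat cs)"
    unfolding HP_admissible_def using meas by blast
  have "HP_energy H \<beta> (elem_hat cs) = (LINT \<xi>|riesz_measure \<beta>. alpha_H H * riesz_energy (2 - 2 * H) (\<lambda>r. elem_hat cs r \<xi>))"
    by (simp add: HP_energy_def)
  also have "\<dots> = (\<Sum>i<?n. \<Sum>j<?n. (LINT \<xi>|riesz_measure \<beta>. c i * c j * R_H H (t i) (t j) * Re (?F i \<xi> * cnj (?F j \<xi>))))"
    unfolding form by (intro integral_double_sum integrable_mult_right int) auto
  finally show "HP_energy H \<beta> (elem_hat cs) = (\<Sum>i<?n. \<Sum>j<?n. c i * c j * R_H H (t i) (t j) *
       (LINT \<xi>|riesz_measure \<beta>. Re (?F i \<xi> * cnj (?F j \<xi>))))"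
    by simp
qed

text \<open>
  For a nondegenerate variable the second claim is the formula for the even moments of the normal
  law, with equality; an almost surely vanishing variable has variance \<open>0\<close>.
\<close>

lemma centered_gaussian_moments:
  fixes p :: nat
  assumes "prob_space M" and X: "centered_gaussian M X"
  shows "integrable M (\<lambda>\<omega>. (X \<omega>)\<^sup>2)"
    and "(\<integral>\<^sup>+ \<omega>. ennreal ((X \<omega>) ^ (2 * p)) \<partial>M) \<le> ennreal (fact (2 * p) / (2 ^ p * fact p) * (LINT \<omega>|M. (X \<omega>)\<^sup>2) ^ p)"
proof -
  interpret prob_space M by fact
  have [measurable]: "X \<in> borel_measurable M" using X by (simp add: centered_gaussian_def)
  have "integrable M (\<lambda>\<omega>. (X \<omega>)\<^sup>2) \<and> (\<integral>\<^sup>+ \<omega>. ennreal ((X \<omega>) ^ (2 * p)) \<partial>M) \<le> ennreal (fact (2 * p) / (2 ^ p * fact p) * (LINT \<omega>|M. (X \<omega>)\<^sup>2) ^ p)"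
  proof (cases "AE \<omega> in M. X \<omega> = 0")
    case True
    then have z: "AE \<omega> in M. (X \<omega>)\<^sup>2 = 0" by eventually_elim simp
    have 1: "integrable M (\<lambda>\<omega>. (X \<omega>)\<^sup>2)"
      by (subst integrable_cong_AE[where g="\<lambda>_. 0"]) (use z in auto)
    have 2: "(LINT \<omega>|M. (X \<omega>)\<^sup>2) = 0"
      by (subst integral_cong_AE[where g="\<lambda>_. 0"]) (use z in auto)
    have "(\<integral>\<^sup>+ \<omega>. ennreal ((X \<omega>) ^ (2 * p)) \<partial>M) = (\<integral>\<^sup>+ \<omega>. ennreal (0 ^ (2 * p)) \<partial>M)"
      by (intro nn_integral_cong_AE) (use True in \<open>auto elim!: eventually_mono\<close>)
    also have "\<dots> = ennreal (0 ^ (2 * p))" by (simp add: emeasure_space_1)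
    also have "\<dots> \<le> ennreal (fact (2 * p) / (2 ^ p * fact p) * (LINT \<omega>|M. (X \<omega>)\<^sup>2) ^ p)"
      unfolding 2 by (cases p) auto
    finally show ?thesis using 1 by simp
  next
    case False
    then obtain \<sigma> where \<sigma>: "\<sigma> > 0" "distributed M lborel X (normal_density 0 \<sigma>)"
      using X by (auto simp: centered_gaussian_def)
    have mom: "has_bochner_integral lborel (\<lambda>x. normal_density 0 \<sigma> x * x ^ (2 * k)) (fact (2 * k) / ((2 / \<sigma>\<^sup>2) ^ k * fact k))" for k
      using normal_moment_even[OF \<sigma>(1), of 0 k] by simp
    have int: "integrable M (\<lambda>\<omega>. X \<omega> ^ (2 * k))" for k
      using distributed_integrable[OF \<sigma>(2), of "\<lambda>x. x ^ (2 * k)"] mom[of k] by (auto simp: has_bochner_integral_iff)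
    have val: "(LINT \<omega>|M. X \<omega> ^ (2 * k)) = fact (2 * k) / ((2 / \<sigma>\<^sup>2) ^ k * fact k)" for k
      using distributed_integral[OF \<sigma>(2), of "\<lambda>x. x ^ (2 * k)"] mom[of k] by (auto simp: has_bochner_integral_iff)
    have var: "(LINT \<omega>|M. (X \<omega>)\<^sup>2) = \<sigma>\<^sup>2" using val[of 1] by simp
    have "(\<integral>\<^sup>+ \<omega>. ennreal ((X \<omega>) ^ (2 * p)) \<partial>M) = ennreal (fact (2 * p) / ((2 / \<sigma>\<^sup>2) ^ p * fact p))"
      unfolding val[symmetric] by (rule nn_integral_eq_integral[OF int]) auto
    also have "fact (2 * p) / ((2 / \<sigma>\<^sup>2) ^ p * fact p) = fact (2 * p) / (2 ^ p * fact p) * (LINT \<omega>|M. (X \<omega>)\<^sup>2) ^ p"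
      unfolding var by (simp add: power_divide)
    finally show ?thesis using int[of 1] by simp
  qed
  then show "integrable M (\<lambda>\<omega>. (X \<omega>)\<^sup>2)"
    and "(\<integral>\<^sup>+ \<omega>. ennreal ((X \<omega>) ^ (2 * p)) \<partial>M) \<le> ennreal (fact (2 * p) / (2 ^ p * fact p) * (LINT \<omega>|M. (X \<omega>)\<^sup>2) ^ p)"
    by auto
qed

text \<open>
  A list may contain the same pair \<open>(t, A)\<close> several times, whereas Gaussian families are defined by
  sums over finite sets of indices; the coefficients belonging to the same index are collected.
\<close>

lemma elem_integral_centered_gaussian:
  assumes "fractional_colored_noise M H f W" and cs: "elementary cs"
  shows "centered_gaussian M (elem_integral W cs)"
proof -
  let ?key = "\<lambda>i. snd (cs ! i)"
  define J where "J = ?key ` {..<length cs}"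
  define b where "b j = (\<Sum>i\<in>{i\<in>{..<length cs}. ?key i = j}. fst (cs ! i))" for j
  have fam: "centered_gaussian_family M noise_index (\<lambda>(t, A). W t A)"
    using assms(1) by (simp add: fractional_colored_noise_def)
  have J: "finite J" "J \<subseteq> noise_index" using elementary_nth(4)[OF cs] by (auto simp: J_def)
  have "centered_gaussian M (\<lambda>\<omega>. \<Sum>j\<in>J. b j * (case j of (t, A) \<Rightarrow> W t A) \<omega>)"
    using fam J unfolding centered_gaussian_family_def by blast
  moreover have "(\<Sum>j\<in>J. b j * (case j of (t, A) \<Rightarrow> W t A) \<omega>) = elem_integral W cs \<omega>" for \<omega>
  proof -
    have "(\<Sum>j\<in>J. b j * (case j of (t, A) \<Rightarrow> W t A) \<omega>)
      = (\<Sum>j\<in>J. \<Sum>i\<in>{i\<in>{..<length cs}. ?key i = j}. fst (cs ! i) * W (fst (snd (cs ! i))) (snd (snd (cs ! i))) \<omega>)"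
      unfolding b_def sum_distrib_right by (intro sum.cong refl) (auto simp: case_prod_beta')
    also have "\<dots> = elem_integral W cs \<omega>"
      unfolding elem_integral_nth by (rule sum.group[where g="?key"]) (auto simp: J_def)
    finally show ?thesis .
  qed
  ultimately show ?thesis by simp
qed

text \<open>
  The isometry between elementary functions and their stochastic integrals; \<open>\<kappa>\<close> absorbs the factor
  \<open>k\<close> of the covariance kernel and the constant relating \<open>|x|\<^bsup>-\<beta>\<^esup>\<close> to its spectral measure.
  In the double sum over the entries of the list, the coefficients are symmetric, so the spatial
  covariance may be symmetrised and expressed on the Fourier side by \<open>riesz_form_fourier\<close>.
\<close>

lemma elem_integral_variance:
  fixes f :: "'a::euclidean_space \<Rightarrow> real" and \<beta> H :: real
  assumes "prob_space M" and H: "1 / 2 < H" "H < 1" and \<beta>: "0 < \<beta>" "\<beta> < real DIM('a)"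
    and f: "\<And>x. f x = k * norm x powr (- \<beta>)" and W: "fractional_colored_noise M H f W"
  obtains \<kappa> where "\<kappa> \<ge> 0" "\<And>cs. elementary cs \<Longrightarrow>
     (LINT \<omega>|M. (elem_integral W cs \<omega>)\<^sup>2) \<le> \<kappa> * HP_energy H \<beta> (elem_hat cs)"
proof -
  interpret prob_space M by fact
  obtain K where K: "K > 0"
    "\<And>g h :: 'a \<Rightarrow> complex. bounded_support g \<Longrightarrow> bounded_support h \<Longrightarrow>
       Re (riesz_form \<beta> g h) + Re (riesz_form \<beta> h g) = 2 * K * (LINT \<xi>|riesz_measure \<beta>. Re (fourier g \<xi> * cnj (fourier h \<xi>)))"
    using riesz_form_fourier[OF \<beta>] by metis
  have spatial: "(LINT x:A|lborel. (LINT y:B|lborel. f (x - y))) = k * Re (riesz_form \<beta> (cindicator A) (cindicator B))"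
    if "A \<in> sets borel" "bounded A" "B \<in> sets borel" "bounded B" for A B :: "'a set"
  proof -
    have "riesz_form \<beta> (cindicator A) (cindicator B) = (LINT x|lborel. LINT y|lborel. complex_of_real (indicator A x * (indicator B y * norm (x - y) powr - \<beta>)))"
      using that by (subst riesz_form_iterated[OF \<beta>]) (auto intro!: bounded_support_indicator simp: mult.assoc)
    also have "\<dots> = complex_of_real (LINT x|lborel. indicator A x * (LINT y|lborel. indicator B y * norm (x - y) powr - \<beta>))"
      by (simp only: integral_complex_of_real integral_mult_right_zero)
    finally have "Re (riesz_form \<beta> (cindicator A) (cindicator B)) = (LINT x|lborel. indicator A x * (LINT y|lborel. indicator B y * norm (x - y) powr - \<beta>))"
      by simp
    moreover have "(LINT x:A|lborel. (LINT y:B|lborel. f (x - y))) = (LINT x|lborel. k * (indicator A x * (LINT y|lborel. indicator B y * norm (x - y) powr - \<beta>)))"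
      unfolding set_lebesgue_integral_def f
      by (intro Bochner_Integration.integral_cong refl) (simp add: mult.left_commute[of _ k])
    ultimately show ?thesis by simp
  qed
  have cov: "(LINT \<omega>|M. W t A \<omega> * W s B \<omega>) = R_H H t s * (LINT x:A|lborel. (LINT y:B|lborel. f (x - y)))"
    if "(t, A) \<in> noise_index" "(s, B) \<in> noise_index" for t s A B
    using W that unfolding fractional_colored_noise_def by fast
  have Wg: "centered_gaussian M (W t A)" if "(t, A) \<in> noise_index" for t A
  proof -
    have "elementary [(1, t, A)]" using that by (simp add: elementary_def)
    from elem_integral_centered_gaussian[OF W this] show ?thesis
      by (simp add: elem_integral_def[abs_def])
  qed
  have W2: "integrable M (\<lambda>\<omega>. W t A \<omega> * W s B \<omega>)" if "(t, A) \<in> noise_index" "(s, B) \<in> noise_index" for t s A B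
  proof (rule Bochner_Integration.integrable_bound)
    show "integrable M (\<lambda>\<omega>. (W t A \<omega>)\<^sup>2 + (W s B \<omega>)\<^sup>2)"
      using centered_gaussian_moments(1)[OF assms(1) Wg[OF that(1)]] centered_gaussian_moments(1)[OF assms(1) Wg[OF that(2)]] by simp
    have [measurable]: "W t A \<in> borel_measurable M" "W s B \<in> borel_measurable M"
      using Wg that by (auto simp: centered_gaussian_def)
    show "(\<lambda>\<omega>. W t A \<omega> * W s B \<omega>) \<in> borel_measurable M" by measurable
    have "\<bar>u * v\<bar> \<le> u\<^sup>2 + v\<^sup>2" for u v :: real
    proof -
      have "2 * \<bar>u\<bar> * \<bar>v\<bar> \<le> u\<^sup>2 + v\<^sup>2" using sum_squares_bound[of "\<bar>u\<bar>" "\<bar>v\<bar>"] by simp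
      moreover have "0 \<le> \<bar>u\<bar> * \<bar>v\<bar>" by simp
      ultimately show ?thesis unfolding abs_mult by linarith
    qed
    then show "AE \<omega> in M. norm (W t A \<omega> * W s B \<omega>) \<le> norm ((W t A \<omega>)\<^sup>2 + (W s B \<omega>)\<^sup>2)"
      by (intro AE_I2) simp
  qed
  have var: "(LINT \<omega>|M. (elem_integral W cs \<omega>)\<^sup>2) = k * K * HP_energy H \<beta> (elem_hat cs)" if cs: "elementary cs" for cs
  proof -
    let ?n = "length cs"
    define c where "c i = fst (cs ! i)" for i
    define t where "t i = fst (snd (cs ! i))" for i
    define A where "A i = snd (snd (cs ! i))" for i
    note en = elementary_nth[OF cs, folded t_def A_def]
    have bs: "bounded_support (cindicator (A i))" if "i < ?n" for i
      using en[OF that] by (intro bounded_support_indicator)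
    define w where "w i j = c i * c j * R_H H (t i) (t j)" for i j
    have sym: "w i j = w j i" for i j by (simp add: w_def R_H_def abs_minus_commute)
    define B where "B i j = Re (riesz_form \<beta> (cindicator (A i)) (cindicator (A j)))" for i j
    have "(LINT \<omega>|M. (elem_integral W cs \<omega>)\<^sup>2) = (LINT \<omega>|M. (\<Sum>i<?n. \<Sum>j<?n. c i * c j * (W (t i) (A i) \<omega> * W (t j) (A j) \<omega>)))"
      unfolding elem_integral_nth c_def t_def A_def power2_eq_square sum_product by (simp add: mult_ac)
    also have "\<dots> = (\<Sum>i<?n. \<Sum>j<?n. c i * c j * (LINT \<omega>|M. W (t i) (A i) \<omega> * W (t j) (A j) \<omega>))"
      by (subst integral_double_sum) (auto intro!: W2 en)
    also have "\<dots> = (\<Sum>i<?n. \<Sum>j<?n. k * (w i j * B i j))"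
      using en by (intro sum.cong refl) (simp add: cov spatial w_def B_def)
    also have "\<dots> = k * (\<Sum>i<?n. \<Sum>j<?n. w i j * B i j)" by (simp add: sum_distrib_left)
    also have "(\<Sum>i<?n. \<Sum>j<?n. w i j * B i j) = (\<Sum>i<?n. \<Sum>j<?n. w i j * ((B i j + B j i) / 2))"
    proof -
      have "(\<Sum>i<?n. \<Sum>j<?n. w i j * B j i) = (\<Sum>i<?n. \<Sum>j<?n. w i j * B i j)"
        by (subst sum.swap) (simp add: sym)
      then show ?thesis
        by (simp add: distrib_left add_divide_distrib sum.distrib sum_divide_distrib[symmetric])
    qed
    also have "\<dots> = (\<Sum>i<?n. \<Sum>j<?n. K * (w i j * (LINT \<xi>|riesz_measure \<beta>. Re (fourier (cindicator (A i)) \<xi> * cnj (fourier (cindicator (A j)) \<xi>)))))"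
      using bs by (intro sum.cong refl) (simp add: B_def K(2))
    also have "\<dots> = K * HP_energy H \<beta> (elem_hat cs)"
      unfolding HP_energy_elementary(2)[OF H \<beta> cs] w_def c_def t_def A_def by (simp add: sum_distrib_left)
    finally show ?thesis by (simp add: mult.assoc)
  qed
  show ?thesis
  proof (rule that[of "\<bar>k * K\<bar>"])
    fix cs :: "(real \<times> real \<times> 'a set) list" assume cs: "elementary cs"
    have "0 \<le> HP_energy H \<beta> (elem_hat cs)"
      unfolding HP_norm_square[OF H HP_energy_elementary(1)[OF H \<beta> cs], symmetric] by simp
    then have "k * K * HP_energy H \<beta> (elem_hat cs) \<le> \<bar>k * K\<bar> * HP_energy H \<beta> (elem_hat cs)"
      by (intro mult_right_mono) auto
    then show "(LINT \<omega>|M. (elem_integral W cs \<omega>)\<^sup>2) \<le> \<bar>k * K\<bar> * HP_energy H \<beta> (elem_hat cs)"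
      unfolding var[OF cs] .
  qed simp
qed

section \<open>Moments of increments of Wiener integrals\<close>

text \<open>
  Appending \<open>\<psi>\<close> with negated coefficients to \<open>\<phi>\<close> represents the difference of the two elementary
  functions; the next lemmas record this for the integral, the function and its transform.
\<close>

lemma elem_integral_diff:
  "elem_integral W (\<phi> @ map (\<lambda>(c, t, A). (- c, t, A)) \<psi>) \<omega> = elem_integral W \<phi> \<omega> - elem_integral W \<psi> \<omega>"
  unfolding elem_integral_def by (induction \<psi>) (auto simp: algebra_simps)

lemma elem_fun_diff:
  "elem_fun (\<phi> @ map (\<lambda>(c, t, A). (- c, t, A)) \<psi>) r y = elem_fun \<phi> r y - elem_fun \<psi> r y"
  unfolding elem_fun_def by (induction \<psi>) (auto simp: algebra_simps)

lemma elementary_diff: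
  "elementary \<phi> \<Longrightarrow> elementary \<psi> \<Longrightarrow> elementary (\<phi> @ map (\<lambda>(c, t, A). (- c, t, A)) \<psi>)"
  unfolding elementary_def by auto

lemma elem_fun_bounded_support:
  assumes "elementary cs"
  shows "bounded_support (\<lambda>y. complex_of_real (elem_fun cs r y))"
proof -
  have "bounded_support (\<lambda>y. \<Sum>i\<in>S. (complex_of_real (c i)) * cindicator (A i) y)"
    if "finite S" "\<And>i. i \<in> S \<Longrightarrow> A i \<in> sets borel \<and> bounded (A i)" for S :: "nat set" and c and A :: "nat \<Rightarrow> 'a set"
    using that
  proof (induction S rule: finite_induct)
    case empty
    show ?case using bounded_support_cmult[OF bounded_support_indicator[of "{} :: 'a set"], of 0] by simp
  next
    case (insert i S)
    then show ?case
      by (simp del: of_real_mult) (intro bounded_support_add bounded_support_cmult bounded_support_indicator; auto)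
  qed
  from this[of "{..<length cs}" "\<lambda>i. snd (snd (cs ! i))" "\<lambda>i. fst (cs ! i) * indicator {0..fst (snd (cs ! i))} r"]
  show ?thesis
    using elementary_nth[OF assms] by (simp only: elem_fun_nth of_real_sum of_real_mult) auto
qed

lemma elem_hat_diff:
  assumes "elementary \<phi>" "elementary \<psi>"
  shows "elem_hat (\<phi> @ map (\<lambda>(c, t, A). (- c, t, A)) \<psi>) r \<xi> = elem_hat \<phi> r \<xi> - elem_hat \<psi> r \<xi>"
proof -
  note i = bounded_support_integrable[OF elem_fun_bounded_support[OF assms(1), of r]]
    bounded_support_integrable[OF elem_fun_bounded_support[OF assms(2), of r]]
  have "elem_hat (\<phi> @ map (\<lambda>(c, t, A). (- c, t, A)) \<psi>) r \<xi>
    = fourier (\<lambda>y. complex_of_real (elem_fun \<phi> r y) + (-1) * complex_of_real (elem_fun \<psi> r y)) \<xi>"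
    unfolding elem_hat_def elem_fun_diff by simp
  also have "\<dots> = fourier (\<lambda>y. complex_of_real (elem_fun \<phi> r y)) \<xi> + (-1) * fourier (\<lambda>y. complex_of_real (elem_fun \<psi> r y)) \<xi>"
  proof -
    have "integrable lborel (\<lambda>y. (-1) * complex_of_real (elem_fun \<psi> r y))"
      using i(2) by (rule integrable_mult_right)
    then show ?thesis by (simp only: fourier_add[OF i(1)] fourier_cmult)
  qed
  finally show ?thesis by (simp add: elem_hat_def)
qed

text \<open>
  Fatou's lemma along an almost surely convergent subsequence transfers the moment bounds of the
  approximating Gaussian variables to the limit.
\<close>

lemma gaussian_limit_moments:
  fixes D :: "nat \<Rightarrow> 'w \<Rightarrow> real"
  assumes "prob_space M" and D: "\<And>n. centered_gaussian M (D n)"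
    and X: "X \<in> borel_measurable M"
    and int: "\<And>n. integrable M (\<lambda>\<omega>. (D n \<omega> - X \<omega>)\<^sup>2)"
    and conv: "(\<lambda>n. LINT \<omega>|M. (D n \<omega> - X \<omega>)\<^sup>2) \<longlonglongrightarrow> 0"
    and var: "\<And>n. (LINT \<omega>|M. (D n \<omega>)\<^sup>2) \<le> b n" and b: "b \<longlonglongrightarrow> V"
  shows "(\<integral>\<^sup>+ \<omega>. ennreal ((X \<omega>) ^ (2 * p)) \<partial>M) \<le> ennreal (fact (2 * p) / (2 ^ p * fact p) * V ^ p)"
proof -
  define c where "c = fact (2 * p) / (2 ^ p * fact p :: real)"
  have c: "c \<ge> 0" by (simp add: c_def)
  note [measurable] = X
  have [measurable]: "D n \<in> borel_measurable M" for n using D by (simp add: centered_gaussian_def)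
  have "\<exists>r::nat\<Rightarrow>nat. strict_mono r \<and> (AE \<omega> in M. (\<lambda>n. (D (r n) \<omega> - X \<omega>)\<^sup>2) \<longlonglongrightarrow> 0)"
    using conv by (intro tendsto_L1_AE_subseq int) simp
  then obtain r :: "nat \<Rightarrow> nat" where r: "strict_mono r" and ae: "AE \<omega> in M. (\<lambda>n. (D (r n) \<omega> - X \<omega>)\<^sup>2) \<longlonglongrightarrow> 0"
    by blast
  have "AE \<omega> in M. ennreal ((X \<omega>) ^ (2 * p)) = liminf (\<lambda>n. ennreal ((D (r n) \<omega>) ^ (2 * p)))"
    using ae
  proof eventually_elim
    fix \<omega> assume "(\<lambda>n. (D (r n) \<omega> - X \<omega>)\<^sup>2) \<longlonglongrightarrow> 0"
    then have "(\<lambda>n. D (r n) \<omega> - X \<omega>) \<longlonglongrightarrow> 0"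
      using tendsto_real_sqrt[of "\<lambda>n. (D (r n) \<omega> - X \<omega>)\<^sup>2"] by (simp add: tendsto_rabs_zero_iff)
    then have "(\<lambda>n. D (r n) \<omega>) \<longlonglongrightarrow> X \<omega>" by (simp add: LIM_zero_iff)
    then have "(\<lambda>n. ennreal ((D (r n) \<omega>) ^ (2 * p))) \<longlonglongrightarrow> ennreal ((X \<omega>) ^ (2 * p))"
      by (intro tendsto_ennrealI tendsto_power)
    then show "ennreal ((X \<omega>) ^ (2 * p)) = liminf (\<lambda>n. ennreal ((D (r n) \<omega>) ^ (2 * p)))"
      by (rule lim_imp_Liminf[OF sequentially_bot, symmetric])
  qed
  then have "(\<integral>\<^sup>+ \<omega>. ennreal ((X \<omega>) ^ (2 * p)) \<partial>M) = (\<integral>\<^sup>+ \<omega>. liminf (\<lambda>n. ennreal ((D (r n) \<omega>) ^ (2 * p))) \<partial>M)"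
    by (rule nn_integral_cong_AE)
  also have "\<dots> \<le> liminf (\<lambda>n. \<integral>\<^sup>+ \<omega>. ennreal ((D (r n) \<omega>) ^ (2 * p)) \<partial>M)"
    by (rule nn_integral_liminf) measurable
  also have "\<dots> \<le> liminf (\<lambda>n. ennreal (c * b (r n) ^ p))"
  proof (intro Liminf_mono always_eventually allI)
    fix n
    have "0 \<le> (LINT \<omega>|M. (D (r n) \<omega>)\<^sup>2)" by (intro integral_nonneg_AE) auto
    then have "c * (LINT \<omega>|M. (D (r n) \<omega>)\<^sup>2) ^ p \<le> c * b (r n) ^ p"
      using c var by (intro mult_left_mono power_mono)
    then show "(\<integral>\<^sup>+ \<omega>. ennreal ((D (r n) \<omega>) ^ (2 * p)) \<partial>M) \<le> ennreal (c * b (r n) ^ p)"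
      using centered_gaussian_moments(2)[OF assms(1) D, of "r n" p]
      by (intro order_trans[OF centered_gaussian_moments(2)[OF assms(1) D]] ennreal_leI) (simp add: c_def)
  qed
  also have "\<dots> = ennreal (c * V ^ p)"
  proof (rule lim_imp_Liminf)
    have "(\<lambda>n. b (r n)) \<longlonglongrightarrow> V" using LIMSEQ_subseq_LIMSEQ[OF b r] by (simp add: comp_def)
    then show "(\<lambda>n. ennreal (c * b (r n) ^ p)) \<longlonglongrightarrow> ennreal (c * V ^ p)"
      by (intro tendsto_ennrealI tendsto_intros)
  qed simp
  finally show ?thesis by (simp add: c_def)
qed

lemma L2_diff_bound:
  fixes f g X Y :: "'w \<Rightarrow> real"
  assumes [measurable]: "f \<in> borel_measurable M" "g \<in> borel_measurable M" "X \<in> borel_measurable M" "Y \<in> borel_measurable M"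
    and "integrable M (\<lambda>\<omega>. (f \<omega> - X \<omega>)\<^sup>2)" "integrable M (\<lambda>\<omega>. (g \<omega> - Y \<omega>)\<^sup>2)"
  shows "integrable M (\<lambda>\<omega>. ((f \<omega> - g \<omega>) - (X \<omega> - Y \<omega>))\<^sup>2)"
    and "(LINT \<omega>|M. ((f \<omega> - g \<omega>) - (X \<omega> - Y \<omega>))\<^sup>2) \<le> 2 * (LINT \<omega>|M. (f \<omega> - X \<omega>)\<^sup>2) + 2 * (LINT \<omega>|M. (g \<omega> - Y \<omega>)\<^sup>2)"
proof -
  have le: "((f \<omega> - g \<omega>) - (X \<omega> - Y \<omega>))\<^sup>2 \<le> 2 * (f \<omega> - X \<omega>)\<^sup>2 + 2 * (g \<omega> - Y \<omega>)\<^sup>2" for \<omega>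
  proof -
    have "0 \<le> ((f \<omega> - X \<omega>) + (g \<omega> - Y \<omega>))\<^sup>2" by simp
    then show ?thesis by (simp add: power2_eq_square algebra_simps)
  qed
  have intB: "integrable M (\<lambda>\<omega>. 2 * (f \<omega> - X \<omega>)\<^sup>2 + 2 * (g \<omega> - Y \<omega>)\<^sup>2)"
    using assms by simp
  show int: "integrable M (\<lambda>\<omega>. ((f \<omega> - g \<omega>) - (X \<omega> - Y \<omega>))\<^sup>2)"
    by (rule Bochner_Integration.integrable_bound[OF intB]) (use le in \<open>auto intro!: AE_I2\<close>)
  have "(LINT \<omega>|M. ((f \<omega> - g \<omega>) - (X \<omega> - Y \<omega>))\<^sup>2) \<le> (LINT \<omega>|M. 2 * (f \<omega> - X \<omega>)\<^sup>2 + 2 * (g \<omega> - Y \<omega>)\<^sup>2)"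
    by (rule integral_mono[OF int intB le])
  then show "(LINT \<omega>|M. ((f \<omega> - g \<omega>) - (X \<omega> - Y \<omega>))\<^sup>2) \<le> 2 * (LINT \<omega>|M. (f \<omega> - X \<omega>)\<^sup>2) + 2 * (LINT \<omega>|M. (g \<omega> - Y \<omega>)\<^sup>2)"
    using assms by simp
qed

text \<open>
  If elementary \<open>\<phi>\<^sub>n\<close> and \<open>\<psi>\<^sub>n\<close> approximate \<open>\<Phi>\<close> and \<open>\<Psi>\<close>, the integral of \<open>\<phi>\<^sub>n - \<psi>\<^sub>n\<close> is a centered
  Gaussian variable converging to \<open>X - Y\<close>, and its variance is controlled by the energy of
  \<open>\<phi>\<^sub>n - \<psi>\<^sub>n = ((\<phi>\<^sub>n - \<Phi>) - (\<psi>\<^sub>n - \<Psi>)) - (\<Psi> - \<Phi>)\<close>. Two applications of \<open>HP_admissible_diff\<close> leave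
  twice the energy of \<open>\<Phi> - \<Psi>\<close> and errors that vanish in the limit.
\<close>

lemma wiener_integral_diff_moments:
  fixes \<Phi> \<Psi> :: "real \<Rightarrow> 'a::euclidean_space \<Rightarrow> complex" and \<beta> H :: real
  assumes M: "prob_space M" and H: "1 / 2 < H" "H < 1" and \<beta>: "0 < \<beta>" "\<beta> < real DIM('a)"
    and W: "fractional_colored_noise M H f W"
    and \<kappa>: "\<kappa> \<ge> 0" "\<And>cs. elementary cs \<Longrightarrow> (LINT \<omega>|M. (elem_integral W cs \<omega>)\<^sup>2) \<le> \<kappa> * HP_energy H \<beta> (elem_hat cs)"
    and X: "wiener_integral M H \<beta> W \<Phi> X" and Y: "wiener_integral M H \<beta> W \<Psi> Y"
    and \<Phi>: "HP_admissible H \<beta> \<Phi>" and \<Psi>: "HP_admissible H \<beta> \<Psi>"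
  shows "(\<integral>\<^sup>+ \<omega>. ennreal ((X \<omega> - Y \<omega>) ^ (2 * p)) \<partial>M)
     \<le> ennreal (fact (2 * p) / (2 ^ p * fact p) * (2 * \<kappa> * HP_energy H \<beta> (\<lambda>r \<xi>. \<Phi> r \<xi> - \<Psi> r \<xi>)) ^ p)"
proof -
  obtain \<phi> where \<phi>: "\<And>n. elementary (\<phi> n)"
    "(\<lambda>n. HP_norm H \<beta> (\<lambda>r \<xi>. elem_hat (\<phi> n) r \<xi> - \<Phi> r \<xi>)) \<longlonglongrightarrow> 0"
    "(\<lambda>n. LINT \<omega>|M. (elem_integral W (\<phi> n) \<omega> - X \<omega>)\<^sup>2) \<longlonglongrightarrow> 0"
    using X unfolding wiener_integral_def by blast
  obtain \<psi> where \<psi>: "\<And>n. elementary (\<psi> n)"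
    "(\<lambda>n. HP_norm H \<beta> (\<lambda>r \<xi>. elem_hat (\<psi> n) r \<xi> - \<Psi> r \<xi>)) \<longlonglongrightarrow> 0"
    "(\<lambda>n. LINT \<omega>|M. (elem_integral W (\<psi> n) \<omega> - Y \<omega>)\<^sup>2) \<longlonglongrightarrow> 0"
    using Y unfolding wiener_integral_def by blast
  have [measurable]: "X \<in> borel_measurable M" "Y \<in> borel_measurable M"
    and X2: "integrable M (\<lambda>\<omega>. (X \<omega>)\<^sup>2)" and Y2: "integrable M (\<lambda>\<omega>. (Y \<omega>)\<^sup>2)"
    using X Y by (auto simp: wiener_integral_def)
  define \<rho> where "\<rho> n = \<phi> n @ map (\<lambda>(c, t, A). (- c, t, A)) (\<psi> n)" for n
  have \<rho>: "elementary (\<rho> n)" for n unfolding \<rho>_def by (intro elementary_diff \<phi> \<psi>)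
  have gauss: "centered_gaussian M (elem_integral W cs)" if "elementary cs" for cs
    by (rule elem_integral_centered_gaussian[OF W that])
  have meas: "elem_integral W cs \<in> borel_measurable M" if "elementary cs" for cs
    using gauss[OF that] by (simp add: centered_gaussian_def)
  have L2: "integrable M (\<lambda>\<omega>. (elem_integral W cs \<omega> - Z \<omega>)\<^sup>2)"
    if "elementary cs" "Z \<in> borel_measurable M" "integrable M (\<lambda>\<omega>. (Z \<omega>)\<^sup>2)" for cs Z
    using L2_diff_bound(1)[of "elem_integral W cs" M Z "\<lambda>_. 0" "\<lambda>_. 0"] meas[OF that(1)] that(2,3)
      centered_gaussian_moments(1)[OF M gauss[OF that(1)]] by simp
  have Xint: "integrable M (\<lambda>\<omega>. (elem_integral W (\<phi> n) \<omega> - X \<omega>)\<^sup>2)" for n by (intro L2 \<phi> X2) measurable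
  have Yint: "integrable M (\<lambda>\<omega>. (elem_integral W (\<psi> n) \<omega> - Y \<omega>)\<^sup>2)" for n by (intro L2 \<psi> Y2) measurable
  have D: "elem_integral W (\<rho> n) \<omega> = elem_integral W (\<phi> n) \<omega> - elem_integral W (\<psi> n) \<omega>" for n \<omega>
    unfolding \<rho>_def by (rule elem_integral_diff)
  have L: "integrable M (\<lambda>\<omega>. (elem_integral W (\<rho> n) \<omega> - (X \<omega> - Y \<omega>))\<^sup>2)"
    "(LINT \<omega>|M. (elem_integral W (\<rho> n) \<omega> - (X \<omega> - Y \<omega>))\<^sup>2)
      \<le> 2 * (LINT \<omega>|M. (elem_integral W (\<phi> n) \<omega> - X \<omega>)\<^sup>2) + 2 * (LINT \<omega>|M. (elem_integral W (\<psi> n) \<omega> - Y \<omega>)\<^sup>2)" for n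
    unfolding D by (intro L2_diff_bound meas \<phi> \<psi> Xint Yint; measurable)+
  define V where "V = HP_energy H \<beta> (\<lambda>r \<xi>. \<Phi> r \<xi> - \<Psi> r \<xi>)"
  define b where "b n = \<kappa> * (4 * (HP_norm H \<beta> (\<lambda>r \<xi>. elem_hat (\<phi> n) r \<xi> - \<Phi> r \<xi>))\<^sup>2 + 4 * (HP_norm H \<beta> (\<lambda>r \<xi>. elem_hat (\<psi> n) r \<xi> - \<Psi> r \<xi>))\<^sup>2 + 2 * V)" for n
  have bound: "(LINT \<omega>|M. (elem_integral W (\<rho> n) \<omega>)\<^sup>2) \<le> b n" for n
  proof -
    note hp = HP_energy_elementary(1)[OF H \<beta> \<phi>(1)[of n]] and hq = HP_energy_elementary(1)[OF H \<beta> \<psi>(1)[of n]]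
    note d1 = HP_admissible_diff[OF H hp \<Phi>] and d2 = HP_admissible_diff[OF H hq \<Psi>] and d3 = HP_admissible_diff[OF H \<Psi> \<Phi>]
    note d12 = HP_admissible_diff[OF H d1(1) d2(1)]
    have V': "HP_energy H \<beta> (\<lambda>r \<xi>. \<Psi> r \<xi> - \<Phi> r \<xi>) = V"
    proof -
      have "riesz_energy (2 - 2 * H) (\<lambda>r. \<Psi> r \<xi> - \<Phi> r \<xi>) = riesz_energy (2 - 2 * H) (\<lambda>r. \<Phi> r \<xi> - \<Psi> r \<xi>)" for \<xi>
        using riesz_form_cmult[of "2 - 2 * H" "-1" "\<lambda>r. \<Phi> r \<xi> - \<Psi> r \<xi>" "-1" "\<lambda>r. \<Phi> r \<xi> - \<Psi> r \<xi>"] by simp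
      then show ?thesis by (simp add: V_def HP_energy_def)
    qed
    have hat: "elem_hat (\<rho> n) = (\<lambda>r \<xi>. ((elem_hat (\<phi> n) r \<xi> - \<Phi> r \<xi>) - (elem_hat (\<psi> n) r \<xi> - \<Psi> r \<xi>)) - (\<Psi> r \<xi> - \<Phi> r \<xi>))"
      unfolding \<rho>_def by (intro ext, subst elem_hat_diff[OF \<phi>(1) \<psi>(1)]) simp
    have "HP_energy H \<beta> (elem_hat (\<rho> n)) \<le> 2 * HP_energy H \<beta> (\<lambda>r \<xi>. (elem_hat (\<phi> n) r \<xi> - \<Phi> r \<xi>) - (elem_hat (\<psi> n) r \<xi> - \<Psi> r \<xi>)) + 2 * V"
      unfolding hat V'[symmetric] by (rule HP_admissible_diff(2)[OF H d12(1) d3(1)])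
    also have "\<dots> \<le> 4 * HP_energy H \<beta> (\<lambda>r \<xi>. elem_hat (\<phi> n) r \<xi> - \<Phi> r \<xi>) + 4 * HP_energy H \<beta> (\<lambda>r \<xi>. elem_hat (\<psi> n) r \<xi> - \<Psi> r \<xi>) + 2 * V"
      using d12(2) by simp
    finally have "\<kappa> * HP_energy H \<beta> (elem_hat (\<rho> n)) \<le> b n"
      unfolding b_def HP_norm_square[OF H d1(1)] HP_norm_square[OF H d2(1)] using \<kappa>(1) by (rule mult_left_mono)
    with \<kappa>(2)[OF \<rho>, of n] show ?thesis by linarith
  qed
  have b_lim: "b \<longlonglongrightarrow> \<kappa> * (4 * 0\<^sup>2 + 4 * 0\<^sup>2 + 2 * V)"
    unfolding b_def by (intro tendsto_intros \<phi> \<psi>)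
  have conv: "(\<lambda>n. LINT \<omega>|M. (elem_integral W (\<rho> n) \<omega> - (X \<omega> - Y \<omega>))\<^sup>2) \<longlonglongrightarrow> 0"
  proof (rule tendsto_sandwich[of "\<lambda>_. 0" _ _ "\<lambda>n. 2 * (LINT \<omega>|M. (elem_integral W (\<phi> n) \<omega> - X \<omega>)\<^sup>2) + 2 * (LINT \<omega>|M. (elem_integral W (\<psi> n) \<omega> - Y \<omega>)\<^sup>2)"])
    show "(\<lambda>n. 2 * (LINT \<omega>|M. (elem_integral W (\<phi> n) \<omega> - X \<omega>)\<^sup>2) + 2 * (LINT \<omega>|M. (elem_integral W (\<psi> n) \<omega> - Y \<omega>)\<^sup>2)) \<longlonglongrightarrow> 0"
      using tendsto_add[OF tendsto_mult_left[OF \<phi>(3), of 2] tendsto_mult_left[OF \<psi>(3), of 2]] by simp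
    show "\<forall>\<^sub>F n in sequentially. 0 \<le> (LINT \<omega>|M. (elem_integral W (\<rho> n) \<omega> - (X \<omega> - Y \<omega>))\<^sup>2)"
      by (intro always_eventually allI integral_nonneg_AE) auto
    show "\<forall>\<^sub>F n in sequentially. (LINT \<omega>|M. (elem_integral W (\<rho> n) \<omega> - (X \<omega> - Y \<omega>))\<^sup>2) \<le>
        2 * (LINT \<omega>|M. (elem_integral W (\<phi> n) \<omega> - X \<omega>)\<^sup>2) + 2 * (LINT \<omega>|M. (elem_integral W (\<psi> n) \<omega> - Y \<omega>)\<^sup>2)"
      by (intro always_eventually allI L(2))
  qed simp
  have "(\<integral>\<^sup>+ \<omega>. ennreal ((X \<omega> - Y \<omega>) ^ (2 * p)) \<partial>M) \<le> ennreal (fact (2 * p) / (2 ^ p * fact p) * (\<kappa> * (4 * 0\<^sup>2 + 4 * 0\<^sup>2 + 2 * V)) ^ p)"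
    by (rule gaussian_limit_moments[OF M gauss[OF \<rho>] _ L(1) conv bound b_lim]) measurable
  then show ?thesis by (simp add: V_def mult_ac)
qed

section \<open>Kolmogorov continuity on a Euclidean space\<close>

definition dyadic_point :: "nat \<Rightarrow> ('a::euclidean_space \<Rightarrow> int) \<Rightarrow> 'a" where
  "dyadic_point n k = (\<Sum>b\<in>Basis. (real_of_int (k b) / 2 ^ n) *\<^sub>R b)"

definition dyadic_floor :: "nat \<Rightarrow> 'a::euclidean_space \<Rightarrow> 'a" where
  "dyadic_floor n x = dyadic_point n (\<lambda>b. \<lfloor>2 ^ n * (x \<bullet> b)\<rfloor>)"

lemma divide_power2_powr:
  assumes "0 \<le> c"
  shows "(c / 2 ^ n) powr g = c powr g * 2 powr (- (g * real n))"
proof -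
  have "c / 2 ^ n = c * 2 powr (- real n)" by (simp add: powr_minus powr_realpow divide_inverse)
  then show ?thesis using assms by (simp add: powr_mult powr_powr mult.commute)
qed

lemma dyadic_point_Suc: "dyadic_point n k = dyadic_point (Suc n) (\<lambda>b. 2 * k b)"
  by (simp add: dyadic_point_def)

lemma dyadic_point_restrict: "dyadic_point n (restrict k Basis) = dyadic_point n k"
  by (simp add: dyadic_point_def)

lemma norm_dyadic_point_diff_le:
  fixes k e :: "'a::euclidean_space \<Rightarrow> int"
  assumes "\<And>b. b \<in> Basis \<Longrightarrow> \<bar>e b\<bar> \<le> 1"
  shows "norm (dyadic_point n k - dyadic_point n (\<lambda>b. k b + e b)) \<le> DIM('a) / 2 ^ n"
proof -
  have "dyadic_point n k - dyadic_point n (\<lambda>b. k b + e b) = (\<Sum>b\<in>Basis. (- real_of_int (e b) / 2 ^ n) *\<^sub>R b)"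
    unfolding dyadic_point_def sum_subtractf[symmetric]
    by (intro sum.cong refl) (simp add: scaleR_diff_left[symmetric] diff_divide_distrib[symmetric])
  also have "norm \<dots> \<le> (\<Sum>b\<in>(Basis::'a set). 1 / 2 ^ n)"
  proof (intro sum_norm_le)
    fix b :: 'a assume b: "b \<in> Basis"
    have "\<bar>real_of_int (e b)\<bar> \<le> 1" using assms[OF b] by linarith
    then show "norm ((- real_of_int (e b) / 2 ^ n) *\<^sub>R b) \<le> 1 / 2 ^ n"
      using b by (simp add: divide_right_mono)
  qed
  finally show ?thesis by simp
qed

lemma norm_dyadic_floor_diff_le: "norm (dyadic_floor n x - (x::'a::euclidean_space)) \<le> DIM('a) / 2 ^ n"
proof -
  have "dyadic_floor n x - x = (\<Sum>b\<in>Basis. (real_of_int \<lfloor>2 ^ n * (x \<bullet> b)\<rfloor> / 2 ^ n - x \<bullet> b) *\<^sub>R b)"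
    by (subst (2) euclidean_representation[of x, symmetric])
       (simp only: dyadic_floor_def dyadic_point_def sum_subtractf[symmetric] scaleR_diff_left)
  also have "norm \<dots> \<le> (\<Sum>b\<in>(Basis::'a set). 1 / 2 ^ n)"
  proof (intro sum_norm_le)
    fix b :: 'a assume b: "b \<in> Basis"
    have "\<bar>real_of_int \<lfloor>2 ^ n * (x \<bullet> b)\<rfloor> - 2 ^ n * (x \<bullet> b)\<bar> \<le> 1" by linarith
    then have "\<bar>real_of_int \<lfloor>2 ^ n * (x \<bullet> b)\<rfloor> - 2 ^ n * (x \<bullet> b)\<bar> / 2 ^ n \<le> 1 / 2 ^ n"
      by (intro divide_right_mono) auto
    moreover have "real_of_int \<lfloor>2 ^ n * (x \<bullet> b)\<rfloor> / 2 ^ n - x \<bullet> b = (real_of_int \<lfloor>2 ^ n * (x \<bullet> b)\<rfloor> - 2 ^ n * (x \<bullet> b)) / 2 ^ n"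
      by (simp add: field_simps)
    ultimately show "norm ((real_of_int \<lfloor>2 ^ n * (x \<bullet> b)\<rfloor> / 2 ^ n - x \<bullet> b) *\<^sub>R b) \<le> 1 / 2 ^ n"
      using b by simp
  qed
  finally show ?thesis by simp
qed

text \<open>
  Dyadic chaining. The roundings of \<open>x\<close> at levels \<open>n\<close> and \<open>n + 1\<close> are neighbours on the grid of
  level \<open>n + 1\<close>, so the values of \<open>X\<close> along the roundings form a Cauchy sequence with geometric
  error. Two points at distance at most \<open>2\<^bsup>-n\<^esup>\<close> have neighbouring roundings at level \<open>n\<close>. Hence
  the limits at these points differ by a multiple of \<open>(2\<^bsup>-\<delta>\<^esup>)\<^bsup>n\<^esup>\<close>, that is, of \<open>2\<^bsup>-n\<delta>\<^esup>\<close>.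
\<close>

lemma dyadic_chaining:
  fixes X :: "'a::euclidean_space \<Rightarrow> real" and N :: nat
  assumes \<delta>: "\<delta> > 0" and B0: "B \<ge> 0"
    and B: "\<And>n k e. (\<And>b. b \<in> Basis \<Longrightarrow> \<bar>k b\<bar> \<le> int N * 2 ^ n) \<Longrightarrow> (\<And>b. b \<in> Basis \<Longrightarrow> \<bar>e b\<bar> \<le> 1) \<Longrightarrow>
       \<bar>X (dyadic_point n k) - X (dyadic_point n (\<lambda>b. k b + e b))\<bar> \<le> B * (2 powr - \<delta>) ^ n"
  defines "v \<equiv> \<lambda>x. lim (\<lambda>n. X (dyadic_floor n x))"
  defines "Q \<equiv> {x. \<forall>b\<in>Basis. \<bar>x \<bullet> b\<bar> \<le> real N}"
  shows "\<exists>C. \<forall>x\<in>Q. \<forall>y\<in>Q. \<bar>v x - v y\<bar> \<le> C * dist x y powr \<delta>"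
proof -
  define q where "q = 2 powr - \<delta>"
  have q: "0 < q" "q < 1" using \<delta> by (auto simp: q_def powr_less_one)
  have floor_bd: "\<bar>\<lfloor>2 ^ n * (x \<bullet> b)\<rfloor>\<bar> \<le> int N * 2 ^ n" if "x \<in> Q" "b \<in> Basis" for x b n
  proof -
    have "\<bar>x \<bullet> b\<bar> \<le> real N" using that by (auto simp: Q_def)
    then have "\<bar>2 ^ n * (x \<bullet> b)\<bar> \<le> 2 ^ n * real N" by (simp add: abs_mult)
    moreover have "real_of_int (int N * 2 ^ n) = 2 ^ n * real N" by simp
    ultimately have "2 ^ n * (x \<bullet> b) \<le> real_of_int (int N * 2 ^ n)" "real_of_int (- (int N * 2 ^ n)) \<le> 2 ^ n * (x \<bullet> b)"
      by linarith+
    then have "\<lfloor>2 ^ n * (x \<bullet> b)\<rfloor> \<le> int N * 2 ^ n" "- (int N * 2 ^ n) \<le> \<lfloor>2 ^ n * (x \<bullet> b)\<rfloor>"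
      by (simp only: floor_le_iff le_floor_iff, linarith)+
    then show ?thesis by simp
  qed
  have step: "\<bar>X (dyadic_floor (Suc n) x) - X (dyadic_floor n x)\<bar> \<le> B * q ^ Suc n" if "x \<in> Q" for x n
  proof -
    define k where "k b = 2 * \<lfloor>2 ^ n * (x \<bullet> b)\<rfloor>" for b
    define e where "e b = \<lfloor>2 ^ Suc n * (x \<bullet> b)\<rfloor> - k b" for b
    have "\<bar>e b\<bar> \<le> 1" for b
    proof -
      have "\<lfloor>2 * (2 ^ n * (x \<bullet> b))\<rfloor> - 2 * \<lfloor>2 ^ n * (x \<bullet> b)\<rfloor> \<le> 1" "0 \<le> \<lfloor>2 * (2 ^ n * (x \<bullet> b))\<rfloor> - 2 * \<lfloor>2 ^ n * (x \<bullet> b)\<rfloor>"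
        by linarith+
      then show ?thesis by (simp add: e_def k_def mult.assoc)
    qed
    moreover have "\<bar>k b\<bar> \<le> int N * 2 ^ Suc n" if "b \<in> Basis" for b
      using floor_bd[OF \<open>x \<in> Q\<close> that, of n] by (simp add: k_def abs_mult)
    ultimately have "\<bar>X (dyadic_point (Suc n) k) - X (dyadic_point (Suc n) (\<lambda>b. k b + e b))\<bar> \<le> B * (2 powr - \<delta>) ^ Suc n"
      by (intro B)
    moreover have "dyadic_point (Suc n) k = dyadic_floor n x"
      unfolding dyadic_floor_def k_def by (rule dyadic_point_Suc[symmetric])
    moreover have "dyadic_point (Suc n) (\<lambda>b. k b + e b) = dyadic_floor (Suc n) x"
      by (simp add: dyadic_floor_def e_def)
    ultimately show ?thesis by (simp add: q_def abs_minus_commute)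
  qed
  have lim: "\<bar>v x - X (dyadic_floor n x)\<bar> \<le> B / (1 - q) * q ^ n" if "x \<in> Q" for x n
  proof -
    let ?D = "\<lambda>m. X (dyadic_floor (Suc m) x) - X (dyadic_floor m x)"
    have gs: "summable (\<lambda>m. B * q ^ Suc m)" using q by (intro summable_mult) (simp add: summable_geometric)
    have sD: "summable ?D"
      by (rule summable_comparison_test'[OF gs, of 0]) (use step[OF that] in simp)
    then have "convergent (\<lambda>m. \<Sum>i<m. ?D i)" by (simp add: summable_iff_convergent)
    then have "convergent (\<lambda>m. X (dyadic_floor m x) - X (dyadic_floor 0 x))" by (simp only: sum_lessThan_telescope[of "\<lambda>n. X (dyadic_floor n x)"])
    from convergent_add[OF this convergent_const[of "X (dyadic_floor 0 x)"]]
    have conv: "(\<lambda>m. X (dyadic_floor m x)) \<longlonglongrightarrow> v x" by (simp add: v_def convergent_LIMSEQ_iff)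
    have "\<bar>X (dyadic_floor (m + n) x) - X (dyadic_floor n x)\<bar> \<le> B / (1 - q) * q ^ n" for m
    proof -
      have "\<bar>X (dyadic_floor (m + n) x) - X (dyadic_floor n x)\<bar> = \<bar>\<Sum>i<m. X (dyadic_floor (Suc i + n) x) - X (dyadic_floor (i + n) x)\<bar>"
        using sum_lessThan_telescope[of "\<lambda>i. X (dyadic_floor (i + n) x)" m] by simp
      also have "\<dots> \<le> (\<Sum>i<m. B * q ^ Suc (i + n))"
        using step[OF that] by (intro order_trans[OF sum_abs] sum_mono) simp
      also have "\<dots> = B * q ^ n * q * (\<Sum>i<m. q ^ i)"
        by (simp add: sum_distrib_left power_add mult_ac)
      also have "\<dots> \<le> B * q ^ n * q * (\<Sum>i. q ^ i)"
        using q B0 by (intro mult_left_mono sum_le_suminf) (auto simp: summable_geometric)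
      also have "\<dots> = B / (1 - q) * q ^ n * q" using q by (simp add: suminf_geometric)
      also have "\<dots> \<le> B / (1 - q) * q ^ n * 1" using q B0 by (intro mult_left_mono) auto
      finally show ?thesis by simp
    qed
    moreover have "(\<lambda>m. \<bar>X (dyadic_floor (m + n) x) - X (dyadic_floor n x)\<bar>) \<longlonglongrightarrow> \<bar>v x - X (dyadic_floor n x)\<bar>"
      by (intro tendsto_intros LIMSEQ_ignore_initial_segment conv)
    ultimately show ?thesis by (intro LIMSEQ_le_const2) auto
  qed
  define D where "D = B + 2 * (B / (1 - q))"
  have D: "D \<ge> 0" using B0 q by (auto simp: D_def)
  have near: "\<bar>v x - v y\<bar> \<le> D * q ^ n" if "x \<in> Q" "y \<in> Q" and xy: "dist x y \<le> 1 / 2 ^ n" for x y n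
  proof -
    define k where "k b = \<lfloor>2 ^ n * (x \<bullet> b)\<rfloor>" for b
    have kk: "k = (\<lambda>b. \<lfloor>2 ^ n * (x \<bullet> b)\<rfloor>)" by (simp add: fun_eq_iff k_def)
    define e where "e b = \<lfloor>2 ^ n * (y \<bullet> b)\<rfloor> - k b" for b
    have "\<bar>e b\<bar> \<le> 1" if "b \<in> Basis" for b
    proof -
      have "\<bar>x \<bullet> b - y \<bullet> b\<bar> \<le> 1 / 2 ^ n"
        using Basis_le_norm[OF that, of "x - y"] xy by (simp add: dist_norm inner_diff_left)
      then have "2 ^ n * \<bar>x \<bullet> b - y \<bullet> b\<bar> \<le> 1" by (simp add: field_simps)
      then have "\<bar>2 ^ n * (x \<bullet> b - y \<bullet> b)\<bar> \<le> 1" by (simp only: abs_mult) simp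
      then have "\<bar>2 ^ n * (x \<bullet> b) - 2 ^ n * (y \<bullet> b)\<bar> \<le> 1" by (simp only: right_diff_distrib)
      then show ?thesis unfolding e_def k_def by linarith
    qed
    then have "\<bar>X (dyadic_point n k) - X (dyadic_point n (\<lambda>b. k b + e b))\<bar> \<le> B * (2 powr - \<delta>) ^ n"
      using floor_bd[OF \<open>x \<in> Q\<close>] by (intro B) (auto simp: k_def)
    then have "\<bar>X (dyadic_floor n x) - X (dyadic_floor n y)\<bar> \<le> B * q ^ n"
      by (simp add: dyadic_floor_def e_def q_def kk)
    with lim[OF that(1), of n] lim[OF that(2), of n]
    have "\<bar>v x - v y\<bar> \<le> B * q ^ n + 2 * (B / (1 - q) * q ^ n)" by linarith
    then show ?thesis by (simp add: D_def algebra_simps)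
  qed
  have "finite (Pi\<^sub>E (Basis::'a set) (\<lambda>_. {- int N..int N}))" by (intro finite_PiE) auto
  then have "bounded ((\<lambda>k. X (dyadic_point 0 k)) ` Pi\<^sub>E (Basis::'a set) (\<lambda>_. {- int N..int N}))"
    by (intro finite_imp_bounded finite_imageI)
  then obtain A where A: "\<And>k. k \<in> Pi\<^sub>E (Basis::'a set) (\<lambda>_. {- int N..int N}) \<Longrightarrow> \<bar>X (dyadic_point 0 k)\<bar> \<le> A"
    by (auto simp: bounded_iff)
  have vbd: "\<bar>v x\<bar> \<le> A + B / (1 - q)" if "x \<in> Q" for x
  proof -
    have "\<bar>X (dyadic_point 0 (restrict (\<lambda>b. \<lfloor>2 ^ 0 * (x \<bullet> b)\<rfloor>) Basis))\<bar> \<le> A"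
    proof (intro A restrict_PiE_iff[THEN iffD2] ballI)
      fix b :: 'a assume "b \<in> Basis"
      from floor_bd[OF that this, of 0] show "\<lfloor>2 ^ 0 * (x \<bullet> b)\<rfloor> \<in> {- int N..int N}"
        unfolding atLeastAtMost_iff power_0 mult_1_right by linarith
    qed
    then show ?thesis using lim[OF that, of 0] by (simp add: dyadic_floor_def dyadic_point_restrict)
  qed
  define E where "E = A + B / (1 - q)"
  note vbd = vbd[folded E_def]
  \<comment> \<open>The first bound serves points at distance at most \<open>1\<close>; at larger distances boundedness of the
    limit on the cube suffices.\<close>
  define C where "C = max (D * 2 powr \<delta>) (2 * E)"
  show ?thesis
  proof (intro exI[of _ C] ballI)
    fix x y assume xy: "x \<in> Q" "y \<in> Q"
    consider "x = y" | "x \<noteq> y" "dist x y \<le> 1" | "dist x y > 1" by linarith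
    then show "\<bar>v x - v y\<bar> \<le> C * dist x y powr \<delta>"
    proof cases
      case 2
      then have pos: "dist x y > 0" by simp
      define n where "n = nat \<lfloor>- log 2 (dist x y)\<rfloor>"
      have l0: "- log 2 (dist x y) \<ge> 0" using 2 pos by (simp add: log_le_zero_cancel_iff)
      then have n: "real n \<le> - log 2 (dist x y)" "- log 2 (dist x y) < real n + 1"
        unfolding n_def by linarith+
      have "dist x y = 2 powr (log 2 (dist x y))" using pos by simp
      also have "\<dots> \<le> 2 powr (- real n)" using n by (intro powr_mono) auto
      finally have le: "dist x y \<le> 1 / 2 ^ n" by (simp add: powr_minus powr_realpow divide_inverse)
      have "2 powr (- real n - 1) \<le> 2 powr (log 2 (dist x y))" using n by (intro powr_mono) auto
      also have "\<dots> = dist x y" using pos by simp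
      finally have "2 powr (- real n - 1) \<le> dist x y" .
      then have "(2 powr (- real n - 1)) powr \<delta> \<le> dist x y powr \<delta>" using \<delta> by (intro powr_mono2) auto
      moreover have "q ^ n = 2 powr \<delta> * (2 powr (- real n - 1)) powr \<delta>"
        by (simp add: q_def powr_powr powr_add[symmetric] powr_realpow[symmetric] algebra_simps)
      ultimately have "q ^ n \<le> 2 powr \<delta> * dist x y powr \<delta>" by simp
      with near[OF xy le] have "\<bar>v x - v y\<bar> \<le> D * (2 powr \<delta> * dist x y powr \<delta>)"
        using D by (meson mult_left_mono order_trans)
      also have "\<dots> \<le> C * dist x y powr \<delta>" unfolding C_def mult.assoc[symmetric] by (intro mult_right_mono) auto
      finally show ?thesis .
    next
      case 3
      have "\<bar>v x - v y\<bar> \<le> 2 * E" using vbd[OF xy(1)] vbd[OF xy(2)] by linarith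
      also have "\<dots> \<le> C" by (simp add: C_def)
      also have "\<dots> \<le> C * dist x y powr \<delta>"
      proof -
        have "0 \<le> C" unfolding C_def using D by (simp add: le_max_iff_disj)
        moreover have "1 \<le> dist x y powr \<delta>" using 3 \<delta> by (intro ge_one_powr_ge_zero) auto
        ultimately show ?thesis by (simp add: mult_le_cancel_left1)
      qed
      finally show ?thesis .
    qed simp
  qed
qed

text \<open>
  The modification \<open>v\<close> is the limit of \<open>X\<close> along dyadic roundings, one choice for all exponents. It
  agrees with \<open>X\<close> almost surely at each point, since the second moments of the differences are
  summable. For the Hoelder bound, the \<open>2p\<close>-th powers of the increments over neighbouring dyadic
  points of a cube are summed over all levels \<open>n\<close> with weights \<open>2\<^bsup>2p\<delta>n\<^esup>\<close>. There are \<open>O(2\<^bsup>dn\<^esup>)\<close>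
  such pairs, so with a moment exponent \<open>\<delta>' > \<delta>\<close> the expected sum is dominated by a geometric series
  of ratio \<open>2\<^bsup>d - 2p(\<delta>' - \<delta>)\<^esup>\<close>, which converges for large \<open>p\<close>. The sum is then almost surely finite
  and bounds every single increment, as chaining requires.
\<close>

theorem kolmogorov_continuity:
  fixes X :: "'a::euclidean_space \<Rightarrow> 'w \<Rightarrow> real" and M :: "'w measure" and \<gamma> :: real
  assumes "\<gamma> > 0"
    and X [measurable]: "\<And>x. X x \<in> borel_measurable M"
    and moments: "\<And>\<delta> p. 0 < \<delta> \<Longrightarrow> \<delta> < \<gamma> \<Longrightarrow> 0 < p \<Longrightarrow> \<exists>C\<ge>0. \<forall>x y.
      (\<integral>\<^sup>+ \<omega>. ennreal ((X x \<omega> - X y \<omega>) ^ (2 * p)) \<partial>M) \<le> ennreal (C * dist x y powr (2 * real p * \<delta>))"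
  shows "\<exists>v. modification_of M v X \<and>
    (\<forall>\<delta>. 0 < \<delta> \<and> \<delta> < \<gamma> \<longrightarrow> (AE \<omega> in M. holder_continuous \<delta> (\<lambda>x. v x \<omega>)))"
proof -
  let ?d = "real DIM('a)"
  define v where "v x \<omega> = lim (\<lambda>n. X (dyadic_floor n x) \<omega>)" for x \<omega>
  have AE_small: "AE \<omega> in M. S \<omega> < \<infinity>" if "S \<in> borel_measurable M" "(\<integral>\<^sup>+ \<omega>. S \<omega> \<partial>M) < \<infinity>" for S :: "'w \<Rightarrow> ennreal"
    using nn_integral_PInf_AE[OF that(1)] that(2) by (auto simp: less_top)
  have mod: "AE \<omega> in M. v x \<omega> = X x \<omega>" for x
  proof -
    have "0 < \<gamma> / 2" "\<gamma> / 2 < \<gamma>" using assms by auto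
    from moments[OF this, of 1] obtain C where C: "C \<ge> 0" "\<And>x y. (\<integral>\<^sup>+ \<omega>. ennreal ((X x \<omega> - X y \<omega>)\<^sup>2) \<partial>M) \<le> ennreal (C * dist x y powr \<gamma>)"
      by auto
    define q where "q = 2 powr - \<gamma>"
    have q: "0 < q" "q < 1" using assms by (auto simp: q_def powr_less_one)
    define S where "S \<omega> = (\<Sum>n. ennreal ((X (dyadic_floor n x) \<omega> - X x \<omega>)\<^sup>2))" for \<omega>
    have S_meas [measurable]: "S \<in> borel_measurable M" unfolding S_def by measurable
    have bound: "(\<integral>\<^sup>+ \<omega>. ennreal ((X (dyadic_floor n x) \<omega> - X x \<omega>)\<^sup>2) \<partial>M) \<le> ennreal (C * ?d powr \<gamma> * q ^ n)" for n
    proof -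
      have "dist (dyadic_floor n x) x powr \<gamma> \<le> (?d / 2 ^ n) powr \<gamma>"
        using norm_dyadic_floor_diff_le[of n x] assms by (intro powr_mono2) (auto simp: dist_norm)
      also have "\<dots> = ?d powr \<gamma> * q ^ n"
        using divide_power2_powr[of ?d n \<gamma>] by (simp add: q_def powr_power mult.commute)
      finally have "C * dist (dyadic_floor n x) x powr \<gamma> \<le> C * (?d powr \<gamma> * q ^ n)"
        using C by (intro mult_left_mono)
      then show ?thesis by (intro order_trans[OF C(2)] ennreal_leI) (simp add: mult.assoc)
    qed
    have "(\<integral>\<^sup>+ \<omega>. S \<omega> \<partial>M) = (\<Sum>n. \<integral>\<^sup>+ \<omega>. ennreal ((X (dyadic_floor n x) \<omega> - X x \<omega>)\<^sup>2) \<partial>M)"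
      unfolding S_def by (rule nn_integral_suminf) measurable
    also have "\<dots> \<le> (\<Sum>n. ennreal (C * ?d powr \<gamma> * q ^ n))"
      by (intro suminf_le bound) auto
    also have "\<dots> < \<infinity>"
      using q C by (subst suminf_ennreal2) (auto intro!: summable_mult summable_geometric)
    finally have "AE \<omega> in M. S \<omega> < \<infinity>" by (intro AE_small) auto
    then show ?thesis
    proof eventually_elim
      fix \<omega> assume "S \<omega> < \<infinity>"
      then have "summable (\<lambda>n. (X (dyadic_floor n x) \<omega> - X x \<omega>)\<^sup>2)"
        unfolding S_def by (intro summable_suminf_not_top) auto
      then have "(\<lambda>n. (X (dyadic_floor n x) \<omega> - X x \<omega>)\<^sup>2) \<longlonglongrightarrow> 0" by (rule summable_LIMSEQ_zero)
      then have "(\<lambda>n. X (dyadic_floor n x) \<omega> - X x \<omega>) \<longlonglongrightarrow> 0"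
        using tendsto_real_sqrt[of "\<lambda>n. (X (dyadic_floor n x) \<omega> - X x \<omega>)\<^sup>2"] by (simp add: tendsto_rabs_zero_iff)
      then have "(\<lambda>n. X (dyadic_floor n x) \<omega>) \<longlonglongrightarrow> X x \<omega>" by (simp add: LIM_zero_iff)
      then show "v x \<omega> = X x \<omega>" unfolding v_def by (rule limI)
    qed
  qed
  have holder: "AE \<omega> in M. holder_continuous \<delta> (\<lambda>x. v x \<omega>)" if \<delta>: "0 < \<delta>" "\<delta> < \<gamma>" for \<delta>
  proof -
    \<comment> \<open>The moment bound is used at an exponent strictly above \<open>\<delta>\<close>, with \<open>p\<close> large enough that the
      gain \<open>2p(\<delta>' - \<delta>)\<close> exceeds the dimension.\<close>
    define \<delta>' where "\<delta>' = (\<delta> + \<gamma>) / 2"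
    have \<delta>': "0 < \<delta>'" "\<delta>' < \<gamma>" "\<delta> < \<delta>'" using \<delta> by (auto simp: \<delta>'_def)
    obtain p :: nat where p: "?d / (2 * (\<delta>' - \<delta>)) < real p" using reals_Archimedean2 by blast
    have dp: "?d < 2 * real p * (\<delta>' - \<delta>)" using p \<delta>' by (simp add: field_simps)
    have p0: "p > 0" using dp by (cases p) auto
    obtain C where C: "C \<ge> 0" "\<And>x y. (\<integral>\<^sup>+ \<omega>. ennreal ((X x \<omega> - X y \<omega>) ^ (2 * p)) \<partial>M) \<le> ennreal (C * dist x y powr (2 * real p * \<delta>'))"
      using moments[OF \<delta>'(1,2) p0] by auto
    define q where "q = 2 powr (?d + 2 * real p * \<delta> - 2 * real p * \<delta>')"
    have q: "0 < q" "q < 1" using dp by (auto simp: q_def powr_less_one algebra_simps)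
    define I where "I N n = Pi\<^sub>E (Basis::'a set) (\<lambda>_. {- (int N * 2 ^ n)..int N * 2 ^ n})" for N n :: nat
    define J where "J = Pi\<^sub>E (Basis::'a set) (\<lambda>_. {-1..1::int})"
    have finI: "finite (I N n)" and finJ: "finite J" for N n by (auto simp: I_def J_def intro!: finite_PiE)
    define Z where "Z n k e \<omega> = (2 powr (\<delta> * real n) * (X (dyadic_point n k) \<omega> - X (dyadic_point n (\<lambda>b. k b + e b)) \<omega>)) ^ (2 * p)" for n k e \<omega>
    have Z0: "Z n k e \<omega> \<ge> 0" for n k e \<omega> by (simp add: Z_def)
    have Z_meas [measurable]: "Z n k e \<in> borel_measurable M" for n k e unfolding Z_def by measurable
    define S where "S N \<omega> = (\<Sum>n. \<Sum>k\<in>I N n. \<Sum>e\<in>J. ennreal (Z n k e \<omega>))" for N \<omega>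
    have S_meas [measurable]: "S N \<in> borel_measurable M" for N unfolding S_def by measurable
    define L where "L = C * ?d powr (2 * real p * \<delta>')"
    have L: "L \<ge> 0" using C by (simp add: L_def)
    have Zint: "(\<integral>\<^sup>+ \<omega>. ennreal (Z n k e \<omega>) \<partial>M) \<le> ennreal (L * 2 powr ((2 * real p * \<delta> - 2 * real p * \<delta>') * real n))" if "e \<in> J" for n k e
    proof -
      have e: "\<And>b. b \<in> Basis \<Longrightarrow> \<bar>e b\<bar> \<le> 1" using that by (auto simp: J_def PiE_iff abs_le_iff)
      have "(\<integral>\<^sup>+ \<omega>. ennreal (Z n k e \<omega>) \<partial>M) = (\<integral>\<^sup>+ \<omega>. ennreal (2 powr (2 * real p * \<delta> * real n)) * ennreal ((X (dyadic_point n k) \<omega> - X (dyadic_point n (\<lambda>b. k b + e b)) \<omega>) ^ (2 * p)) \<partial>M)"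
        by (intro nn_integral_cong)
           (simp add: Z_def power_mult_distrib ennreal_mult'[symmetric] powr_powr powr_realpow[symmetric] powr_power mult_ac)
      also have "\<dots> = ennreal (2 powr (2 * real p * \<delta> * real n)) * (\<integral>\<^sup>+ \<omega>. ennreal ((X (dyadic_point n k) \<omega> - X (dyadic_point n (\<lambda>b. k b + e b)) \<omega>) ^ (2 * p)) \<partial>M)"
        by (rule nn_integral_cmult) measurable
      also have "\<dots> \<le> ennreal (2 powr (2 * real p * \<delta> * real n)) * ennreal (C * (?d / 2 ^ n) powr (2 * real p * \<delta>'))"
      proof (intro mult_left_mono order_trans[OF C(2)] ennreal_leI)
        show "dist (dyadic_point n k) (dyadic_point n (\<lambda>b. k b + e b)) powr (2 * real p * \<delta>') \<le> (?d / 2 ^ n) powr (2 * real p * \<delta>')"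
          using norm_dyadic_point_diff_le[of e n k] e \<delta>' by (intro powr_mono2) (auto simp: dist_norm)
      qed (use C in auto)
      also have "(?d / 2 ^ n) powr (2 * real p * \<delta>') = ?d powr (2 * real p * \<delta>') * 2 powr (- (2 * real p * \<delta>' * real n))"
        using divide_power2_powr[of ?d n "2 * real p * \<delta>'"] by simp
      also have "ennreal (2 powr (2 * real p * \<delta> * real n)) * ennreal (C * (?d powr (2 * real p * \<delta>') * 2 powr (- (2 * real p * \<delta>' * real n))))
        = ennreal (L * (2 powr (2 * real p * \<delta> * real n) * 2 powr (- (2 * real p * \<delta>' * real n))))"
        using C by (simp add: L_def ennreal_mult[symmetric] mult_ac)
      also have "2 powr (2 * real p * \<delta> * real n) * 2 powr (- (2 * real p * \<delta>' * real n)) = 2 powr ((2 * real p * \<delta> - 2 * real p * \<delta>') * real n)"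
        unfolding powr_add[symmetric] left_diff_distrib by simp
      finally show ?thesis .
    qed
    have S_fin: "AE \<omega> in M. S N \<omega> < \<infinity>" for N
    proof -
      have cardI: "real (card (I N n)) \<le> (2 * real N + 1) ^ DIM('a) * 2 powr (?d * real n)" for n
      proof -
        have "real (card (I N n)) = (2 * real N * 2 ^ n + 1) ^ DIM('a)"
          by (simp add: I_def card_PiE nat_add_distrib nat_mult_distrib nat_power_eq ac_simps)
        also have "\<dots> \<le> ((2 * real N + 1) * 2 ^ n) ^ DIM('a)"
          by (intro power_mono) (auto simp: algebra_simps)
        also have "\<dots> = (2 * real N + 1) ^ DIM('a) * 2 powr (?d * real n)"
          by (simp add: power_mult_distrib powr_realpow[symmetric] powr_powr powr_power mult_ac)
        finally show ?thesis .
      qed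
      define L' where "L' = (2 * real N + 1) ^ DIM('a) * real (card J) * L"
      have "(\<integral>\<^sup>+ \<omega>. S N \<omega> \<partial>M) = (\<Sum>n. \<Sum>k\<in>I N n. \<Sum>e\<in>J. (\<integral>\<^sup>+ \<omega>. ennreal (Z n k e \<omega>) \<partial>M))"
        unfolding S_def by (subst nn_integral_suminf, measurable) (simp add: nn_integral_sum)
      also have "\<dots> \<le> (\<Sum>n. ennreal (L' * q ^ n))"
      proof (intro suminf_le)
        fix n
        let ?w = "2 powr ((2 * real p * \<delta> - 2 * real p * \<delta>') * real n)"
        have "(\<Sum>k\<in>I N n. \<Sum>e\<in>J. (\<integral>\<^sup>+ \<omega>. ennreal (Z n k e \<omega>) \<partial>M)) \<le> (\<Sum>k\<in>I N n. \<Sum>e\<in>J. ennreal (L * ?w))"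
          by (intro sum_mono Zint)
        also have "\<dots> = ennreal (real (card (I N n)) * (real (card J) * (L * ?w)))"
          using L by (simp add: ennreal_mult ennreal_of_nat_eq_real_of_nat)
        also have "\<dots> \<le> ennreal (((2 * real N + 1) ^ DIM('a) * 2 powr (?d * real n)) * (real (card J) * (L * ?w)))"
          using L by (intro ennreal_leI mult_right_mono cardI) auto
        also have "((2 * real N + 1) ^ DIM('a) * 2 powr (?d * real n)) * (real (card J) * (L * ?w)) = L' * (2 powr (?d * real n) * ?w)"
          by (simp add: L'_def mult_ac)
        also have "2 powr (?d * real n) * ?w = q ^ n"
          by (simp add: q_def powr_add[symmetric] powr_realpow[symmetric] powr_powr algebra_simps)
        finally show "(\<Sum>k\<in>I N n. \<Sum>e\<in>J. (\<integral>\<^sup>+ \<omega>. ennreal (Z n k e \<omega>) \<partial>M)) \<le> ennreal (L' * q ^ n)" .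
      qed auto
      also have "\<dots> < \<infinity>"
        using q L by (subst suminf_ennreal2) (auto simp: L'_def intro!: summable_mult summable_geometric)
      finally show ?thesis by (intro AE_small) auto
    qed
    then have "AE \<omega> in M. \<forall>N. S N \<omega> < \<infinity>" by (simp add: AE_all_countable)
    then show ?thesis
    proof eventually_elim
      fix \<omega> assume fin: "\<forall>N. S N \<omega> < \<infinity>"
      show "holder_continuous \<delta> (\<lambda>x. v x \<omega>)"
        unfolding holder_continuous_def
      proof (intro allI impI)
        fix K :: "'a set" assume "compact K"
        then obtain R where R: "\<And>x. x \<in> K \<Longrightarrow> norm x \<le> R"
          by (meson bounded_iff compact_imp_bounded)
        obtain N :: nat where N: "R \<le> real N" using real_arch_simple by blast
        define A where "A = enn2real (S N \<omega>)"
        have A: "S N \<omega> = ennreal A" "A \<ge> 0" using fin by (auto simp: A_def less_top)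
        have Z_le: "Z n k e \<omega> \<le> A" if "k \<in> I N n" "e \<in> J" for n k e
        proof -
          have "ennreal (Z n k e \<omega>) \<le> (\<Sum>e\<in>J. ennreal (Z n k e \<omega>))"
            using that finJ by (intro member_le_sum) auto
          also have "\<dots> \<le> (\<Sum>k\<in>I N n. \<Sum>e\<in>J. ennreal (Z n k e \<omega>))"
            using that finI by (intro member_le_sum[where f="\<lambda>k. \<Sum>e\<in>J. ennreal (Z n k e \<omega>)"]) auto
          also have "\<dots> = (\<Sum>n\<in>{n}. \<Sum>k\<in>I N n. \<Sum>e\<in>J. ennreal (Z n k e \<omega>))" by simp
          also have "\<dots> \<le> S N \<omega>" unfolding S_def by (intro sum_le_suminf) auto
          finally show ?thesis using A by simp
        qed
        have main: "\<bar>X (dyadic_point n k) \<omega> - X (dyadic_point n (\<lambda>b. k b + e b)) \<omega>\<bar> \<le> max 1 A * (2 powr - \<delta>) ^ n"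
          if k: "\<And>b. b \<in> Basis \<Longrightarrow> \<bar>k b\<bar> \<le> int N * 2 ^ n" and e: "\<And>b. b \<in> Basis \<Longrightarrow> \<bar>e b\<bar> \<le> 1" for n k e
        proof -
          have "restrict k Basis \<in> I N n" "restrict e Basis \<in> J"
            using k e unfolding I_def J_def restrict_PiE_iff atLeastAtMost_iff
            by (auto simp only: abs_le_iff Ball_def) (metis minus_le_iff)+
          from Z_le[OF this] have "Z n (restrict k Basis) (restrict e Basis) \<omega> \<le> A" .
          moreover have "dyadic_point n (\<lambda>b. restrict k Basis b + restrict e Basis b) = dyadic_point n (\<lambda>b. k b + e b)"
            by (simp add: dyadic_point_def)
          ultimately have Zk: "(2 powr (\<delta> * real n) * (X (dyadic_point n k) \<omega> - X (dyadic_point n (\<lambda>b. k b + e b)) \<omega>)) ^ (2 * p) \<le> A"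
            by (simp add: Z_def dyadic_point_restrict)
          define z where "z = \<bar>2 powr (\<delta> * real n) * (X (dyadic_point n k) \<omega> - X (dyadic_point n (\<lambda>b. k b + e b)) \<omega>)\<bar>"
          have zA: "z ^ (2 * p) \<le> A" using Zk by (simp add: z_def power_even_abs)
          \<comment> \<open>\<open>max 1 A\<close> is a convenient upper bound for the \<open>2p\<close>-th root of \<open>A\<close>.\<close>
          have "z \<le> max 1 A"
          proof (rule ccontr)
            assume "\<not> z \<le> max 1 A"
            then have z: "z > 1" "z > A" by auto
            have "z \<le> z ^ (2 * p)" using z p0 by (intro self_le_power) auto
            with zA z show False by linarith
          qed
          then have "2 powr (\<delta> * real n) * \<bar>X (dyadic_point n k) \<omega> - X (dyadic_point n (\<lambda>b. k b + e b)) \<omega>\<bar> \<le> max 1 A"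
            by (simp add: z_def abs_mult)
          then have "2 powr (- (\<delta> * real n)) * (2 powr (\<delta> * real n) * \<bar>X (dyadic_point n k) \<omega> - X (dyadic_point n (\<lambda>b. k b + e b)) \<omega>\<bar>) \<le> 2 powr (- (\<delta> * real n)) * max 1 A"
            by (intro mult_left_mono) auto
          moreover have "2 powr (- (\<delta> * real n)) * 2 powr (\<delta> * real n) = 1" by (simp add: powr_add[symmetric])
          moreover have "2 powr (- (\<delta> * real n)) = (2 powr - \<delta>) ^ n" by (simp add: powr_power mult.commute)
          ultimately show ?thesis by (simp only: mult.assoc[symmetric] mult_1_left mult.commute[of "max 1 A"])
        qed
        have "\<exists>C. \<forall>x\<in>{x. \<forall>b\<in>Basis. \<bar>x \<bullet> b\<bar> \<le> real N}. \<forall>y\<in>{x. \<forall>b\<in>Basis. \<bar>x \<bullet> b\<bar> \<le> real N}.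
            \<bar>lim (\<lambda>n. X (dyadic_floor n x) \<omega>) - lim (\<lambda>n. X (dyadic_floor n y) \<omega>)\<bar> \<le> C * dist x y powr \<delta>"
          by (rule dyadic_chaining[OF \<delta>(1), of "max 1 A"]) (use main in auto)
        moreover have "K \<subseteq> {x. \<forall>b\<in>Basis. \<bar>x \<bullet> b\<bar> \<le> real N}"
          using R N by (auto intro: order_trans[OF Basis_le_norm] order_trans)
        ultimately show "\<exists>C. \<forall>x\<in>K. \<forall>y\<in>K. \<bar>v x \<omega> - v y \<omega>\<bar> \<le> C * dist x y powr \<delta>"
          unfolding v_def by (meson subsetD)
      qed
    qed
  qed
  have "v x \<in> borel_measurable M" for x unfolding v_def by measurable
  with mod have "modification_of M v X" by (simp add: modification_of_def)
  with holder show ?thesis by blast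
qed

section \<open>Spatial regularity of the stochastic wave equation\<close>

theorem proposition3:
  fixes H \<beta> t0 T :: real
    and f :: "'a::euclidean_space \<Rightarrow> real"
    and M :: "'w measure"
    and W :: "real \<Rightarrow> 'a set \<Rightarrow> 'w \<Rightarrow> real"
    and u :: "real \<Rightarrow> 'a \<Rightarrow> 'w \<Rightarrow> real"
  assumes "1 / 2 < H" and "H < 1"
    and "0 < t0" and "t0 < T"
    and "2 * H - 1 < \<beta>" and "\<beta> < min (real DIM('a)) (2 * H + 1)"
    and "prob_space M"
    and "riesz_kernel \<beta> f"
    and "fractional_colored_noise M H f W"
    and "wave_mild_solution M H \<beta> W u"
  shows "\<forall>t\<in>{t0..T}. \<exists>v. modification_of M v (u t) \<and>
    (\<forall>\<delta>. 0 < \<delta> \<and> \<delta> < min ((2 * H + 1 - \<beta>) / 2) 1 \<longrightarrow>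
      (AE \<omega> in M. holder_continuous \<delta> (\<lambda>x. v x \<omega>)))"
proof
  fix t assume "t \<in> {t0..T}"
  then have t: "t \<ge> 0" using assms(3) by simp
  have \<beta>: "0 < \<beta>" "\<beta> < real DIM('a)" "\<beta> < 2 * H + 1" using assms(1,5,6) by auto
  obtain k where k: "\<And>x. f x = k * norm x powr (- \<beta>)"
    using assms(8) unfolding riesz_kernel_def by blast
  obtain \<kappa> where \<kappa>: "\<kappa> \<ge> 0" "\<And>cs. elementary cs \<Longrightarrow>
     (LINT \<omega>|M. (elem_integral W cs \<omega>)\<^sup>2) \<le> \<kappa> * HP_energy H \<beta> (elem_hat cs)"
    using elem_integral_variance[OF assms(7) assms(1,2) \<beta>(1,2) k assms(9)] by blast
  have u: "wiener_integral M H \<beta> W (wave_kernel_hat t x) (u t x)" for x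
    using assms(10) t by (simp add: wave_mild_solution_def)
  note adm = wave_kernel_hat_admissible[OF assms(1,2) \<beta> t]
  show "\<exists>v. modification_of M v (u t) \<and>
    (\<forall>\<delta>. 0 < \<delta> \<and> \<delta> < min ((2 * H + 1 - \<beta>) / 2) 1 \<longrightarrow>
      (AE \<omega> in M. holder_continuous \<delta> (\<lambda>x. v x \<omega>)))"
  proof (rule kolmogorov_continuity)
    show "0 < min ((2 * H + 1 - \<beta>) / 2) 1" using \<beta> by simp
    show "u t x \<in> borel_measurable M" for x using u by (simp add: wiener_integral_def)
    fix \<delta> :: real and p :: nat
    assume \<delta>: "0 < \<delta>" "\<delta> < min ((2 * H + 1 - \<beta>) / 2) 1" and p: "0 < p"
    obtain C where C: "C \<ge> 0" "\<And>x y::'a. HP_energy H \<beta> (\<lambda>r \<xi>. wave_kernel_hat t x r \<xi> - wave_kernel_hat t y r \<xi>) \<le> C * dist x y powr (2 * \<delta>)"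
      using wave_increment_energy[OF assms(1,2) \<beta> t, of \<delta>] \<delta> by (auto simp: field_simps)
    define c where "c = fact (2 * p) / (2 ^ p * fact p :: real)"
    have "(\<integral>\<^sup>+ \<omega>. ennreal ((u t x \<omega> - u t y \<omega>) ^ (2 * p)) \<partial>M) \<le> ennreal (c * (2 * \<kappa> * C) ^ p * dist x y powr (2 * real p * \<delta>))" for x y
    proof -
      let ?V = "HP_energy H \<beta> (\<lambda>r \<xi>. wave_kernel_hat t x r \<xi> - wave_kernel_hat t y r \<xi>)"
      have V: "0 \<le> ?V"
        unfolding HP_norm_square[OF assms(1,2) HP_admissible_diff(1)[OF assms(1,2) adm adm], symmetric] by simp
      have "(2 * \<kappa> * ?V) ^ p \<le> (2 * \<kappa> * (C * dist x y powr (2 * \<delta>))) ^ p"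
        using \<kappa>(1) C(2)[of x y] V by (intro power_mono mult_left_mono) auto
      also have "\<dots> = (2 * \<kappa> * C) ^ p * (dist x y powr (2 * \<delta>)) ^ p"
        by (simp only: power_mult_distrib mult.assoc)
      also have "(dist x y powr (2 * \<delta>)) ^ p = dist x y powr (2 * real p * \<delta>)"
        using p by (cases "x = y") (simp_all add: powr_power mult_ac)
      finally have "c * (2 * \<kappa> * ?V) ^ p \<le> c * ((2 * \<kappa> * C) ^ p * dist x y powr (2 * real p * \<delta>))"
        by (rule mult_left_mono) (simp add: c_def)
      with wiener_integral_diff_moments[OF assms(7) assms(1,2) \<beta>(1,2) assms(9) \<kappa> u u adm adm, of x y p]
      show ?thesis unfolding c_def[symmetric] mult.assoc[symmetric]
        by (rule order_trans[OF _ ennreal_leI]) (simp only: mult.assoc)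
    qed
    moreover have "0 \<le> c * (2 * \<kappa> * C) ^ p" using \<kappa> C by (simp add: c_def)
    ultimately show "\<exists>C\<ge>0. \<forall>x y. (\<integral>\<^sup>+ \<omega>. ennreal ((u t x \<omega> - u t y \<omega>) ^ (2 * p)) \<partial>M) \<le> ennreal (C * dist x y powr (2 * real p * \<delta>))"
      by blast
  qed
qed

end
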